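(* Let $\tau$ be a partition of $N$ with $\tau_1\ge2$, and let $m$ be such that $\tau_1=\tau_2=\cdots=\tau_m>\tau_{m+1}$ (with $\tau_{m+1}=0$ if $m=\ell(\tau)$). Let $\alpha=(1^m,0^{N-m})$ and $\widehat{\alpha}=(0,1^{m-1},0^{N-m})$. Then $$\mathcal{D}_m\zeta_{\alpha,T_0}=\prod_{j=1}^{\tau_1-1}\frac{1+\kappa h(1,j)}{1+\kappa(h(1,j)-1)}\;\theta_m^{-1}\zeta_{\widehat{\alpha},T_0}.$$
   Context: $\tau$ is a partition of $N$ with length $\ell(\tau)$; the hook-length of node $(i,j)$ is $h(i,j)=\tau_i-j+\#\{k\colon i<k\le\ell(\tau),\ j\le\tau_k\}+1$. $\mathcal{Y}(\tau)$ is the set of reverse standard Young tableaux (fillings of the Ferrers diagram with $1,\dots,N$ decreasing along rows and columns); $c(i,T)=\operatorname{col}(i,T)-\operatorname{row}(i,T)$; $T_0\in\mathcal{Y}(\tau)$ is obtained by entering $N,N-1,\dots,1$ column by column (first column top to bottom, then second column, etc.). $V_\tau$ is the $\mathbb{R}(\kappa)$-space ($\kappa$ an indeterminate) with basis $\mathcal{Y}(\tau)$ and representation $\tau$ of $\mathcal{S}_N$ given on $s_i=(i,i+1)$ by: $\tau(s_i)T=T$ if $i,i+1$ share a row; $-T$ if they share a column; $T^{(i)}+\frac1bT$ if $b=c(i,T)-c(i+1,T)\ge2$; $(1-\frac1{b^2})T^{(i)}+\frac1bT$ if $b\le-2$ ($T^{(i)}$: $i,i+1$ interchanged). $\mathcal{P}_\tau=\mathcal{P}\otimes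 V_\tau$ with $\mathcal{S}_N$-action $w(x^\beta\otimes T)=(xw)^\beta\otimes\tau(w)T$, $(xw)_i=x_{w(i)}$. $\mathcal{D}_i(p\otimes T)=\frac{\partial p}{\partial x_i}\otimes T+\kappa\sum_{j\ne i}\frac{p(x)-p(x(i,j))}{x_i-x_j}\otimes\tau((i,j))T$; $\mathcal{U}_i(p\otimes T)=\mathcal{D}_i(x_ip\otimes T)-\kappa\sum_{j<i}p(x(i,j))\otimes\tau((i,j))T$. For $\beta\in\mathbb{N}_0^N$: $\beta^+$ is its nonincreasing rearrangement, rank $r_\beta(i)=\#\{j\colon\beta_j>\beta_i\}+\#\{j\le i\colon\beta_j=\beta_i\}$. $\beta\prec\gamma$ iff $\beta\ne\gamma$ and $\sum_{j\le i}\beta_j\le\sum_{j\le i}\gamma_j$ for all $i$; $\beta\lhd\gamma$ iff $|\beta|=|\gamma|$ and ($\beta^+\prec\gamma^+$ or ($\beta^+=\gamma^+$ and $\beta\prec\gamma$)). $\zeta_{\beta,T}$ is the unique element of the form $x^\beta\otimes\tau(r_\beta^{-1})T+\sum_{\gamma\lhd\beta}x^\gamma\otimes t_{\beta\gamma}(\kappa)$ with $\mathcal{U}_i\zeta_{\beta,T}=(\beta_i+1+\kappa c(r_\beta(i),T))\zeta_{\beta,T}$ for all $i$. $\theta_k=s_1s_2\cdots s_{k-1}\in\mathcal{S}_N$ ($\theta_1=1$), acting via the $\mathcal{S}_N$-action. *)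

theory Defs
  imports "HOL-Computational_Algebra.Polynomial" "HOL-Computational_Algebra.Fraction_Field"
          "HOL-Combinatorics.Permutations" "HOL-Combinatorics.Transposition"
          "HOL-Library.Function_Algebras"
begin

type_synonym K = "real poly fract"
definition kappa :: K where "kappa = Fract [:0, 1:] 1"

(* tableaux: maps cell (row, col) -> entry, 0 outside the Ferrers diagram *)
type_synonym tabl = "nat \<times> nat \<Rightarrow> nat"
(* elements of V_tau: coefficient functions on tableaux *)
type_synonym vec = "tabl \<Rightarrow> K"
(* exponent vectors beta, indexed 1..N (0 elsewhere) *)
type_synonym expo = "nat \<Rightarrow> nat"
(* elements of P_tau = P (x) V_tau: F beta T = coefficient of x^beta (x) T *)
type_synonym elem = "expo \<Rightarrow> vec"

definition is_partition :: "nat list \<Rightarrow> nat \<Rightarrow> bool" where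
  "is_partition tau N \<longleftrightarrow> sorted (rev tau) \<and> (\<forall>x\<in>set tau. 0 < x) \<and> sum_list tau = N"

definition part :: "nat list \<Rightarrow> nat \<Rightarrow> nat" where
  "part tau i = (if 1 \<le> i \<and> i \<le> length tau then tau ! (i - 1) else 0)"

definition diagram :: "nat list \<Rightarrow> (nat \<times> nat) set" where
  "diagram tau = {(i, j). 1 \<le> i \<and> i \<le> length tau \<and> 1 \<le> j \<and> j \<le> part tau i}"

definition hook :: "nat list \<Rightarrow> nat \<Rightarrow> nat \<Rightarrow> nat" where
  "hook tau i j = part tau i - j + card {k. i < k \<and> k \<le> length tau \<and> j \<le> part tau k} + 1"

definition Ytab :: "nat list \<Rightarrow> tabl set" where
  "Ytab tau = {T. (\<forall>c. c \<notin> diagram tau \<longrightarrow> T c = 0)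
     \<and> bij_betw T (diagram tau) {1..sum_list tau}
     \<and> (\<forall>i j j'. (i, j) \<in> diagram tau \<and> (i, j') \<in> diagram tau \<and> j < j' \<longrightarrow> T (i, j') < T (i, j))
     \<and> (\<forall>i i' j. (i, j) \<in> diagram tau \<and> (i', j) \<in> diagram tau \<and> i < i' \<longrightarrow> T (i', j) < T (i, j))}"

definition cell_of :: "nat list \<Rightarrow> tabl \<Rightarrow> nat \<Rightarrow> nat \<times> nat" where
  "cell_of tau T k = (THE c. c \<in> diagram tau \<and> T c = k)"

definition row :: "nat list \<Rightarrow> tabl \<Rightarrow> nat \<Rightarrow> nat" where
  "row tau T k = fst (cell_of tau T k)"

definition col :: "nat list \<Rightarrow> tabl \<Rightarrow> nat \<Rightarrow> nat" where
  "col tau T k = snd (cell_of tau T k)"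

definition content :: "nat list \<Rightarrow> tabl \<Rightarrow> nat \<Rightarrow> int" where
  "content tau T k = int (col tau T k) - int (row tau T k)"

(* T_0: enter N, N-1, ..., 1 column by column, each column top to bottom *)
definition T0 :: "nat list \<Rightarrow> tabl" where
  "T0 tau = (\<lambda>(i, j). if (i, j) \<in> diagram tau
      then sum_list tau + 1 - i - (\<Sum>r\<in>{1..length tau}. min (part tau r) (j - 1)) else 0)"

definition swap_entries :: "tabl \<Rightarrow> nat \<Rightarrow> tabl" where
  "swap_entries T i = (\<lambda>c. if T c = i then Suc i else if T c = Suc i then i else T c)"

definition basis :: "tabl \<Rightarrow> vec" where
  "basis T = (\<lambda>S. if S = T then 1 else 0)"

definition smult_vec :: "K \<Rightarrow> vec \<Rightarrow> vec" where
  "smult_vec c v = (\<lambda>S. c * v S)"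

definition rep_s_basis :: "nat list \<Rightarrow> nat \<Rightarrow> tabl \<Rightarrow> vec" where
  "rep_s_basis tau i T =
    (let b = content tau T i - content tau T (Suc i) in
     if row tau T i = row tau T (Suc i) then basis T
     else if col tau T i = col tau T (Suc i) then - basis T
     else if 2 \<le> b then basis (swap_entries T i) + smult_vec (1 / of_int b) (basis T)
     else if b \<le> -2 then smult_vec (1 - 1 / (of_int b)^2) (basis (swap_entries T i))
                          + smult_vec (1 / of_int b) (basis T)
     else 0)"

definition rep_s :: "nat list \<Rightarrow> nat \<Rightarrow> vec \<Rightarrow> vec" where
  "rep_s tau i v = (\<Sum>T\<in>Ytab tau. smult_vec (v T) (rep_s_basis tau i T))"

definition word_prod :: "nat list \<Rightarrow> (nat \<Rightarrow> nat)" where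
  "word_prod ws = foldr (\<lambda>i w. Transposition.transpose i (Suc i) \<circ> w) ws id"

definition word_rep :: "nat list \<Rightarrow> nat list \<Rightarrow> vec \<Rightarrow> vec" where
  "word_rep tau ws v = foldr (rep_s tau) ws v"

definition rep :: "nat list \<Rightarrow> (nat \<Rightarrow> nat) \<Rightarrow> vec \<Rightarrow> vec" where
  "rep tau w v = word_rep tau
     (SOME ws. set ws \<subseteq> {1..<sum_list tau} \<and> word_prod ws = w) v"

definition smult_el :: "K \<Rightarrow> elem \<Rightarrow> elem" where
  "smult_el c F = (\<lambda>beta S. c * F beta S)"

(* S_N action on P_tau: w (x^beta (x) T) = (xw)^beta (x) tau(w) T, i.e. x^(beta o w^-1) (x) tau(w) T *)
definition act :: "nat list \<Rightarrow> (nat \<Rightarrow> nat) \<Rightarrow> elem \<Rightarrow> elem" where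
  "act tau w F = (\<lambda>beta. rep tau w (F (beta \<circ> w)))"

definition Vact :: "nat list \<Rightarrow> (nat \<Rightarrow> nat) \<Rightarrow> elem \<Rightarrow> elem" where
  "Vact tau w F = (\<lambda>beta. rep tau w (F beta))"

definition mulx :: "nat \<Rightarrow> elem \<Rightarrow> elem" where
  "mulx i F = (\<lambda>beta S. if 0 < beta i then F (beta(i := beta i - 1)) S else 0)"

definition pderiv_x :: "nat \<Rightarrow> elem \<Rightarrow> elem" where
  "pderiv_x i F = (\<lambda>beta S. of_nat (Suc (beta i)) * F (beta(i := Suc (beta i))) S)"

definition divdiff :: "nat \<Rightarrow> nat \<Rightarrow> elem \<Rightarrow> elem" where
  "divdiff i j F = (THE Q. \<forall>beta S.
      F beta S - F (beta \<circ> Transposition.transpose i j) S = mulx i Q beta S - mulx j Q beta S)"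

definition Dop :: "nat list \<Rightarrow> nat \<Rightarrow> elem \<Rightarrow> elem" where
  "Dop tau i F = pderiv_x i F + smult_el kappa
     (\<Sum>j\<in>{1..sum_list tau} - {i}. Vact tau (Transposition.transpose i j) (divdiff i j F))"

definition Uop :: "nat list \<Rightarrow> nat \<Rightarrow> elem \<Rightarrow> elem" where
  "Uop tau i F = Dop tau i (mulx i F)
     - smult_el kappa (\<Sum>j\<in>{1..<i}. act tau (Transposition.transpose i j) F)"

definition rank :: "nat \<Rightarrow> expo \<Rightarrow> nat \<Rightarrow> nat" where
  "rank N beta i = card {j\<in>{1..N}. beta i < beta j} + card {j\<in>{1..i}. beta j = beta i}"

definition rank_perm :: "nat \<Rightarrow> expo \<Rightarrow> (nat \<Rightarrow> nat)" where
  "rank_perm N beta = (\<lambda>i. if i \<in> {1..N} then rank N beta i else i)"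

definition plus_rearr :: "nat \<Rightarrow> expo \<Rightarrow> expo" where
  "plus_rearr N beta = (THE g. (\<exists>w. w permutes {1..N} \<and> g = beta \<circ> w)
      \<and> (\<forall>i j. 1 \<le> i \<and> i \<le> j \<and> j \<le> N \<longrightarrow> g j \<le> g i))"

definition dom_lt :: "nat \<Rightarrow> expo \<Rightarrow> expo \<Rightarrow> bool" where
  "dom_lt N beta gamma \<longleftrightarrow> beta \<noteq> gamma \<and>
     (\<forall>i\<in>{1..N}. (\<Sum>j=1..i. beta j) \<le> (\<Sum>j=1..i. gamma j))"

definition tri_lt :: "nat \<Rightarrow> expo \<Rightarrow> expo \<Rightarrow> bool" where
  "tri_lt N beta gamma \<longleftrightarrow> (\<Sum>j=1..N. beta j) = (\<Sum>j=1..N. gamma j) \<and>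
     (dom_lt N (plus_rearr N beta) (plus_rearr N gamma)
      \<or> (plus_rearr N beta = plus_rearr N gamma \<and> dom_lt N beta gamma))"

definition supported :: "nat \<Rightarrow> expo \<Rightarrow> bool" where
  "supported N beta \<longleftrightarrow> (\<forall>k. k \<notin> {1..N} \<longrightarrow> beta k = 0)"

definition well_formed :: "nat list \<Rightarrow> elem \<Rightarrow> bool" where
  "well_formed tau F \<longleftrightarrow> (\<forall>beta S. F beta S \<noteq> 0 \<longrightarrow> supported (sum_list tau) beta \<and> S \<in> Ytab tau)"

definition zeta :: "nat list \<Rightarrow> expo \<Rightarrow> tabl \<Rightarrow> elem" where
  "zeta tau beta T = (THE F. well_formed tau F
     \<and> F beta = rep tau (inv (rank_perm (sum_list tau) beta)) (basis T)
     \<and> (\<forall>gamma. gamma \<noteq> beta \<and> \<not> tri_lt (sum_list tau) gamma beta \<longrightarrow> F gamma = 0)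
     \<and> (\<forall>i\<in>{1..sum_list tau}. Uop tau i F =
          smult_el (of_nat (beta i) + 1 + kappa * of_int (content tau T (rank_perm (sum_list tau) beta i))) F))"

end

theory Submission
  imports Defs
begin

text \<open>
  The exponents below \<open>(1\<^sup>m, 0, \<dots>)\<close> and \<open>(0, 1\<^sup>m\<^sup>-\<^sup>1, 0, \<dots>)\<close> are again 0-1 vectors, so both \<open>\<zeta>\<close> are
  square-free and can be handled as functions from sets to \<open>V\<^sub>\<tau>\<close>. They arise from \<open>x\<^sub>1\<cdots>x\<^sub>n \<otimes> T\<close>,
  an eigenvector for the order \<open>n+1, \<dots>, N, 1, \<dots>, n\<close> of the variables, by intertwining operators
  that exchange neighbours in this order. An eigenvector of \<open>\<U>\<^sub>j\<close>, \<open>j > m\<close>, is determined by its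
  leading coefficient. This gives \<open>\<D>\<^sub>j \<zeta> = 0\<close> for \<open>j > m\<close>, hence \<open>\<D>\<^sub>m \<zeta>\<close> has the eigenvalues of
  \<open>\<theta>\<^sub>m\<^sup>-\<^sup>1 \<zeta>\<close> for the smaller exponent and is a multiple of it. Its leading coefficient is
  \<open>A\<^sub>m\<^sub>+\<^sub>1 \<cdots> A\<^sub>N T\<^sub>0\<close> with \<open>A\<^sub>l = 1 + \<epsilon>\<^sub>l (m l)\<close>; the product of the \<open>1 - \<epsilon>\<^sub>l (m l)\<close> in the opposite
  order is computed from the Jucys-Murphy eigenvalues, so the factor is a product of the
  \<open>1 - \<epsilon>\<^sub>l\<^sup>2\<close>, which telescopes along the columns of \<open>\<tau>\<close>.
\<close>

text \<open>The definitions rest on choices: \<open>rep\<close> evaluates some word for a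
  permutation, while \<open>divdiff\<close>, \<open>plus_rearr\<close> and \<open>zeta\<close> are
  definite descriptions. Hence the Coxeter presentation of the symmetric group and the relations for
  Young's matrices have to be proved, and each \<open>zeta\<close> needs existence and uniqueness.
  Uniqueness is arithmetic: at the largest index of a support set the equation makes the coefficient
  an eigenvector, with eigenvalue z - 1/kappa for an integer z, of a sum of transpositions through
  one index; such a sum is conjugate to a Jucys-Murphy element, which has integer eigenvalues. The
  same fact 1 + kappa z \<noteq> 0 keeps the denominators of the intertwiners nonzero, because they
  only exchange an index \<le> n with one > n. D_j zeta vanishes for j > m because, by uniqueness,
  s_i with i > m acts on the zetas of all tableaux as on the tableaux; so the sum of the (j l), l >
  j, acts by the content of j, and the equation for U_j leaves x_j D_j zeta = 0. Adding these zeros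
  to D_m zeta gives access to its leading coefficient: in the sum over j \<ge> m the kappa-terms
  cancel in pairs.\<close>

abbreviation tr :: "nat \<Rightarrow> nat \<Rightarrow> nat \<Rightarrow> nat" where
  "tr \<equiv> Transposition.transpose"

lemmas tr_def = Transposition.transpose_def and tr_commute = Transposition.transpose_commute

section \<open>Words in the adjacent transpositions\<close>

text \<open>Generated by the Coxeter relations of type A. \<open>rep\<close> evaluates an
  unspecified word with the right product, so its value is controlled only once words with equal
  product are known to be linked by these relations.\<close>

inductive coxeq :: "nat \<Rightarrow> nat list \<Rightarrow> nat list \<Rightarrow> bool" for N where
  coxeq_refl: "coxeq N a a"
| coxeq_sym: "coxeq N a b \<Longrightarrow> coxeq N b a"
| coxeq_trans: "coxeq N a b \<Longrightarrow> coxeq N b c \<Longrightarrow> coxeq N a c"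
| coxeq_app: "coxeq N a b \<Longrightarrow> coxeq N c d \<Longrightarrow> coxeq N (a @ c) (b @ d)"
| coxeq_sq: "1 \<le> i \<Longrightarrow> i < N \<Longrightarrow> coxeq N [i, i] []"
| coxeq_braid: "1 \<le> i \<Longrightarrow> Suc i < N \<Longrightarrow> coxeq N [i, Suc i, i] [Suc i, i, Suc i]"
| coxeq_comm: "1 \<le> i \<Longrightarrow> Suc i < j \<Longrightarrow> j < N \<Longrightarrow> coxeq N [i, j] [j, i]"

text \<open>Stated for any family of maps satisfying the relations, since it serves both composition
  with transpositions and the operators \<open>young_op\<close>.\<close>

lemma foldr_coxeq:
  assumes "coxeq N a b"
    and sq: "\<And>i x. 1 \<le> i \<Longrightarrow> i < N \<Longrightarrow> f i (f i x) = x"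
    and braid: "\<And>i x. 1 \<le> i \<Longrightarrow> Suc i < N \<Longrightarrow> f i (f (Suc i) (f i x)) = f (Suc i) (f i (f (Suc i) x))"
    and comm: "\<And>i j x. 1 \<le> i \<Longrightarrow> Suc i < j \<Longrightarrow> j < N \<Longrightarrow> f i (f j x) = f j (f i x)"
  shows "foldr f a x = foldr f b x"
  using assms(1) by (induction arbitrary: x) (auto simp: sq braid intro: comm)

lemma word_prod_Nil [simp]: "word_prod [] = id"
  and word_prod_Cons [simp]: "word_prod (i # ws) = tr i (Suc i) \<circ> word_prod ws"
  by (simp_all add: word_prod_def)

lemma word_prod_append [simp]: "word_prod (a @ b) = word_prod a \<circ> word_prod b"
  by (induction a) (simp_all add: comp_assoc)

lemma word_prod_permutes:
  "set ws \<subseteq> {1..<N} \<Longrightarrow> word_prod ws permutes {1..N}"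
proof (induction ws)
  case (Cons i ws)
  then have "tr i (Suc i) permutes {1..N}"
    by (intro permutes_swap_id) auto
  with Cons show ?case by (simp add: permutes_compose del: o_apply)
qed (simp add: permutes_id[unfolded id_def] id_def)

lemma coxeq_word_prod: "coxeq N a b \<Longrightarrow> word_prod a = word_prod b"
  unfolding word_prod_def
proof (rule foldr_coxeq, assumption)
qed (auto simp: fun_eq_iff tr_def)

text \<open>The word \<open>n, n-1, ..., n-d+1\<close>. For d = 0, ..., n these words represent the
  cosets of S_n in S_(n+1), where S_n is generated by the letters below n.\<close>

fun desc :: "nat \<Rightarrow> nat \<Rightarrow> nat list" where
  "desc n 0 = []"
| "desc n (Suc d) = n # desc (n - 1) d"

lemma set_desc: "d \<le> n \<Longrightarrow> set (desc n d) = {n - d<..n}"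
  by (induction n d rule: desc.induct) auto

lemma desc_snoc: "d < n \<Longrightarrow> desc n (Suc d) = desc n d @ [n - d]"
  by (induction n d rule: desc.induct) auto

lemma word_prod_desc: "d \<le> n \<Longrightarrow> word_prod (desc n d) (Suc n - d) = Suc n"
proof (induction n d rule: desc.induct)
  case (2 n d)
  then have "Suc (n - 1) = n" by simp
  with 2 show ?case by (simp add: Suc_diff_le)
qed simp

lemma coxeq_comm_word:
  assumes "\<And>i. i \<in> set ws \<Longrightarrow> Suc j < i \<and> i < N" "1 \<le> j"
  shows "coxeq N (ws @ [j]) (j # ws)"
  using assms(1)
proof (induction ws)
  case (Cons i ws)
  have "coxeq N ([i] @ (ws @ [j])) ([i] @ (j # ws))"
    using Cons by (intro coxeq_app coxeq_refl) auto
  moreover have "coxeq N ([i, j] @ ws) ([j, i] @ ws)"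
    using Cons assms by (intro coxeq_app coxeq_refl coxeq_sym[OF coxeq_comm]) auto
  ultimately show ?case by (auto intro: coxeq_trans)
qed (simp add: coxeq_refl)

lemma coxeq_comm_word':
  assumes "\<And>i. i \<in> set ws \<Longrightarrow> 1 \<le> i \<and> Suc i < j" "j < N"
  shows "coxeq N (ws @ [j]) (j # ws)"
  using assms(1)
proof (induction ws)
  case (Cons i ws)
  have "coxeq N ([i] @ (ws @ [j])) ([i] @ (j # ws))"
    using Cons by (intro coxeq_app coxeq_refl) auto
  moreover have "coxeq N ([i, j] @ ws) ([j, i] @ ws)"
    using Cons assms by (intro coxeq_app coxeq_refl coxeq_comm) auto
  ultimately show ?case by (auto intro: coxeq_trans)
qed (simp add: coxeq_refl)

text \<open>For \<open>n - d + 1 < j \<le> n\<close> the braid relation moves the letter \<open>j\<close> through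
  \<open>[n, n - 1, \<dots>, n - d + 1]\<close>, lowering it by one.\<close>

lemma coxeq_desc_pass:
  assumes "d \<le> n" "n < N" "Suc (n - d) < j" "j \<le> n"
  shows "coxeq N (desc n d @ [j]) ((j - 1) # desc n d)"
  using assms
proof (induction n d rule: desc.induct)
  case (2 n d)
  show ?case
  proof (cases "j = n")
    case True
    then obtain d' n' where d: "d = Suc d'" "n = Suc n'" using 2 by (cases d; cases n) auto
    have "n' \<ge> 1" using 2 True d by auto
    have "coxeq N ([n, n'] @ (desc (n' - 1) d' @ [n])) ([n, n'] @ (n # desc (n' - 1) d'))"
      using 2 d by (intro coxeq_app coxeq_refl coxeq_comm_word') (auto simp: set_desc)
    moreover have "coxeq N ([n, n', n] @ desc (n' - 1) d') ([n', n, n'] @ desc (n' - 1) d')"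
      using 2 d \<open>n' \<ge> 1\<close> by (intro coxeq_app coxeq_refl) (auto intro!: coxeq_sym[OF coxeq_braid])
    ultimately show ?thesis using d True by (auto intro: coxeq_trans)
  next
    case False
    have "coxeq N ([n] @ (desc (n - 1) d @ [j])) ([n] @ ((j - 1) # desc (n - 1) d))"
      using 2 False by (intro coxeq_app coxeq_refl) auto
    moreover have "coxeq N ([n, j - 1] @ desc (n - 1) d) ([j - 1, n] @ desc (n - 1) d)"
      using 2 False by (intro coxeq_app coxeq_refl coxeq_sym[OF coxeq_comm]) auto
    ultimately show ?thesis by (auto intro: coxeq_trans)
  qed
qed simp

text \<open>A letter j appended to \<open>desc n d\<close> either commutes to its front, prolongs
  it, cancels its last letter, or passes through it as j - 1. Whatever emerges on the left is a
  letter below n.\<close>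

lemma coxeq_normal_form:
  assumes "set ws \<subseteq> {1..n}" "n < N"
  shows "\<exists>us d. set us \<subseteq> {1..<n} \<and> d \<le> n \<and> coxeq N ws (us @ desc n d)"
  using assms(1)
proof (induction ws rule: rev_induct)
  case Nil
  show ?case by (rule exI[of _ "[]"], rule exI[of _ 0]) (simp add: coxeq_refl)
next
  case (snoc j ws)
  then obtain us d where us: "set us \<subseteq> {1..<n}" "d \<le> n" "coxeq N ws (us @ desc n d)" by auto
  have j: "1 \<le> j" "j \<le> n" using snoc.prems by auto
  have step: "coxeq N (ws @ [j]) (us @ desc n d @ [j])"
    using coxeq_app[OF us(3) coxeq_refl[of N "[j]"]] by simp
  have key: ?case if "set vs \<subseteq> {1..<n}" "e \<le> n" "coxeq N (desc n d @ [j]) (vs @ desc n e)" for vs e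
  proof -
    have "coxeq N (us @ desc n d @ [j]) (us @ vs @ desc n e)"
      using coxeq_app[OF coxeq_refl that(3), of us] by simp
    with step have "coxeq N (ws @ [j]) ((us @ vs) @ desc n e)" by (auto intro: coxeq_trans)
    then show ?thesis using that us by (intro exI[of _ "us @ vs"] exI[of _ e]) auto
  qed
  consider "j < n - d" | "j = n - d" | "j = Suc (n - d)" | "Suc (n - d) < j" by linarith
  then show ?case
  proof cases
    case 1
    have "coxeq N (desc n d @ [j]) (j # desc n d)"
      using 1 us j assms(2) by (intro coxeq_comm_word) (auto simp: set_desc)
    then show ?thesis using 1 us j by (intro key[of "[j]" d]) auto
  next
    case 2
    then have "coxeq N (desc n d @ [j]) ([] @ desc n (Suc d))"
      using j us by (subst desc_snoc) (auto intro: coxeq_refl)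
    then show ?thesis using 2 us j by (intro key[of "[]" "Suc d"]) auto
  next
    case 3
    then obtain d' where d: "d = Suc d'" using j us by (cases d) auto
    then have eq: "desc n d @ [j] = desc n d' @ [j, j]" using 3 us desc_snoc[of d' n] by auto
    have "coxeq N (desc n d' @ [j, j]) (desc n d' @ [])"
      using j assms by (intro coxeq_app coxeq_refl coxeq_sq) auto
    then show ?thesis unfolding eq[symmetric] using us d by (intro key[of "[]" d']) auto
  next
    case 4
    then have "coxeq N (desc n d @ [j]) ([j - 1] @ desc n d)"
      using coxeq_desc_pass[of d n N j] us j assms by auto
    then show ?thesis using 4 us j by (intro key[of "[j - 1]" d]) auto
  qed
qed

text \<open>Induction on the largest letter. In normal form \<open>d\<close> can be read off from
  the preimage of n + 1 under the product; cancelling the common \<open>desc\<close> leaves two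
  words in smaller letters with equal product.\<close>

theorem coxeq_iff_word_prod:
  assumes "set a \<subseteq> {1..<N}" "set b \<subseteq> {1..<N}" "word_prod a = word_prod b"
  shows "coxeq N a b"
proof -
  have "coxeq N a b" if "set a \<subseteq> {1..n}" "set b \<subseteq> {1..n}" "word_prod a = word_prod b" "n < N" for n a b
    using that
  proof (induction n arbitrary: a b)
    case 0
    then show ?case by (simp add: coxeq_refl)
  next
    case (Suc n)
    let ?n = "Suc n"
    obtain us d where us: "set us \<subseteq> {1..<?n}" "d \<le> ?n" "coxeq N a (us @ desc ?n d)"
      using coxeq_normal_form[of a ?n N] Suc.prems by auto
    obtain vs e where vs: "set vs \<subseteq> {1..<?n}" "e \<le> ?n" "coxeq N b (vs @ desc ?n e)"
      using coxeq_normal_form[of b ?n N] Suc.prems by auto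
    have eq: "word_prod us \<circ> word_prod (desc ?n d) = word_prod vs \<circ> word_prod (desc ?n e)"
      using coxeq_word_prod[OF us(3)] coxeq_word_prod[OF vs(3)] Suc.prems(3)
      unfolding word_prod_append by metis
    have pu: "word_prod us permutes {1..?n}" and pv: "word_prod vs permutes {1..?n}"
      using word_prod_permutes us vs by auto
    have pd: "word_prod (desc ?n e) permutes {1..Suc ?n}" "word_prod (desc ?n d) permutes {1..Suc ?n}"
      using us vs by (intro word_prod_permutes; auto simp: set_desc)+
    have fu: "word_prod us (Suc ?n) = Suc ?n" and fv: "word_prod vs (Suc ?n) = Suc ?n"
      using permutes_not_in[OF pu] permutes_not_in[OF pv] by auto
    have "(word_prod us \<circ> word_prod (desc ?n d)) (Suc ?n - d) = Suc ?n"
      using fu word_prod_desc[OF us(2)] by simp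
    moreover have "(word_prod us \<circ> word_prod (desc ?n d)) (Suc ?n - e) = Suc ?n"
      unfolding eq using fv word_prod_desc[OF vs(2)] by simp
    moreover have "inj (word_prod us \<circ> word_prod (desc ?n d))"
      using permutes_inj[OF pu] permutes_inj[OF pd(2)] by (rule inj_compose)
    ultimately have "Suc ?n - d = Suc ?n - e" by (metis injD)
    with us vs have de: "d = e" by simp
    have "word_prod us = word_prod vs"
    proof
      fix x
      obtain y where "x = word_prod (desc ?n e) y"
        using permutes_surj[OF pd(1)] by (metis surj_def)
      then show "word_prod us x = word_prod vs x" using eq de by (metis comp_apply)
    qed
    then have "coxeq N us vs" using Suc us vs by (intro Suc.IH) auto
    then have "coxeq N (us @ desc ?n d) (vs @ desc ?n e)"
      using de by (auto intro: coxeq_app coxeq_refl)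
    then show ?case using us(3) vs(3) by (meson coxeq_trans coxeq_sym)
  qed
  note this[of a "N - 1" b]
  with assms show ?thesis
    by (cases N; cases "N - 1") (auto simp: coxeq_refl atLeastLessThanSuc_atLeastAtMost)
qed

lemma word_prod_surj:
  "w permutes {1..N} \<Longrightarrow> \<exists>ws. set ws \<subseteq> {1..<N} \<and> word_prod ws = w"
proof (induction N arbitrary: w)
  case 0
  then show ?case by (intro exI[of _ "[]"]) auto
next
  case (Suc n)
  define k where "k = inv w (Suc n)"
  have wk: "w k = Suc n" using permutes_inverses(1)[OF Suc.prems] by (simp add: k_def)
  then have k: "1 \<le> k" "k \<le> Suc n" using permutes_in_image[OF Suc.prems, of k] by auto
  \<comment> \<open>With this length the product of \<open>desc n d\<close> sends k to n + 1, so
    \<open>w\<close> composed with its inverse fixes n + 1.\<close>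
  define d where "d = Suc n - k"
  have d: "d \<le> n" "Suc n - d = k" using k by (auto simp: d_def)
  let ?u = "word_prod (desc n d)"
  have u: "?u permutes {1..Suc n}" using d by (intro word_prod_permutes) (auto simp: set_desc)
  have uk: "?u k = Suc n" using word_prod_desc[OF d(1)] d by simp
  have p: "w \<circ> inv ?u permutes {1..Suc n}"
    using u Suc.prems by (intro permutes_compose permutes_inv)
  moreover have "(w \<circ> inv ?u) (Suc n) = Suc n"
    using uk wk permutes_inverses(2)[OF u, of k] by simp
  ultimately have "w \<circ> inv ?u permutes {1..n}"
    by (intro permutes_superset[OF p]) (auto simp: le_Suc_eq)
  then obtain ws where ws: "set ws \<subseteq> {1..<n}" "word_prod ws = w \<circ> inv ?u" using Suc.IH by blast
  have "word_prod (ws @ desc n d) = w"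
    using ws permutes_inv_o(2)[OF u] by (simp add: comp_assoc)
  then show ?case using ws d
    by (intro exI[of _ "ws @ desc n d"]) (fastforce simp: set_desc)
qed

declare One_nat_def [simp del]

section \<open>The operators on square-free elements\<close>

text \<open>Linearity is asked for every \<open>w\<close>, multiplicativity only for permutations of
  \<open>{1..N}\<close>: elsewhere the instance \<open>yrep\<close> is still linear, but
  unspecified.\<close>

locale sym_rep = vector_space scale
  for scale :: "'k::field \<Rightarrow> 'v::ab_group_add \<Rightarrow> 'v" (infixr "*s" 75) +
  fixes N :: nat and P :: "(nat \<Rightarrow> nat) \<Rightarrow> 'v \<Rightarrow> 'v" and k :: 'k
  assumes P_add: "P w (u + v) = P w u + P w v"
    and P_scale: "P w (c *s v) = c *s P w v"
    and P_comp: "w permutes {1..N} \<Longrightarrow> w' permutes {1..N} \<Longrightarrow> P (w \<circ> w') v = P w (P w' v)"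
    and P_id: "P id v = v"
begin

lemma P_zero [simp]: "P w 0 = 0"
  using P_scale[of w 0 0] by simp

lemma P_minus: "P w (- v) = - P w v"
  using P_add[of w v "- v"] by (simp add: eq_neg_iff_add_eq_0 add.commute)

lemma P_diff: "P w (u - v) = P w u - P w v"
  using P_add[of w u "- v"] by (simp add: P_minus)

lemma P_sum: "P w (\<Sum>x\<in>A. f x) = (\<Sum>x\<in>A. P w (f x))"
  by (induction A rule: infinite_finite_induct) (simp_all add: P_add)

lemma tr_permutes: "i \<in> {1..N} \<Longrightarrow> j \<in> {1..N} \<Longrightarrow> tr i j permutes {1..N}"
  by (rule permutes_swap_id)

lemma P_tr_tr: "i \<in> {1..N} \<Longrightarrow> j \<in> {1..N} \<Longrightarrow> P (tr i j) (P (tr i j) v) = v"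
  by (subst P_comp[symmetric]) (simp_all add: tr_permutes P_id del: o_apply)

lemma P_conj:
  assumes "w permutes {1..N}" "i \<in> {1..N}" "j \<in> {1..N}"
  shows "P w (P (tr i j) v) = P (tr (w i) (w j)) (P w v)"
proof -
  have "w \<circ> tr i j = tr (w i) (w j) \<circ> w"
    using permutes_inj[OF assms(1)] by (auto simp: fun_eq_iff tr_def dest: injD)
  moreover have "w i \<in> {1..N}" "w j \<in> {1..N}"
    using assms permutes_in_image[OF assms(1)] by auto
  ultimately show ?thesis
    using assms P_comp[OF assms(1) tr_permutes] P_comp[OF tr_permutes assms(1)] by metis
qed

text \<open>The Jucys-Murphy elements suited to decreasing fillings: larger indices are summed, so
  \<open>J N\<close> is zero, in agreement with N occupying the corner of content 0.\<close>

definition J :: "nat \<Rightarrow> 'v \<Rightarrow> 'v" where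
  "J i v = (\<Sum>j\<in>{i<..N}. P (tr i j) v)"

text \<open>A square-free element \<open>\<Sum>\<^sub>R x\<^sup>R \<otimes> h R\<close> is represented by its coefficient function \<open>h\<close>
  on subsets \<open>R\<close> of \<open>{1..N}\<close>.\<close>

definition sact :: "(nat \<Rightarrow> nat) \<Rightarrow> (nat set \<Rightarrow> 'v) \<Rightarrow> nat set \<Rightarrow> 'v" where
  "sact w h R = P w (h (w -` R))"

text \<open>For square-free p the quotient of p - p(x(i,j)) by x_i - x_j is free of x_i and x_j and
  has the coefficient \<open>h (insert i R) - h (insert j R)\<close> at R; the derivative is free of
  x_i too. Hence the value 0 for \<open>i \<in> R\<close> and the sum over j outside R.\<close>

definition sD :: "nat \<Rightarrow> (nat set \<Rightarrow> 'v) \<Rightarrow> nat set \<Rightarrow> 'v" where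
  "sD i h R = (if i \<in> R then 0 else h (insert i R) +
     k *s (\<Sum>j\<in>{1..N} - R - {i}. P (tr i j) (h (insert i R) - h (insert j R))))"

definition xD :: "nat \<Rightarrow> (nat set \<Rightarrow> 'v) \<Rightarrow> nat set \<Rightarrow> 'v" where
  "xD i h R = (if i \<in> R then sD i h (R - {i}) else 0)"

definition sJ :: "nat set \<Rightarrow> nat \<Rightarrow> (nat set \<Rightarrow> 'v) \<Rightarrow> nat set \<Rightarrow> 'v" where
  "sJ Q i h R = (\<Sum>j\<in>Q. sact (tr i j) h R)"

text \<open>On square-free elements \<open>\<U>\<^sub>i = x\<^sub>i \<D>\<^sub>i + 1 + \<kappa> \<Sum>\<^sub>j\<^sub>>\<^sub>i (i j)\<close>. Replacing \<open>{i<..N}\<close> by the set \<open>Q\<close> of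
  the indices that follow \<open>i\<close> in some other order of \<open>{1..N}\<close> gives a conjugate commuting family.\<close>

definition sU :: "nat set \<Rightarrow> nat \<Rightarrow> (nat set \<Rightarrow> 'v) \<Rightarrow> nat set \<Rightarrow> 'v" where
  "sU Q i h R = xD i h R + h R + k *s sJ Q i h R"

lemma sact_add: "sact w (\<lambda>R. f R + c *s g R) R = sact w f R + c *s sact w g R"
  by (simp add: sact_def P_add P_scale)

lemma sD_add: "sD i (\<lambda>R. f R + c *s g R) R = sD i f R + c *s sD i g R"
proof (cases "i \<in> R")
  case False
  have "P (tr i j) (f A + c *s g A - (f B + c *s g B)) =
      P (tr i j) (f A - f B) + c *s P (tr i j) (g A - g B)" for j A B
    by (simp add: P_add P_diff P_scale algebra_simps)
  with False show ?thesis
    by (simp add: sD_def sum.distrib scale_sum_right[symmetric] scale_right_distrib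
        scale_left_commute[of c k])
qed (simp add: sD_def)

lemma xD_add: "xD i (\<lambda>R. f R + c *s g R) R = xD i f R + c *s xD i g R"
  by (simp add: xD_def sD_add)

lemma sJ_add: "sJ Q i (\<lambda>R. f R + c *s g R) R = sJ Q i f R + c *s sJ Q i g R"
  by (simp add: sJ_def sact_add sum.distrib scale_sum_right)

lemma sU_add: "sU Q i (\<lambda>R. f R + c *s g R) R = sU Q i f R + c *s sU Q i g R"
  by (simp add: sU_def xD_add sJ_add scale_right_distrib scale_left_commute)

lemma sact_comp:
  assumes "u permutes {1..N}" "w permutes {1..N}"
  shows "sact (u \<circ> w) h = sact u (sact w h)"
  by (rule ext) (simp only: sact_def P_comp[OF assms] vimage_comp[symmetric])

lemma sact_id: "sact id h = h"
  by (simp add: sact_def fun_eq_iff P_id)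

lemma sact_tr_tr: "i \<in> {1..N} \<Longrightarrow> j \<in> {1..N} \<Longrightarrow> sact (tr i j) (sact (tr i j) h) = h"
  by (simp add: sact_comp[symmetric] tr_permutes sact_id del: o_apply)

lemma sact_conj:
  assumes "w permutes {1..N}" "i \<in> {1..N}" "j \<in> {1..N}"
  shows "sact (tr (w i) (w j)) (sact w h) = sact w (sact (tr i j) h)"
proof -
  have "w i \<in> {1..N}" "w j \<in> {1..N}" using assms permutes_in_image[OF assms(1)] by auto
  moreover have "tr (w i) (w j) \<circ> w = w \<circ> tr i j"
    using permutes_inj[OF assms(1)] by (auto simp: fun_eq_iff tr_def dest: injD)
  ultimately show ?thesis
    using assms by (metis sact_comp tr_permutes)
qed

lemma sD_sact:
  assumes w: "w permutes {1..N}" and i: "i \<in> {1..N}"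
  shows "sD (w i) (sact w h) R = sact w (sD i h) R"
proof (cases "w i \<in> R")
  case False
  have ins: "w -` insert (w j) R = insert j (w -` R)" for j
    using permutes_inj[OF w] by (auto dest: injD)
  have img: "w ` ({1..N} - w -` R - {i}) = {1..N} - R - {w i}"
    using permutes_image[OF w] permutes_inj[OF w] by (auto simp: inj_eq)
  have "(\<Sum>j\<in>{1..N} - R - {w i}. P (tr (w i) j) (sact w h (insert (w i) R) - sact w h (insert j R)))
      = (\<Sum>j\<in>{1..N} - w -` R - {i}. P (tr (w i) (w j)) (sact w h (insert (w i) R) - sact w h (insert (w j) R)))"
    unfolding img[symmetric]
    by (subst sum.reindex) (auto intro: inj_on_subset[OF permutes_inj[OF w]])
  also have "\<dots> = (\<Sum>j\<in>{1..N} - w -` R - {i}. P w (P (tr i j) (h (insert i (w -` R)) - h (insert j (w -` R)))))"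
    using i by (intro sum.cong refl) (simp add: P_conj[OF w] sact_def ins P_diff)
  finally show ?thesis using False
    by (simp add: sD_def sact_def ins P_add P_scale P_sum)
qed (simp add: sD_def sact_def)

lemma xD_sact:
  assumes w: "w permutes {1..N}" and i: "i \<in> {1..N}"
  shows "xD (w i) (sact w h) R = sact w (xD i h) R"
proof -
  have "w -` (R - {w i}) = w -` R - {i}" using permutes_inj[OF w] by (auto dest: injD)
  then show ?thesis using sD_sact[OF assms] by (auto simp: xD_def sact_def)
qed

lemma sJ_sact:
  assumes w: "w permutes {1..N}" and i: "i \<in> {1..N}" and Q: "Q \<subseteq> {1..N}"
  shows "sJ (w ` Q) (w i) (sact w h) R = sact w (sJ Q i h) R"
proof -
  have "sJ (w ` Q) (w i) (sact w h) R = (\<Sum>j\<in>Q. sact (tr (w i) (w j)) (sact w h) R)"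
    unfolding sJ_def by (subst sum.reindex) (auto intro: inj_on_subset[OF permutes_inj[OF w]])
  also have "\<dots> = (\<Sum>j\<in>Q. sact w (sact (tr i j) h) R)"
    using Q by (intro sum.cong refl) (auto simp: sact_conj[OF w i] subset_iff)
  finally show ?thesis by (simp add: sJ_def sact_def P_sum)
qed

lemma sU_sact:
  assumes "w permutes {1..N}" "i \<in> {1..N}" "Q \<subseteq> {1..N}"
  shows "sU (w ` Q) (w i) (sact w h) R = sact w (sU Q i h) R"
  using xD_sact[OF assms(1,2)] sJ_sact[OF assms] by (simp add: sU_def sact_def P_add P_scale)

lemma sU_tr_commute:
  assumes "i \<in> {1..N}" "j \<in> {1..N}" "a \<in> {1..N}" "Q \<subseteq> {1..N}" "a \<noteq> i" "a \<noteq> j" "i \<in> Q \<longleftrightarrow> j \<in> Q"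
  shows "sU Q a (sact (tr i j) h) R = sact (tr i j) (sU Q a h) R"
proof -
  have "tr i j ` Q = Q" using assms(7) by (auto simp: tr_def image_iff)
  moreover have "tr i j a = a" using assms by simp
  ultimately show ?thesis using sU_sact[OF tr_permutes[OF assms(1,2)] assms(3,4)] by metis
qed

lemma sU_insert:
  "finite Q \<Longrightarrow> j \<notin> Q \<Longrightarrow> sU (insert j Q) i h R = sU Q i h R + k *s sact (tr i j) h R"
  by (simp add: sU_def sJ_def scale_right_distrib algebra_simps)

text \<open>Together with \<open>sU_insert\<close> this is the degenerate affine Hecke relation.\<close>

lemma sU_tr_left:
  assumes "i \<in> {1..N}" "j \<in> {1..N}" "Q \<subseteq> {1..N}" "i \<noteq> j" "i \<notin> Q" "j \<notin> Q"
  shows "sU Q i (sact (tr i j) h) R = sact (tr i j) (sU Q j h) R"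
proof -
  have "tr i j ` Q = Q" using assms by (auto simp: tr_def image_iff)
  then show ?thesis using sU_sact[OF tr_permutes[OF assms(1,2)] assms(2,3)] by simp
qed

section \<open>Eigenvectors for an arbitrary order of the variables, and their intertwiners\<close>

fun eigen :: "(nat \<Rightarrow> 'k) \<Rightarrow> nat list \<Rightarrow> (nat set \<Rightarrow> 'v) \<Rightarrow> bool" where
  "eigen \<xi> [] h = True"
| "eigen \<xi> (i # q) h = ((\<forall>R. sU (set q) i h R = \<xi> i *s h R) \<and> eigen \<xi> q h)"

text \<open>The standard intertwiner of the degenerate affine Hecke algebra, multiplied by the
  transposition. Instead of exchanging the two eigenvalues it exchanges i and j in the order of the
  variables, and each index keeps its eigenvalue.\<close>

definition intertwine :: "(nat \<Rightarrow> 'k) \<Rightarrow> nat \<Rightarrow> nat \<Rightarrow> (nat set \<Rightarrow> 'v) \<Rightarrow> nat set \<Rightarrow> 'v" where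
  "intertwine \<xi> i j h R = h R + (k / (\<xi> j - \<xi> i)) *s sact (tr i j) h R"

lemma eigen_commute:
  assumes "sU Q a h = (\<lambda>R. \<xi> a *s h R)"
    and "i \<in> {1..N}" "j \<in> {1..N}" "a \<in> {1..N}" "Q \<subseteq> {1..N}" "a \<noteq> i" "a \<noteq> j" "i \<in> Q \<longleftrightarrow> j \<in> Q"
  shows "sU Q a (intertwine \<xi> i j h) R = \<xi> a *s intertwine \<xi> i j h R"
proof -
  have "sU Q a (intertwine \<xi> i j h) R
      = sU Q a h R + (k / (\<xi> j - \<xi> i)) *s sact (tr i j) (sU Q a h) R"
    unfolding intertwine_def sU_add sU_tr_commute[OF assms(2-8)] ..
  then show ?thesis
    by (simp add: assms(1) intertwine_def sact_def P_scale scale_right_distrib scale_left_commute)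
qed

text \<open>For an index before or after the pair, the set of successors contains both or neither of
  i and j, so its operator commutes with the transposition. For the pair itself the Hecke relation
  reduces the claim to the identity \<open>c\<close> for the coefficient.\<close>

lemma eigen_intertwine:
  assumes "eigen \<xi> (p @ i # j # q) h" "distinct (p @ i # j # q)"
    "set (p @ i # j # q) \<subseteq> {1..N}" "\<xi> i \<noteq> \<xi> j"
  shows "eigen \<xi> (p @ j # i # q) (intertwine \<xi> i j h)"
  using assms
proof (induction p)
  case Nil
  let ?Q = "set q" let ?c = "k / (\<xi> j - \<xi> i)" let ?t = "sact (tr i j)"
  have ij: "i \<in> {1..N}" "j \<in> {1..N}" "i \<noteq> j" "i \<notin> ?Q" "j \<notin> ?Q" "?Q \<subseteq> {1..N}" using Nil by auto
  have Ui: "sU ?Q i h R + k *s ?t h R = \<xi> i *s h R" for R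
    using Nil(1) ij by (simp add: sU_insert)
  have Ui': "sU ?Q i h = (\<lambda>R. \<xi> i *s h R - k *s ?t h R)"
    using Ui by (auto simp: fun_eq_iff eq_diff_eq)
  have Uj: "sU ?Q j h = (\<lambda>R. \<xi> j *s h R)" using Nil(1) by auto
  have c: "?c * \<xi> j = k + ?c * \<xi> i" using Nil(4) by (simp add: field_simps)
  have tt: "?t (?t f) R = f R" for f R using ij by (simp add: sact_tr_tr)
  have lin: "?t (\<lambda>R. a *s f R) R = a *s ?t f R" for a f R by (simp add: sact_def P_scale)
  have 1: "sU ?Q i (intertwine \<xi> i j h) R = \<xi> i *s intertwine \<xi> i j h R" for R
  proof -
    have "sU ?Q i (intertwine \<xi> i j h) R = sU ?Q i h R + ?c *s ?t (sU ?Q j h) R"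
      using sU_tr_left[of i j ?Q] ij by (simp add: intertwine_def[abs_def] sU_add)
    also have "\<dots> = \<xi> i *s h R - k *s ?t h R + (?c * \<xi> j) *s ?t h R"
      by (simp add: Ui' Uj lin)
    finally show ?thesis unfolding c by (simp add: intertwine_def algebra_simps)
  qed
  have 2: "sU (insert i ?Q) j (intertwine \<xi> i j h) R = \<xi> j *s intertwine \<xi> i j h R" for R
  proof -
    have "sU (insert i ?Q) j (intertwine \<xi> i j h) R
        = sU ?Q j (intertwine \<xi> i j h) R + k *s ?t (intertwine \<xi> i j h) R"
      using ij by (simp add: sU_insert tr_commute[of j i])
    also have "sU ?Q j (intertwine \<xi> i j h) R = sU ?Q j h R + ?c *s ?t (sU ?Q i h) R"
      using sU_tr_left[of j i ?Q] ij
      by (simp add: intertwine_def[abs_def] sU_add tr_commute[of j i])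
    also have "?t (sU ?Q i h) R = \<xi> i *s ?t h R - k *s h R"
      using tt[of h R] by (simp add: Ui') (simp add: sact_def P_diff P_scale)
    also have "?t (intertwine \<xi> i j h) R = ?t h R + ?c *s h R"
      using tt[of h R] by (simp add: intertwine_def[abs_def] sact_add)
    finally have "sU (insert i ?Q) j (intertwine \<xi> i j h) R
        = \<xi> j *s h R + (k + ?c * \<xi> i) *s ?t h R"
      by (simp add: Uj algebra_simps)
    then show ?thesis unfolding c[symmetric] by (simp add: intertwine_def algebra_simps)
  qed
  have 3: "eigen \<xi> r (intertwine \<xi> i j h)" if "eigen \<xi> r h" "i \<notin> set r" "j \<notin> set r" "set r \<subseteq> {1..N}" for r
    using that
  proof (induction r)
    case (Cons a r)
    then show ?case using ij by (auto intro!: eigen_commute)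
  qed simp
  show ?case using 1 2 3[of q] Nil(1) ij by auto
next
  case (Cons a p)
  have eq: "set (p @ j # i # q) = set (p @ i # j # q)" by auto
  have "sU (set (p @ i # j # q)) a (intertwine \<xi> i j h) R = \<xi> a *s intertwine \<xi> i j h R" for R
    using Cons.prems by (intro eigen_commute) auto
  with Cons eq show ?case by (simp del: set_append)
qed

section \<open>Triangularity with respect to an order of the variables\<close>

text \<open>Every set in the support is dominated by \<open>{1..n}\<close> with respect to the order \<open>xs\<close>; this makes
  \<open>{1..n}\<close> the leading term and keeps its coefficient fixed when \<open>j \<le> n\<close> moves left past \<open>i > n\<close>.\<close>

definition dominated :: "nat \<Rightarrow> nat list \<Rightarrow> (nat set \<Rightarrow> 'v) \<Rightarrow> bool" where
  "dominated n xs h \<longleftrightarrow> (\<forall>R. h R \<noteq> 0 \<longrightarrow> R \<subseteq> {1..N} \<and> card R = n \<and>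
     (\<forall>p q. xs = p @ q \<longrightarrow> card (R \<inter> set p) \<le> card ({1..n} \<inter> set p)))"

lemma dominated_zero:
  "dominated n (p @ q) h \<Longrightarrow> card ({1..n} \<inter> set p) < card (R \<inter> set p) \<Longrightarrow> h R = 0"
  unfolding dominated_def by (metis leD)

lemma card_tr_vimage:
  assumes "i \<in> A \<longleftrightarrow> j \<in> A"
  shows "card ((tr i j -` R) \<inter> A) = card (R \<inter> A)"
proof -
  have "tr i j ` (R \<inter> A) = (tr i j -` R) \<inter> A"
    using assms by (auto simp: tr_def image_iff split: if_splits)
  moreover have "inj_on (tr i j) (R \<inter> A)" by (auto intro: inj_onI dest: transpose_eq_imp_eq)
  ultimately show ?thesis by (metis card_image)
qed

lemma card_tr_vimage_eq: "card (tr i j -` R) = card R"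
  using card_tr_vimage[of i UNIV j R] by simp

text \<open>Only the prefix \<open>p @ [j]\<close> is new. There \<open>{1..n}\<close> gains the
  element j, while R has at most one element more than in \<open>p\<close>, where the old bound
  applies.\<close>

lemma intertwine_dominated:
  assumes h: "dominated n (p @ i # j # q) h" and xs: "distinct (p @ i # j # q)"
    "set (p @ i # j # q) \<subseteq> {1..N}" and i: "n < i" and j: "j \<le> n"
  shows "dominated n (p @ j # i # q) (intertwine \<xi> i j h)"
    and "intertwine \<xi> i j h {1..n} = h {1..n}"
proof -
  have ij: "i \<in> {1..N}" "j \<in> {1..N}" "i \<noteq> j" "i \<notin> set p" "j \<notin> set p" using xs by auto
  show "dominated n (p @ j # i # q) (intertwine \<xi> i j h)"
    unfolding dominated_def
  proof (intro allI impI)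
    fix R assume "intertwine \<xi> i j h R \<noteq> 0"
    then have "h R \<noteq> 0 \<or> h (tr i j -` R) \<noteq> 0"
      by (auto simp: intertwine_def sact_def)
    then obtain S where S: "h S \<noteq> 0" "S = R \<or> S = tr i j -` R" by auto
    have SN: "S \<subseteq> {1..N}" "card S = n" using h S unfolding dominated_def by auto
    have bnd: "card (S \<inter> set u) \<le> card ({1..n} \<inter> set u)" if "p @ i # j # q = u @ v" for u v
      using h S that unfolding dominated_def by blast
    have R: "R = S \<or> R = tr i j -` S" using S by (auto simp: vimage_def)
    have cR: "card (R \<inter> A) = card (S \<inter> A)" if "i \<in> A \<longleftrightarrow> j \<in> A" for A
      using R card_tr_vimage[OF that] by auto
    have RN: "R \<subseteq> {1..N}"
    proof
      fix x assume "x \<in> R"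
      then have "x \<in> S \<or> tr i j x \<in> S" using R by auto
      then show "x \<in> {1..N}" using SN ij by (cases "x = i"; cases "x = j") auto
    qed
    have Rn: "card R = n" using cR[of UNIV] SN by simp
    have main: "card (R \<inter> set u) \<le> card ({1..n} \<inter> set u)" if u: "p @ j # i # q = u @ v" for u v
    proof -
      consider w where "p = u @ w" | "u = p @ [j]" | w where "u = p @ j # i # w" "q = w @ v"
        using u by (auto simp: append_eq_append_conv2 Cons_eq_append_conv)
      then show ?thesis
      proof cases
        case (1 w)
        then have "card (S \<inter> set u) \<le> card ({1..n} \<inter> set u)" by (intro bnd[of _ "w @ i # j # q"]) simp
        then show ?thesis using cR[of "set u"] 1 ij by auto
      next
        case 2
        have "card (R \<inter> set u) \<le> Suc (card (R \<inter> set p))"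
          using 2 by (simp add: Int_insert_right card_insert_le_m1 card_insert_if)
        also have "card (R \<inter> set p) = card (S \<inter> set p)" using cR[of "set p"] ij by auto
        also have "card (S \<inter> set p) \<le> card ({1..n} \<inter> set p)" by (intro bnd[of _ "i # j # q"]) simp
        also have "Suc (card ({1..n} \<inter> set p)) = card ({1..n} \<inter> set u)"
          using 2 ij j by (simp add: Int_insert_right)
        finally show ?thesis by simp
      next
        case (3 w)
        have eq: "set u = set (p @ i # j # w)" using 3 by auto
        have "card (S \<inter> set (p @ i # j # w)) \<le> card ({1..n} \<inter> set (p @ i # j # w))"
          using 3 by (intro bnd[of _ v]) simp
        then show ?thesis using cR[of "set u"] unfolding eq by auto
      qed
    qed
    show "R \<subseteq> {1..N} \<and> card R = n \<and>
      (\<forall>u v. p @ j # i # q = u @ v \<longrightarrow> card (R \<inter> set u) \<le> card ({1..n} \<inter> set u))"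
      using RN Rn main by blast
  qed
  \<comment> \<open>The reflected set has i in place of j, hence too many elements in the old prefix
    \<open>p @ [i]\<close>; its coefficient is 0 and the leading coefficient stays fixed.\<close>
  have "tr i j -` {1..n} = insert i ({1..n} - {j})"
    using i j ij by (auto simp: tr_def split: if_splits)
  then have "(tr i j -` {1..n}) \<inter> set (p @ [i]) = insert i ({1..n} \<inter> set p)"
    using ij by auto
  then have "h (tr i j -` {1..n}) = 0"
    using i ij by (intro dominated_zero[of n "p @ [i]" "j # q"]) (use h in \<open>auto simp: Int_insert_right\<close>)
  then show "intertwine \<xi> i j h {1..n} = h {1..n}" by (simp add: intertwine_def sact_def)
qed

text \<open>Collects what the intertwiners preserve. For suitable \<open>n\<close> and
  \<open>xs\<close> such an \<open>h\<close> is one of the two zetas, up to the action of a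
  permutation.\<close>

definition solution :: "nat \<Rightarrow> (nat \<Rightarrow> 'k) \<Rightarrow> 'v \<Rightarrow> nat list \<Rightarrow> (nat set \<Rightarrow> 'v) \<Rightarrow> bool" where
  "solution n \<xi> X xs h \<longleftrightarrow> distinct xs \<and> set xs = {1..N} \<and> eigen \<xi> xs h \<and> dominated n xs h \<and> h {1..n} = X"

lemma solution_intertwine:
  assumes "solution n \<xi> X (p @ i # j # q) h" "n < i" "j \<le> n" "\<xi> i \<noteq> \<xi> j"
  shows "solution n \<xi> X (p @ j # i # q) (intertwine \<xi> i j h)"
  using assms eigen_intertwine[of \<xi> p i j q h] intertwine_dominated[of n p i j q h]
  unfolding solution_def by auto

lemma eigen_upt_append:
  "eigen \<xi> ([a..<b] @ q) h \<longleftrightarrow>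
    (\<forall>i\<in>{a..<b}. \<forall>R. sU ({i<..<b} \<union> set q) i h R = \<xi> i *s h R) \<and> eigen \<xi> q h"
proof (induction "b - a" arbitrary: a)
  case (Suc d)
  then have ab: "a < b" by simp
  have "{Suc a..<b} = {a<..<b}" "{a..<b} = insert a {Suc a..<b}" using ab by auto
  moreover have "d = b - Suc a" using Suc by simp
  ultimately show ?case using Suc(1)[of "Suc a"] ab by (auto simp: upt_conv_Cons)
qed simp

text \<open>For i \<le> n, x_i D_i contributes the transpositions (i j) with j > n and
  \<open>sJ\<close> those with i < j \<le> n, together \<open>J i\<close>. For i > n, x_i D_i is
  nonzero only at sets containing i, where it cancels \<open>sJ\<close>; at \<open>{1..n}\<close>
  just the terms j > i of \<open>sJ\<close> survive, again \<open>J i\<close>.\<close>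

lemma solution_start:
  assumes "n \<le> N" and J: "\<And>i. i \<in> {1..N} \<Longrightarrow> J i X = c i *s X"
  shows "solution n (\<lambda>i. of_bool (i \<le> n) + 1 + k * c i) X ([Suc n..<Suc N] @ [1..<Suc n])
    (\<lambda>R. if R = {1..n} then X else 0)" (is "solution n ?\<xi> X _ ?h")
proof -
  have low: "sU {i<..n} i ?h R = ?\<xi> i *s ?h R" if "i \<in> {1..n}" for i R
  proof (cases "i \<in> R")
    case True
    have xD: "xD i ?h R = ?h R + k *s (\<Sum>j\<in>{1..N} - R. P (tr i j) (?h R - ?h (insert j (R - {i}))))"
    proof -
      have "{1..N} - (R - {i}) - {i} = {1..N} - R" using True by auto
      then show ?thesis using True by (simp add: xD_def sD_def insert_absorb)
    qed
    show ?thesis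
    proof (cases "R = {1..n}")
      case R: True
      have "insert j (R - {i}) \<noteq> {1..n}" if "j \<in> {1..N} - R" for j
        using that R by auto
      then have "xD i ?h R = X + k *s (\<Sum>j\<in>{1..N} - R. P (tr i j) X)"
        unfolding xD using R by (auto intro!: arg_cong[of _ _ "\<lambda>x. k *s x"] sum.cong)
      moreover have "{1..N} - R = {n<..N}" using R by auto
      moreover have "sJ {i<..n} i ?h R = (\<Sum>j\<in>{i<..n}. P (tr i j) X)"
        unfolding sJ_def
      proof (intro sum.cong refl)
        fix j assume "j \<in> {i<..n}"
        then have "tr i j -` R = R"
          using that R by (auto simp: tr_def split: if_splits)
        then show "sact (tr i j) ?h R = P (tr i j) X" using R by (simp add: sact_def)
      qed
      moreover have "J i X = (\<Sum>j\<in>{i<..n}. P (tr i j) X) + (\<Sum>j\<in>{n<..N}. P (tr i j) X)"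
        unfolding J_def using that assms(1)
        by (subst sum.union_disjoint[symmetric]) (auto intro!: sum.cong)
      moreover have "J i X = c i *s X" using J that assms(1) by simp
      ultimately have "sU {i<..n} i ?h R = X + X + k *s c i *s X"
        using R by (simp add: sU_def algebra_simps)
      then show ?thesis using that R scale_left_distrib[of 1 1 X] by (simp add: algebra_simps)
    next
      case R: False
      have "insert j (R - {i}) \<noteq> {1..n}" if "j \<in> {1..N} - R" for j
      proof
        assume "insert j (R - {i}) = {1..n}"
        then have "i = j" using \<open>i \<in> {1..n}\<close> by (metis Diff_iff insertE singletonI)
        then show False using that True by auto
      qed
      then have "xD i ?h R = 0" unfolding xD using R by simp
      moreover have "sJ {i<..n} i ?h R = 0"
        unfolding sJ_def
      proof (intro sum.neutral ballI)
        fix j assume "j \<in> {i<..n}"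
        then have "tr i j ` {1..n} = {1..n}"
          using that by (auto simp: tr_def image_iff)
        then have "tr i j -` R \<noteq> {1..n}"
          using R by (metis surj_image_vimage_eq surj_transpose)
        then show "sact (tr i j) ?h R = 0" by (simp add: sact_def)
      qed
      ultimately show ?thesis using R by (simp add: sU_def)
    qed
  next
    case False
    then have "R \<noteq> {1..n}" using that by auto
    moreover have "sact (tr i j) ?h R = 0" if "j \<in> {i<..n}" for j
    proof -
      have "j \<notin> tr i j -` R" using False by simp
      moreover have "j \<in> {1..n}" using that by auto
      ultimately have "tr i j -` R \<noteq> {1..n}" by blast
      then show ?thesis by (simp add: sact_def)
    qed
    ultimately show ?thesis using False by (simp add: sU_def xD_def sJ_def)
  qed
  have high: "sU ({i<..N} \<union> {1..n}) i ?h R = ?\<xi> i *s ?h R" if "i \<in> {n<..N}" for i R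
  proof -
    let ?Q = "{i<..N} \<union> {1..n}"
    have i: "i \<notin> {1..n}" using that by auto
    show ?thesis
    proof (cases "i \<in> R")
      case True
      then have R: "R \<noteq> {1..n}" using i by auto
      have vi: "tr i j -` R = insert j (R - {i})" if "j \<notin> R" for j
        using that True by (auto simp: tr_def split: if_splits)
      have vi': "tr i j -` R = R" if "j \<in> R" for j
        using that True by (auto simp: tr_def split: if_splits)
      have "(\<Sum>j\<in>{1..N} - R. P (tr i j) (?h (insert j (R - {i})))) = sJ ?Q i ?h R"
        unfolding sJ_def sact_def
      proof (rule sum.mono_neutral_cong)
        fix j assume j: "j \<in> {1..N} - R - ?Q"
        then have "insert j (R - {i}) \<noteq> {1..n}" by auto
        then show "P (tr i j) (?h (insert j (R - {i}))) = 0" by simp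
      next
        fix j assume "j \<in> ?Q - ({1..N} - R)"
        then have "j \<in> R" using assms(1) by auto
        then show "P (tr i j) (?h (tr i j -` R)) = 0" using R by (simp add: vi')
      qed (simp_all add: vi)
      moreover have "{1..N} - (R - {i}) - {i} = {1..N} - R" using True by auto
      ultimately have "xD i ?h R = - (k *s sJ ?Q i ?h R)"
        using True R by (simp add: xD_def sD_def insert_absorb P_minus sum_negf)
      then show ?thesis using R by (simp add: sU_def)
    next
      case False
      show ?thesis
      proof (cases "R = {1..n}")
        case R: True
        have "sJ ?Q i ?h R = J i X"
          unfolding sJ_def J_def
        proof (rule sum.mono_neutral_cong_right)
          show "\<forall>j\<in>?Q - {i<..N}. sact (tr i j) ?h R = 0"
          proof
            fix j assume "j \<in> ?Q - {i<..N}"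
            then have "i \<in> tr i j -` R" using R by auto
            then have "tr i j -` R \<noteq> {1..n}" using i by auto
            then show "sact (tr i j) ?h R = 0" by (simp add: sact_def)
          qed
          fix j assume "j \<in> {i<..N}"
          then have "tr i j -` R = R"
            using i that R by (auto simp: tr_def split: if_splits)
          then show "sact (tr i j) ?h R = P (tr i j) X" using R by (simp add: sact_def)
        qed auto
        then show ?thesis using R i that False J[of i] by (simp add: sU_def xD_def algebra_simps)
      next
        case R: False
        have "sact (tr i j) ?h R = 0" if "j \<in> ?Q" for j
        proof -
          have "tr i j -` R \<noteq> {1..n}"
          proof
            assume eq: "tr i j -` R = {1..n}"
            have "j \<notin> tr i j -` R" using False by simp
            then have "j > i" using eq that by auto
            then have "tr i j ` {1..n} = {1..n}"
              using i \<open>i \<in> {n<..N}\<close> by (auto simp: tr_def image_iff)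
            then show False using eq R by (metis surj_image_vimage_eq surj_transpose)
          qed
          then show ?thesis by (simp add: sact_def)
        qed
        then show ?thesis using False R by (simp add: sU_def xD_def sJ_def)
      qed
    qed
  qed
  have sets: "{i<..<Suc b} = {i<..b}" "{a..<Suc b} = {a..b}" "{Suc a..b} = {a<..b}" for i a b :: nat
    by auto
  have "eigen ?\<xi> ([1..<Suc n] @ []) ?h"
    unfolding eigen_upt_append list.set Un_empty_right sets using low by simp
  then have "eigen ?\<xi> ([Suc n..<Suc N] @ [1..<Suc n]) ?h"
    unfolding eigen_upt_append set_upt sets append_Nil2 using high by blast
  moreover have "dominated n ([Suc n..<Suc N] @ [1..<Suc n]) ?h"
    using assms(1) by (auto simp: dominated_def)
  ultimately show ?thesis using assms(1) by (auto simp: solution_def)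
qed

lemma solution_move_left:
  assumes "solution n \<xi> X (p @ ks @ j # q) h" "j \<le> n" "\<And>i. i \<in> set ks \<Longrightarrow> n < i \<and> \<xi> i \<noteq> \<xi> j"
  shows "solution n \<xi> X (p @ j # ks @ q) (foldr (\<lambda>i. intertwine \<xi> i j) ks h)"
  using assms
proof (induction ks arbitrary: q h rule: rev_induct)
  case (snoc i ks)
  have "solution n \<xi> X ((p @ ks) @ j # i # q) (intertwine \<xi> i j h)"
    using snoc.prems by (intro solution_intertwine) auto
  then show ?case using snoc by simp
qed simp

lemma solution_move_block:
  assumes "solution n \<xi> X (p @ ks @ js @ q) h" "\<And>j. j \<in> set js \<Longrightarrow> j \<le> n"
    "\<And>i j. i \<in> set ks \<Longrightarrow> j \<in> set js \<Longrightarrow> n < i \<and> \<xi> i \<noteq> \<xi> j"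
  shows "\<exists>h. solution n \<xi> X (p @ js @ ks @ q) h"
  using assms
proof (induction js arbitrary: p h)
  case (Cons j js)
  have "solution n \<xi> X (p @ j # ks @ js @ q) (foldr (\<lambda>i. intertwine \<xi> i j) ks h)"
    using Cons.prems by (intro solution_move_left) auto
  then have "\<exists>h. solution n \<xi> X ((p @ [j]) @ js @ ks @ q) h"
    using Cons.prems by (intro Cons.IH) auto
  then show ?case by simp
qed auto

subsection \<open>Commutation\<close>

lemma P_P_eq:
  assumes "i \<in> {1..N}" "j \<in> {1..N}" "a \<in> {1..N}" "b \<in> {1..N}"
  shows "P (tr i j) (P (tr a b) v) = P (tr (tr i j a) (tr i j b)) (P (tr i j) v)"
  using P_conj[OF tr_permutes[OF assms(1,2)] assms(3,4)] .

text \<open>The terms are sorted by the power of \<open>k\<close> and by the number of auxiliary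
  indices from \<open>C\<close>, so that commutation of the two operators can be checked group by
  group.\<close>

lemma sD_sD_expand:
  fixes h R
  defines "f \<equiv> \<lambda>a b. h (insert a (insert b R))"
  assumes ij: "i \<in> {1..N}" "j \<in> {1..N}" "i \<noteq> j" "i \<notin> R" "j \<notin> R"
    and C: "C = {1..N} - R - {i, j}"
  shows "sD i (sD j h) R = f j i +
      k *s ((\<Sum>l\<in>C. P (tr j l) (f j i - f l i)) + P (tr i j) (f j i) + (\<Sum>l\<in>C. P (tr i l) (f j i - f j l))) +
      (k * k) *s ((\<Sum>l\<in>C. P (tr i j) (P (tr j l) (f j i - f l i)) + P (tr i l) (P (tr j l) (f j i - f l i))
          - P (tr i l) (P (tr j i) (f j l - f i l)))
        + (\<Sum>l\<in>C. \<Sum>l'\<in>C - {l}. P (tr i l) (P (tr j l') (f j i - f l' i - f j l + f l' l))))"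
proof -
  define a where "a = (\<Sum>l\<in>C. P (tr j l) (f j i - f l i))"
  define b where "b l = P (tr j i) (f j l - f i l) + (\<Sum>l'\<in>C - {l}. P (tr j l') (f j l - f l' l))" for l
  have fin: "finite C" using C by simp
  have gi: "sD j h (insert i R) = f j i + k *s a"
  proof -
    have "{1..N} - insert i R - {j} = C" using C by auto
    then show ?thesis using ij by (simp add: sD_def f_def a_def)
  qed
  have gl: "sD j h (insert l R) = f j l + k *s b l" if "l \<in> C" for l
  proof -
    have eq: "{1..N} - insert l R - {j} = insert i (C - {l})" and "j \<notin> insert l R" "i \<notin> C - {l}"
      using C ij that by auto
    then show ?thesis unfolding sD_def eq using fin by (simp add: f_def b_def)
  qed
  have gj: "sD j h (insert j R) = 0" by (simp add: sD_def)
  have eq: "{1..N} - R - {i} = insert j C" and "j \<notin> C" using C ij by auto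
  then have "sD i (sD j h) R = f j i + k *s a
      + k *s (P (tr i j) (f j i + k *s a) + (\<Sum>l\<in>C. P (tr i l) (f j i + k *s a - (f j l + k *s b l))))"
    unfolding sD_def[of i "sD j h"] eq using ij fin by (simp add: gi gj gl cong: sum.cong_simp)
  also have "(\<Sum>l\<in>C. P (tr i l) (f j i + k *s a - (f j l + k *s b l)))
      = (\<Sum>l\<in>C. P (tr i l) (f j i - f j l)) + k *s (\<Sum>l\<in>C. P (tr i l) (a - b l))"
    by (simp add: scale_sum_right sum.distrib[symmetric] P_diff P_add P_scale algebra_simps)
  finally have 1: "sD i (sD j h) R = f j i
      + k *s (a + P (tr i j) (f j i) + (\<Sum>l\<in>C. P (tr i l) (f j i - f j l)))
      + (k * k) *s (P (tr i j) a + (\<Sum>l\<in>C. P (tr i l) (a - b l)))"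
    by (simp add: P_add P_scale algebra_simps)
  have "P (tr i l) (a - b l) = P (tr i l) (P (tr j l) (f j i - f l i)) - P (tr i l) (P (tr j i) (f j l - f i l))
      + (\<Sum>l'\<in>C - {l}. P (tr i l) (P (tr j l') (f j i - f l' i - f j l + f l' l)))" if "l \<in> C" for l
  proof -
    have "a = P (tr j l) (f j i - f l i) + (\<Sum>l'\<in>C - {l}. P (tr j l') (f j i - f l' i))"
      unfolding a_def using fin that by (rule sum.remove)
    then have "a - b l = P (tr j l) (f j i - f l i) - P (tr j i) (f j l - f i l)
        + (\<Sum>l'\<in>C - {l}. P (tr j l') (f j i - f l' i - f j l + f l' l))"
      by (simp add: b_def P_add P_diff sum_subtractf sum.distrib)
    then show ?thesis by (simp only: P_add P_diff P_sum)
  qed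
  then have 2: "P (tr i j) a + (\<Sum>l\<in>C. P (tr i l) (a - b l))
    = (\<Sum>l\<in>C. P (tr i j) (P (tr j l) (f j i - f l i)) + P (tr i l) (P (tr j l) (f j i - f l i))
          - P (tr i l) (P (tr j i) (f j l - f i l)))
        + (\<Sum>l\<in>C. \<Sum>l'\<in>C - {l}. P (tr i l) (P (tr j l') (f j i - f l' i - f j l + f l' l)))"
    by (simp add: a_def P_sum sum.distrib sum_subtractf)
  show ?thesis unfolding 1 unfolding 2 unfolding a_def ..
qed

lemma sum_off_diagonal_swap:
  assumes "finite C"
  shows "(\<Sum>l\<in>C. \<Sum>l'\<in>C - {l}. d l l') = (\<Sum>l\<in>C. \<Sum>l'\<in>C - {l}. (d l' l :: 'a :: comm_monoid_add))"
proof -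
  have *: "(\<Sum>l\<in>C. \<Sum>l'\<in>C - {l}. d l l') = (\<Sum>l\<in>C. \<Sum>l'\<in>C. if l' = l then 0 else d l l')"
    for d :: "'b \<Rightarrow> 'b \<Rightarrow> 'a"
    using assms by (intro sum.cong refl sum.mono_neutral_cong_left) auto
  show ?thesis unfolding * by (subst sum.swap) (auto intro!: sum.cong)
qed

text \<open>Commutativity of the Dunkl operators on square-free elements. It transfers D_j h = 0 for
  j > m to D_m h.\<close>

lemma sD_sD_commute:
  assumes ij: "i \<in> {1..N}" "j \<in> {1..N}" "i \<noteq> j"
  shows "sD i (sD j h) R = sD j (sD i h) R"
proof (cases "i \<in> R \<or> j \<in> R")
  case True
  then show ?thesis by (auto simp: sD_def intro!: sum.neutral)
next
  case False
  define C where "C = {1..N} - R - {i, j}"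
  define f where "f a b = h (insert a (insert b R))" for a b
  have f_sym: "f a b = f b a" for a b by (simp add: f_def insert_commute)
  have fin: "finite C" and C': "C = {1..N} - R - {j, i}" by (auto simp: C_def)
  have s: "P (tr i j) (P (tr j l) (f j i - f l i)) + P (tr i l) (P (tr j l) (f j i - f l i))
          - P (tr i l) (P (tr j i) (f j l - f i l))
      = P (tr j i) (P (tr i l) (f i j - f l j)) + P (tr j l) (P (tr i l) (f i j - f l j))
          - P (tr j l) (P (tr i j) (f i l - f j l))" if "l \<in> C" for l
  proof -
    have l: "l \<in> {1..N}" "l \<noteq> i" "l \<noteq> j" using that by (auto simp: C_def)
    \<comment> \<open>Every product of two distinct transpositions of i, j, l is one of two
      3-cycles. After rewriting with \<open>X1\<close> to \<open>Y2\<close>, each side uses a single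
      one, and the coefficients cancel by the symmetry of \<open>f\<close>.\<close>
    have X1: "P (tr i l) (P (tr j i) v) = P (tr i j) (P (tr j l) v)" for v
      using P_P_eq[of i j j l v] ij l by (simp add: tr_commute)
    have X2: "P (tr j l) (P (tr i l) v) = P (tr i j) (P (tr j l) v)" for v
      using P_P_eq[of i l i j v] ij l X1 by (simp add: tr_commute)
    have Y1: "P (tr j l) (P (tr i j) v) = P (tr j i) (P (tr i l) v)" for v
      using P_P_eq[of j i i l v] ij l by (simp add: tr_commute)
    have Y2: "P (tr i l) (P (tr j l) v) = P (tr j i) (P (tr i l) v)" for v
      using P_P_eq[of j l j i v] ij l Y1 by (simp add: tr_commute)
    show ?thesis unfolding X1 X2 Y1 Y2
      by (simp add: P_diff f_sym[of i j] f_sym[of l i] f_sym[of l j])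
  qed
  have d: "P (tr i l) (P (tr j l') (f j i - f l' i - f j l + f l' l))
      = P (tr j l') (P (tr i l) (f i j - f l j - f i l' + f l l'))" if "l \<in> C" "l' \<in> C - {l}" for l l'
  proof -
    have "P (tr i l) (P (tr j l') v) = P (tr j l') (P (tr i l) v)" for v
      using P_P_eq[of i l j l' v] that ij by (simp add: C_def)
    moreover have "f j i - f l' i - f j l + f l' l = f i j - f l j - f i l' + f l l'"
      using f_sym[of i j] f_sym[of l' i] f_sym[of j l] f_sym[of l' l] by (simp add: algebra_simps)
    ultimately show ?thesis by simp
  qed
  \<comment> \<open>Here the transpositions are disjoint and commute; renaming l and l' matches the
    two double sums.\<close>
  have d': "(\<Sum>l\<in>C. \<Sum>l'\<in>C - {l}. P (tr i l) (P (tr j l') (f j i - f l' i - f j l + f l' l)))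
      = (\<Sum>l\<in>C. \<Sum>l'\<in>C - {l}. P (tr j l) (P (tr i l') (f i j - f l' j - f i l + f l' l)))"
    by (subst (2) sum_off_diagonal_swap[OF fin]) (intro sum.cong refl d)
  have s': "(\<Sum>l\<in>C. P (tr i j) (P (tr j l) (f j i - f l i)) + P (tr i l) (P (tr j l) (f j i - f l i))
          - P (tr i l) (P (tr j i) (f j l - f i l)))
      = (\<Sum>l\<in>C. P (tr j i) (P (tr i l) (f i j - f l j)) + P (tr j l) (P (tr i l) (f i j - f l j))
          - P (tr j l) (P (tr i j) (f i l - f j l)))"
    by (intro sum.cong refl s)
  have "(\<Sum>l\<in>C. P (tr j l) (f j i - f l i)) = (\<Sum>l\<in>C. P (tr j l) (f i j - f i l))"
    "(\<Sum>l\<in>C. P (tr i l) (f j i - f j l)) = (\<Sum>l\<in>C. P (tr i l) (f i j - f l j))"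
    by (metis f_sym)+
  then have lin: "(\<Sum>l\<in>C. P (tr j l) (f j i - f l i)) + P (tr i j) (f j i) + (\<Sum>l\<in>C. P (tr i l) (f j i - f j l))
      = (\<Sum>l\<in>C. P (tr i l) (f i j - f l j)) + P (tr j i) (f i j) + (\<Sum>l\<in>C. P (tr j l) (f i j - f i l))"
    by (simp add: f_sym[of i j] tr_commute[of j i] add_ac)
  have "j \<noteq> i" "i \<notin> R" "j \<notin> R" using False ij by auto
  note e = sD_sD_expand[OF ij(1,2,3) \<open>i \<notin> R\<close> \<open>j \<notin> R\<close> C_def, of h, folded f_def]
    sD_sD_expand[OF ij(2,1) \<open>j \<noteq> i\<close> \<open>j \<notin> R\<close> \<open>i \<notin> R\<close> C', of h, folded f_def]
  show ?thesis unfolding e s' d' lin by (simp only: f_sym[of i j])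
qed

lemma sD_sum: "sD i (\<lambda>R. \<Sum>x\<in>A. f x R) R = (\<Sum>x\<in>A. sD i (f x) R)"
proof (induction A rule: infinite_finite_induct)
  case (insert x F)
  then show ?case using sD_add[of i "f x" 1 "\<lambda>R. \<Sum>x\<in>F. f x R" R] by simp
qed (simp_all add: sD_def)

lemma sD_scale: "sD i (\<lambda>R. c *s f R) R = c *s sD i f R"
  using sD_add[of i "\<lambda>R. 0" c f R] by (simp add: sD_def)

lemma sJ_sD:
  assumes "i \<in> {1..N}" "j \<in> {1..N}" "Q \<subseteq> {1..N}" "i \<notin> Q" "i \<noteq> j"
  shows "sJ Q j (sD i h) R = sD i (sJ Q j h) R"
proof -
  have "sact (tr j l) (sD i h) R = sD i (sact (tr j l) h) R" if "l \<in> Q" for l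
  proof -
    have "l \<noteq> i" using that assms by auto
    then have "tr j l i = i" using assms by simp
    then show ?thesis using sD_sact[OF tr_permutes[of j l] assms(1), of h R] that assms by auto
  qed
  then show ?thesis by (simp add: sJ_def[abs_def] sD_sum)
qed

subsection \<open>The value of the constant\<close>

text \<open>The trace of an intertwiner on sums of coefficients, see
  \<open>sum_intertwine\<close>.\<close>

definition raise :: "(nat \<Rightarrow> 'k) \<Rightarrow> nat \<Rightarrow> nat \<Rightarrow> 'v \<Rightarrow> 'v" where
  "raise e j l v = v + e l *s P (tr j l) v"

definition lower :: "(nat \<Rightarrow> 'k) \<Rightarrow> nat \<Rightarrow> nat \<Rightarrow> 'v \<Rightarrow> 'v" where
  "lower e j l v = v - e l *s P (tr j l) v"

lemma foldr_raise_scale: "foldr (raise e j) ks (a *s v) = a *s foldr (raise e j) ks v"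
  by (induction ks) (simp_all add: raise_def P_scale scale_right_distrib scale_left_commute)

lemma foldr_lower_diff:
  "foldr (lower e j) ks (u - a *s v) = foldr (lower e j) ks u - a *s foldr (lower e j) ks v"
proof (induction ks)
  case (Cons l ks)
  show ?case by (simp only: foldr_Cons comp_apply Cons.IH)
      (simp add: lower_def[of e j l] P_scale P_diff algebra_simps)
qed simp

text \<open>In this order the innermost \<open>raise\<close> and the outermost \<open>lower\<close>
  carry the same index and multiply to a scalar; the product collapses from the middle
  outwards.\<close>

lemma foldr_raise_lower:
  assumes "j \<in> {1..N}" "set ks \<subseteq> {1..N}" "distinct ks"
  shows "foldr (raise e j) ks (foldr (lower e j) (rev ks) v) = (\<Prod>l\<in>set ks. 1 - (e l)\<^sup>2) *s v"
  using assms(2,3)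
proof (induction ks rule: rev_induct)
  case (snoc l ks)
  have "raise e j l (lower e j l u) = (1 - (e l)\<^sup>2) *s u" for u
    using P_tr_tr[OF assms(1), of l u] snoc.prems
    by (simp add: raise_def lower_def P_diff P_scale algebra_simps power2_eq_square)
  with snoc show ?case by (simp add: foldr_raise_scale)
qed simp

lemma foldr_lower_conj:
  assumes "j \<in> {1..N}" "a \<in> {1..N}" "set ks \<subseteq> {1..N} - {a, j}"
  shows "foldr (lower e j) ks (P (tr j a) v) = P (tr j a) (foldr (lower e a) ks v)"
  using assms(3)
proof (induction ks)
  case (Cons l ks)
  have "P (tr j a) (P (tr a l) u) = P (tr j l) (P (tr j a) u)" for u
    using P_P_eq[of j a a l u] assms Cons.prems by auto
  with Cons show ?case by (simp add: lower_def P_diff P_scale)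
qed simp

text \<open>With \<open>z = 1 / k + t\<close> and \<open>e l = 1 / (z - c l)\<close> the product of the factors \<open>1 - e l (j l)\<close>
  collapses to \<open>1 - (\<Sum>\<^sub>l (j l)) / z\<close> on a joint eigenvector of the Jucys-Murphy elements.\<close>

lemma foldr_lower_eigenvector:
  assumes J: "\<And>i. i \<in> {1..N} \<Longrightarrow> J i X = c i *s X"
    and nz: "1 + k * t \<noteq> 0" "\<And>l. l \<in> {a..N} \<Longrightarrow> 1 + k * (t - c l) \<noteq> 0"
    and e: "\<And>l. e l = k / (1 + k * (t - c l))"
    and "1 \<le> j" "j < a" "a \<le> Suc N"
  shows "foldr (lower e j) (rev [a..<Suc N]) X = X - (k / (1 + k * t)) *s (\<Sum>l\<in>{a..N}. P (tr j l) X)"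
  using assms(2-)
proof (induction "Suc N - a" arbitrary: a j)
  case (Suc d)
  have aN: "a \<le> N" "1 \<le> a" using Suc by auto
  let ?z = "k / (1 + k * t)"
  let ?F = "\<lambda>j. foldr (lower e j) (rev [Suc a..<Suc N])"
  have IH: "?F j X = X - ?z *s (\<Sum>l\<in>{Suc a..N}. P (tr j l) X)" if "1 \<le> j" "j < Suc a" for j
    using Suc.prems Suc.hyps(2) that aN by (intro Suc.hyps(1)) auto
  have "(\<Sum>l\<in>{Suc a..N}. P (tr a l) X) = c a *s X"
    using J[of a] aN unfolding J_def by (simp add: atLeastSucAtMost_greaterThanAtMost)
  \<comment> \<open>For the index a the sum over l > a is exactly \<open>J a\<close>, so the
    remaining product is a scalar on \<open>X\<close>. Conjugation by (j a) brings it into play for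
    j; hence the induction hypothesis is used for both j and a.\<close>
  then have Fa: "?F a X = (1 - ?z * c a) *s X"
    using IH[of a] aN by (simp add: algebra_simps)
  have "foldr (lower e j) (rev [a..<Suc N]) X = ?F j (X - e a *s P (tr j a) X)"
    using aN by (simp add: upt_conv_Cons lower_def del: upt_Suc)
  also have "\<dots> = ?F j X - e a *s P (tr j a) (?F a X)"
    using Suc.prems aN by (subst foldr_lower_diff, subst foldr_lower_conj) auto
  also have "\<dots> = ?F j X - (e a * (1 - ?z * c a)) *s P (tr j a) X"
    unfolding Fa by (simp add: P_scale del: upt_Suc)
  also have "e a * (1 - ?z * c a) = ?z"
  proof -
    have n: "1 + k * t \<noteq> 0" "1 + k * (t - c a) \<noteq> 0" using Suc.prems aN by auto
    have "1 - ?z * c a = (1 + k * (t - c a)) / (1 + k * t)" using n(1) by (simp add: field_simps)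
    then show ?thesis using n by (simp add: e)
  qed
  finally have step: "foldr (lower e j) (rev [a..<Suc N]) X = ?F j X - ?z *s P (tr j a) X" .
  have "{a..N} = insert a {Suc a..N}" using aN by auto
  then have "(\<Sum>l\<in>{a..N}. P (tr j l) X) = P (tr j a) X + (\<Sum>l\<in>{Suc a..N}. P (tr j l) X)"
    by simp
  moreover have "j < Suc a" using Suc.prems by simp
  ultimately show ?case
    unfolding step IH[OF \<open>1 \<le> j\<close> \<open>j < Suc a\<close>] by (simp add: scale_right_distrib diff_diff_eq add.commute)
qed simp

text \<open>With j = m and t = c m the sum in the collapsed product of the \<open>lower\<close>
  factors is \<open>J m\<close>, so that product is the scalar 1 / (1 + k c_m). Dividing
  \<open>foldr_raise_lower\<close> by it produces the extra factor 1 + k c_m.\<close>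

lemma foldr_raise_eigenvector:
  assumes J: "\<And>i. i \<in> {1..N} \<Longrightarrow> J i X = c i *s X"
    and nz: "1 + k * c m \<noteq> 0" "\<And>l. l \<in> {Suc m..N} \<Longrightarrow> 1 + k * (c m - c l) \<noteq> 0"
    and e: "\<And>l. e l = k / (1 + k * (c m - c l))"
    and m: "m \<in> {1..N}"
  shows "foldr (raise e m) [Suc m..<Suc N] X = ((1 + k * c m) * (\<Prod>l\<in>{Suc m..N}. 1 - (e l)\<^sup>2)) *s X"
proof -
  let ?ks = "[Suc m..<Suc N]"
  have "foldr (lower e m) (rev ?ks) X = X - (k / (1 + k * c m)) *s (\<Sum>l\<in>{Suc m..N}. P (tr m l) X)"
    using m by (intro foldr_lower_eigenvector[OF J nz e]) auto
  also have "(\<Sum>l\<in>{Suc m..N}. P (tr m l) X) = c m *s X"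
    using J[OF m] unfolding J_def by (simp add: atLeastSucAtMost_greaterThanAtMost)
  also have "X - (k / (1 + k * c m)) *s (c m *s X) = (1 - (k / (1 + k * c m)) * c m) *s X"
    by (simp add: algebra_simps)
  also have "1 - (k / (1 + k * c m)) * c m = 1 / (1 + k * c m)"
    using nz(1) by (simp add: field_simps)
  finally have low: "foldr (lower e m) (rev ?ks) X = (1 / (1 + k * c m)) *s X" .
  have "foldr (raise e m) ?ks (foldr (lower e m) (rev ?ks) X) = (\<Prod>l\<in>set ?ks. 1 - (e l)\<^sup>2) *s X"
    using m by (intro foldr_raise_lower) (auto simp del: upt_Suc)
  moreover have "set ?ks = {Suc m..N}" by auto
  ultimately have "(1 / (1 + k * c m)) *s foldr (raise e m) ?ks X = (\<Prod>l\<in>{Suc m..N}. 1 - (e l)\<^sup>2) *s X"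
    unfolding low foldr_raise_scale by (simp only:)
  then have "(1 + k * c m) *s (1 / (1 + k * c m)) *s foldr (raise e m) ?ks X
      = (1 + k * c m) *s (\<Prod>l\<in>{Suc m..N}. 1 - (e l)\<^sup>2) *s X"
    by (rule arg_cong)
  then show ?thesis using nz(1) by (simp add: scale_scale del: upt_Suc)
qed

text \<open>The terms with factor \<open>k\<close> are antisymmetric in j and l, as (j l) = (l j),
  so they cancel in the double sum. When all D_j h with j > m vanish, the left side is D_m h
  alone.\<close>

lemma sum_sD:
  assumes "1 \<le> m" "m \<le> N"
  shows "(\<Sum>j\<in>{m..N}. sD j h {1..<m}) = (\<Sum>j\<in>{m..N}. h (insert j {1..<m}))"
proof -
  let ?C = "{m..N}" let ?z = "\<lambda>j. h (insert j {1..<m})"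
  have "sD j h {1..<m} = ?z j + k *s (\<Sum>l\<in>?C. P (tr j l) (?z j - ?z l))" if "j \<in> ?C" for j
  proof -
    have "{1..N} - {1..<m} - {j} = ?C - {j}" using assms that by auto
    moreover have "(\<Sum>l\<in>?C. P (tr j l) (?z j - ?z l)) = (\<Sum>l\<in>?C - {j}. P (tr j l) (?z j - ?z l))"
      using that by (subst sum.remove[of _ j]) auto
    ultimately show ?thesis using that by (simp add: sD_def)
  qed
  then have "(\<Sum>j\<in>?C. sD j h {1..<m})
      = (\<Sum>j\<in>?C. ?z j) + k *s (\<Sum>j\<in>?C. \<Sum>l\<in>?C. P (tr j l) (?z j - ?z l))"
    by (simp add: sum.distrib scale_sum_right)
  also have "(\<Sum>j\<in>?C. \<Sum>l\<in>?C. P (tr j l) (?z j - ?z l))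
      = (\<Sum>j\<in>?C. \<Sum>l\<in>?C. P (tr j l) (?z j)) - (\<Sum>j\<in>?C. \<Sum>l\<in>?C. P (tr j l) (?z l))"
    by (simp add: P_diff sum_subtractf)
  also have "(\<Sum>j\<in>?C. \<Sum>l\<in>?C. P (tr j l) (?z l)) = (\<Sum>l\<in>?C. \<Sum>j\<in>?C. P (tr l j) (?z l))"
    by (subst sum.swap) (simp add: tr_commute)
  finally show ?thesis by simp
qed

text \<open>The transposition (i m) permutes the sets \<open>insert l {1..<m}\<close> with l \<ge> m
  among themselves. Summing over them turns the intertwiner into an operator on single
  vectors.\<close>

lemma sum_intertwine:
  assumes "i \<in> {m..N}" "1 \<le> m"
  shows "(\<Sum>l\<in>{m..N}. intertwine \<xi> i m h (insert l {1..<m}))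
    = raise (\<lambda>i. k / (\<xi> m - \<xi> i)) m i (\<Sum>l\<in>{m..N}. h (insert l {1..<m}))"
proof -
  have "tr i m -` insert l {1..<m} = insert (tr i m l) {1..<m}" for l
    using assms by (auto simp: tr_def split: if_splits)
  then have "(\<Sum>l\<in>{m..N}. sact (tr i m) h (insert l {1..<m}))
      = P (tr i m) (\<Sum>l\<in>{m..N}. h (insert (tr i m l) {1..<m}))"
    by (simp add: sact_def P_sum)
  also have "(\<Sum>l\<in>{m..N}. h (insert (tr i m l) {1..<m})) = (\<Sum>l\<in>{m..N}. h (insert l {1..<m}))"
    using assms by (intro sum.permute[symmetric, unfolded comp_def] permutes_swap_id) auto
  finally show ?thesis
    by (simp add: intertwine_def raise_def sum.distrib scale_sum_right[symmetric]
        tr_commute[of i m])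
qed

lemma sum_foldr_intertwine:
  assumes "set ks \<subseteq> {m..N}" "1 \<le> m"
  shows "(\<Sum>l\<in>{m..N}. foldr (\<lambda>i. intertwine \<xi> i m) ks h (insert l {1..<m}))
    = foldr (raise (\<lambda>i. k / (\<xi> m - \<xi> i)) m) ks (\<Sum>l\<in>{m..N}. h (insert l {1..<m}))"
  using assms by (induction ks) (simp_all add: sum_intertwine)

end

text \<open>\<open>J_eigenvalues\<close> says that z - 1/k is not an eigenvalue of
  \<open>J i\<close> for any integer z; it is verified below from the integrality of the
  spectrum.\<close>

locale jucys_murphy_rep = sym_rep scale N P k
  for scale :: "'k::field_char_0 \<Rightarrow> 'v::ab_group_add \<Rightarrow> 'v" (infixr "*s" 75)
    and N :: nat and P :: "(nat \<Rightarrow> nat) \<Rightarrow> 'v \<Rightarrow> 'v" and k :: 'k +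
  assumes k_generic: "1 + k * of_int z \<noteq> 0"
    and J_eigenvalues: "i \<in> {1..N} \<Longrightarrow> v + k *s J i v = (k * of_int z) *s v \<Longrightarrow> v = 0"
begin

lemma exists_permutation_to_end:
  assumes "j \<in> {1..N}" "A \<subseteq> {1..N} - {j}"
  obtains w where "w permutes {1..N}" "w j = N - card A" "w ` A = {N - card A<..N}"
proof -
  let ?a = "card A" let ?B = "{1..N} - {j} - A"
  have fin: "finite A" using assms finite_subset by blast
  have "card A \<le> card ({1..N} - {j})" using assms by (intro card_mono) auto
  then have a: "?a < N" using assms by auto
  have "card {N - ?a<..N} = card A" using a by simp
  then obtain f where f: "bij_betw f A {N - ?a<..N}"
    using fin by (metis finite_same_card_bij finite_greaterThanAtMost)
  have "card ?B = card ({1..N} - {j}) - card A" using assms fin by (intro card_Diff_subset) auto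
  then have "card ?B = card {1..<N - ?a}" using assms by simp
  then obtain g where g: "bij_betw g ?B {1..<N - ?a}"
    by (metis finite_same_card_bij finite_atLeastAtMost finite_atLeastLessThan finite_Diff)
  define w where "w x = (if x \<in> A then f x else if x = j then N - ?a else if x \<in> ?B then g x else x)" for x
  have wA: "w ` A = {N - ?a<..N}" using f by (auto simp: bij_betw_def w_def)
  have "bij_betw w A {N - ?a<..N}" using f by (rule bij_betw_cong[THEN iffD1, rotated]) (simp add: w_def)
  moreover have "bij_betw w ?B {1..<N - ?a}"
    using g by (rule bij_betw_cong[THEN iffD1, rotated]) (auto simp: w_def)
  moreover have "bij_betw w {j} {N - ?a}" using assms by (auto simp: w_def)
  ultimately have "bij_betw w (A \<union> ({j} \<union> ?B)) ({N - ?a<..N} \<union> ({N - ?a} \<union> {1..<N - ?a}))"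
    by (intro bij_betw_combine) auto
  moreover have "A \<union> ({j} \<union> ?B) = {1..N}" using assms by auto
  moreover have "{N - ?a<..N} \<union> ({N - ?a} \<union> {1..<N - ?a}) = {1..N}" using a by auto
  ultimately have "bij_betw w {1..N} {1..N}" by simp
  then have "w permutes {1..N}"
    using assms by (intro bij_imp_permutes) (auto simp: w_def)
  moreover have "w j = N - ?a" using assms by (auto simp: w_def)
  ultimately show ?thesis using wA that by blast
qed

text \<open>A star of transpositions centred at j is conjugate to the Jucys-Murphy element with
  index \<open>N - card A\<close> and inherits its spectral property.\<close>

lemma star_sum_eigenvalues:
  assumes "j \<in> {1..N}" "A \<subseteq> {1..N} - {j}"
    and eq: "v + k *s (\<Sum>l\<in>A. P (tr j l) v) = (k * of_int z) *s v"
  shows "v = 0"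
proof -
  obtain w where w: "w permutes {1..N}" "w j = N - card A" "w ` A = {N - card A<..N}"
    using exists_permutation_to_end[OF assms(1,2)] .
  have "J (w j) (P w v) = (\<Sum>l\<in>w ` A. P (tr (w j) l) (P w v))" unfolding J_def using w by simp
  also have "\<dots> = (\<Sum>l\<in>A. P (tr (w j) (w l)) (P w v))"
    by (subst sum.reindex) (auto intro: inj_on_subset[OF permutes_inj[OF w(1)]])
  also have "\<dots> = P w (\<Sum>l\<in>A. P (tr j l) v)"
    using assms P_conj[OF w(1)] by (auto simp: P_sum subset_iff intro!: sum.cong)
  finally have "P w v + k *s J (w j) (P w v) = P w (v + k *s (\<Sum>l\<in>A. P (tr j l) v))"
    by (simp add: P_add P_scale)
  also have "\<dots> = (k * of_int z) *s P w v" unfolding eq by (simp add: P_scale)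
  finally have "P w v = 0"
    using J_eigenvalues permutes_in_image[OF w(1)] assms(1) by blast
  moreover have "P (inv w) (P w v) = v"
    using w(1) by (simp add: P_comp[symmetric] permutes_inv permutes_inv_o P_id del: o_apply)
  ultimately show ?thesis by simp
qed

text \<open>Induction on the sum of the elements of \<open>R\<close>: at \<open>j = Max R\<close> the eigenvalue equation involves,
  besides \<open>h R\<close>, only coefficients at sets in which \<open>j\<close> is replaced by a smaller element.\<close>

lemma eigen_unique:
  assumes supp: "\<And>R. h R \<noteq> 0 \<Longrightarrow> R \<subseteq> {1..N} \<and> \<not> R \<subseteq> {1..q}"
    and ev: "\<And>j R. j \<in> {q<..N} \<Longrightarrow> sU {j<..N} j h R = (1 + k * of_int (z j)) *s h R"
  shows "h R = 0"
proof (induction "\<Sum>R" arbitrary: R rule: less_induct)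
  case (less R)
  show ?case
  proof (rule ccontr)
    assume "h R \<noteq> 0"
    then have R: "R \<subseteq> {1..N}" "\<not> R \<subseteq> {1..q}" using supp by auto
    then have fin: "finite R" "R \<noteq> {}" by (auto intro: finite_subset)
    define j where "j = Max R"
    have jR: "j \<in> R" and max: "\<And>x. x \<in> R \<Longrightarrow> x \<le> j" using fin by (auto simp: j_def)
    have jq: "j \<in> {q<..N}"
    proof -
      obtain x where "x \<in> R" "x \<notin> {1..q}" using R by blast
      then show ?thesis using max[of x] R jR by fastforce
    qed
    have small: "h (insert l (R - {j})) = 0" if "l \<notin> R" "l < j" for l
    proof (rule less)
      have "\<Sum>(insert l (R - {j})) = l + \<Sum>(R - {j})" using fin that by simp
      also have "\<dots> < j + \<Sum>(R - {j})" using that by simp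
      also have "\<dots> = \<Sum>R" using fin jR by (simp add: sum.remove[of R j])
      finally show "\<Sum>(insert l (R - {j})) < \<Sum>R" .
    qed
    have "sJ {j<..N} j h R = (\<Sum>l\<in>{1..N} - R. P (tr j l) (h (insert l (R - {j}))))"
      unfolding sJ_def sact_def
    proof (rule sum.mono_neutral_cong_left)
      show "{j<..N} \<subseteq> {1..N} - R" using jq by (auto dest!: max)
      show "\<forall>l\<in>{1..N} - R - {j<..N}. P (tr j l) (h (insert l (R - {j}))) = 0"
      proof
        fix l assume l: "l \<in> {1..N} - R - {j<..N}"
        then have "l < j" using jR by (cases "l = j") auto
        then show "P (tr j l) (h (insert l (R - {j}))) = 0" using small l by simp
      qed
      fix l assume "l \<in> {j<..N}"
      then have "l \<notin> R" using max by (auto dest: leD)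
      then have "tr j l -` R = insert l (R - {j})"
        using jR by (auto simp: tr_def split: if_splits)
      then show "P (tr j l) (h (tr j l -` R)) = P (tr j l) (h (insert l (R - {j})))" by simp
    qed simp
    moreover have "{1..N} - (R - {j}) - {j} = {1..N} - R" using jR by auto
    then have "xD j h R = h R + k *s (\<Sum>l\<in>{1..N} - R. P (tr j l) (h R - h (insert l (R - {j}))))"
      using jR by (simp add: xD_def sD_def insert_absorb)
    \<comment> \<open>The terms of \<open>sJ\<close> cancel the coefficients at other sets in
      \<open>xD\<close>. The second copy of \<open>h R\<close>, due to x_j D_j, shifts the
      eigenvalue so that the excluded case of \<open>star_sum_eigenvalues\<close> results.\<close>
    ultimately have "sU {j<..N} j h R = h R + (h R + k *s (\<Sum>l\<in>{1..N} - R. P (tr j l) (h R)))"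
      by (simp add: sU_def P_diff sum_subtractf algebra_simps)
    with ev[OF jq, of R] have "h R + k *s (\<Sum>l\<in>{1..N} - R. P (tr j l) (h R)) = (k * of_int (z j)) *s h R"
      by (simp add: algebra_simps)
    then have "h R = 0"
      using jq jR by (intro star_sum_eigenvalues[of j "{1..N} - R"]) auto
    with \<open>h R \<noteq> 0\<close> show False by simp
  qed
qed

end

locale seminormal_family = jucys_murphy_rep scale N P k
  for scale :: "'k::field_char_0 \<Rightarrow> 'v::ab_group_add \<Rightarrow> 'v" (infixr "*s" 75)
    and N :: nat and P :: "(nat \<Rightarrow> nat) \<Rightarrow> 'v \<Rightarrow> 'v" and k :: 'k +
  fixes Y :: "'t set" and X :: "'t \<Rightarrow> 'v" and c :: "'t \<Rightarrow> nat \<Rightarrow> int"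
    and flip :: "nat \<Rightarrow> 't \<Rightarrow> 't" and p :: "nat \<Rightarrow> 't \<Rightarrow> 'k"
  assumes J_X: "T \<in> Y \<Longrightarrow> i \<in> {1..N} \<Longrightarrow> J i (X T) = of_int (c T i) *s X T"
    and tr_X: "T \<in> Y \<Longrightarrow> 1 \<le> i \<Longrightarrow> i < N \<Longrightarrow>
      P (tr i (Suc i)) (X T) = (1 / of_int (c T i - c T (Suc i))) *s X T + p i T *s X (flip i T)"
    and flip: "T \<in> Y \<Longrightarrow> 1 \<le> i \<Longrightarrow> i < N \<Longrightarrow> p i T \<noteq> 0 \<Longrightarrow>
      flip i T \<in> Y \<and> (\<forall>j. c (flip i T) j = c T (tr i (Suc i) j))"
    and c_Suc: "T \<in> Y \<Longrightarrow> 1 \<le> i \<Longrightarrow> i < N \<Longrightarrow> c T i \<noteq> c T (Suc i)"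
    and c_N: "T \<in> Y \<Longrightarrow> 1 \<le> N \<Longrightarrow> c T N = 0"
begin

text \<open>The eigenvalues of the U_i for the exponent (1^n, 0^(N-n)), whose rank function is the
  identity.\<close>

definition spec :: "nat \<Rightarrow> 't \<Rightarrow> nat \<Rightarrow> 'k" where
  "spec n T i = of_bool (i \<le> n) + 1 + k * of_int (c T i)"

text \<open>Such a pair differs by 1 + k z with z an integer. All exchanges performed below are of
  this kind, so no denominator in \<open>intertwine\<close> vanishes.\<close>

lemma spec_neq: "i \<le> n \<Longrightarrow> n < j \<Longrightarrow> spec n T i \<noteq> spec n T j"
  using k_generic[of "c T i - c T j"] by (simp add: spec_def algebra_simps)

text \<open>The parameter r covers both targets: r = n gives the natural order, and n = m - 1, r = m
  gives m, 1, ..., m - 1, m + 1, ..., N, which theta_m carries to the natural order.\<close>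

lemma exists_solution:
  assumes "T \<in> Y" "n \<le> N" "n \<le> r" "r \<le> N"
  shows "\<exists>h. solution n (spec n T) (X T) ([Suc n..<Suc r] @ [1..<Suc n] @ [Suc r..<Suc N]) h"
proof -
  have neq: "spec n T i \<noteq> spec n T j" if "Suc r \<le> i" "j < Suc n" for i j
    using spec_neq[of j n i T] that assms(3) by auto
  have "[Suc n..<Suc N] = [Suc n..<Suc r] @ [Suc r..<Suc N]"
    using assms by (metis Suc_le_mono le_iff_add upt_add_eq_append)
  then have "solution n (spec n T) (X T) ([Suc n..<Suc r] @ [Suc r..<Suc N] @ [1..<Suc n] @ [])
      (\<lambda>R. if R = {1..n} then X T else 0)"
    using solution_start[OF assms(2) J_X[OF assms(1)]] by (simp add: spec_def[abs_def] del: upt_Suc)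
  then have "\<exists>h. solution n (spec n T) (X T) ([Suc n..<Suc r] @ [1..<Suc n] @ [Suc r..<Suc N] @ []) h"
    by (rule solution_move_block) (use assms(3) neq in \<open>auto simp del: upt_Suc\<close>)
  then show ?thesis by simp
qed

end

section \<open>Extracting information from solutions\<close>

lemma upt_append_upt: "a \<le> b \<Longrightarrow> b \<le> c \<Longrightarrow> [a..<b] @ [b..<c] = [a..<c]"
  by (metis le_iff_add upt_add_eq_append)

context sym_rep
begin

lemma eigen_append: "eigen \<xi> (p @ q) h \<Longrightarrow> eigen \<xi> q h"
  by (induction p) auto

lemma solution_sU:
  assumes "solution n \<xi> X (p @ [a..<Suc N]) h" "j \<in> {a..N}"
  shows "sU {j<..N} j h R = \<xi> j *s h R"
proof -
  have "eigen \<xi> ([a..<Suc N] @ []) h" using assms eigen_append by (auto simp: solution_def)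
  then have "sU ({j<..<Suc N} \<union> set []) j h R = \<xi> j *s h R"
    unfolding eigen_upt_append using assms(2) by auto
  moreover have "{j<..<Suc N} = {j<..N}" by auto
  ultimately show ?thesis by simp
qed

lemma solution_sU_upt:
  "solution n \<xi> X [1..<Suc N] h \<Longrightarrow> j \<in> {1..N} \<Longrightarrow> sU {j<..N} j h R = \<xi> j *s h R"
  using solution_sU[of n \<xi> X "[]" 1 h j R] by (simp only: append_Nil)

lemma solution_supp:
  assumes "solution n \<xi> X xs h" "h R \<noteq> 0"
  shows "R \<subseteq> {1..N}" "card R = n"
  using assms by (auto simp: solution_def dominated_def)

text \<open>Domination on the one-element prefix: \<open>{1..n}\<close> has no element there. This
  keeps m out of the support of the solution for the smaller exponent.\<close>

lemma solution_first:
  assumes "solution n \<xi> X (a # xs) h" "n < a" "h R \<noteq> 0"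
  shows "a \<notin> R"
proof
  assume "a \<in> R"
  then have "card ({1..n} \<inter> set [a]) < card (R \<inter> set [a])" using assms by simp
  then show False using assms dominated_zero[of n "[a]" xs h R] by (auto simp: solution_def)
qed

lemma solution_lead: "solution n \<xi> X xs h \<Longrightarrow> h {1..n} = X"
  by (simp add: solution_def)

end

context jucys_murphy_rep
begin

text \<open>\<open>eigen_unique\<close> for h - a g: the equation at \<open>S\<close> removes the
  only set inside \<open>{1..q}\<close> that could lie in the support.\<close>

lemma solution_diff_unique:
  assumes supp: "\<And>R. h R \<noteq> 0 \<or> g R \<noteq> 0 \<Longrightarrow> R \<subseteq> {1..N} \<and> (R \<subseteq> {1..q} \<longrightarrow> R = S)"
    and ev: "\<And>j R. j \<in> {q<..N} \<Longrightarrow> sU {j<..N} j h R = (1 + k * of_int (z j)) *s h R"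
      "\<And>j R. j \<in> {q<..N} \<Longrightarrow> sU {j<..N} j g R = (1 + k * of_int (z j)) *s g R"
    and eq: "h S = a *s g S"
  shows "h R = a *s g R"
proof -
  have "(\<lambda>R. h R + (- a) *s g R) R = 0"
  proof (rule eigen_unique)
    fix R assume *: "h R + (- a) *s g R \<noteq> 0"
    then have "h R \<noteq> 0 \<or> g R \<noteq> 0" by auto
    moreover have "R \<noteq> S" using eq * by auto
    ultimately show "R \<subseteq> {1..N} \<and> \<not> R \<subseteq> {1..q}" using supp by blast
  next
    fix j R assume "j \<in> {q<..N}"
    then show "sU {j<..N} j (\<lambda>R. h R + (- a) *s g R) R
        = (1 + k * of_int (z j)) *s (h R + (- a) *s g R)"
      unfolding sU_add by (simp add: ev algebra_simps)
  qed
  then show ?thesis by simp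
qed

end

section \<open>Jucys-Murphy sums and Dunkl operators on solutions\<close>

context seminormal_family
begin

lemma exists_solution_upt:
  assumes "T \<in> Y" "n \<le> N"
  shows "\<exists>h. solution n (spec n T) (X T) [1..<Suc N] h"
proof -
  have "[1..<Suc n] @ [Suc n..<Suc N] = [1..<Suc N]" using assms by (intro upt_append_upt) auto
  then show ?thesis using exists_solution[OF assms order_refl assms(2)] by (simp del: upt_Suc)
qed

lemma spec_high: "n < j \<Longrightarrow> spec n T j = 1 + k * of_int (c T j)"
  by (simp add: spec_def)

text \<open>For i > n, s_i acts on solutions as on the seminormal basis. Both s_i h - h / b and p g
  satisfy the equations of \<open>flip i T\<close> for j > n, and s_i fixes the leading set
  \<open>{1..n}\<close>, so their leading coefficients agree by \<open>tr_X\<close>; uniqueness does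
  the rest.\<close>

lemma solution_tr:
  assumes T: "T \<in> Y" and i: "n < i" "i < N"
    and h: "solution n (spec n T) (X T) [1..<Suc N] h"
    and g: "p i T \<noteq> 0 \<Longrightarrow> solution n (spec n (flip i T)) (X (flip i T)) [1..<Suc N] g"
  shows "sact (tr i (Suc i)) h R = (1 / of_int (c T i - c T (Suc i))) *s h R + p i T *s g R"
proof -
  let ?s = "tr i (Suc i)" and ?c = "c T"
  let ?b = "of_int (?c i - ?c (Suc i)) :: 'k" and ?x = "\<lambda>j. 1 + k * of_int (?c j)"
  let ?g = "- (1 / ?b)"
  \<comment> \<open>The contents of \<open>flip i T\<close>, written through \<open>T\<close> so
    that they make sense also when p i T = 0.\<close>
  define z where "z j = ?c (?s j)" for j
  have iN: "i \<in> {1..N}" "Suc i \<in> {1..N}" "1 \<le> i" using i by auto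
  have b: "?b \<noteq> 0" using c_Suc[OF T _ i(2)] i by simp
  have hU: "sU {j<..N} j h = (\<lambda>R. ?x j *s h R)" if "j \<in> {n<..N}" for j
    using solution_sU_upt[OF h, of j] that by (auto simp: spec_high)
  have gU: "p i T *s sU {j<..N} j g R = p i T *s (1 + k * of_int (z j)) *s g R" if "j \<in> {n<..N}" for j R
  proof (cases "p i T = 0")
    case False
    then have "c (flip i T) j = z j" using flip[OF T iN(3) i(2)] by (simp add: z_def)
    then show ?thesis
      using solution_sU_upt[OF g[OF False], of j] that by (simp add: spec_high)
  qed simp
  let ?Q = "{Suc i<..N}"
  have Qi: "{i<..N} = insert (Suc i) ?Q" using i by auto
  have finQ: "finite ?Q" "Suc i \<notin> ?Q" "?Q \<subseteq> {1..N}" "i \<notin> ?Q" by auto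
  have lin: "sact ?s (\<lambda>R. a *s f R) R = a *s sact ?s f R" for a f R by (simp add: sact_def P_scale)
  have tt: "sact ?s (sact ?s f) R = f R" for f R using iN by (simp add: sact_tr_tr)
  have Uh: "sU {j<..N} j (sact ?s h) R + ?g *s sU {j<..N} j h R
      = (1 + k * of_int (z j)) *s (sact ?s h R + ?g *s h R)" if j: "j \<in> {n<..N}" for j R
  proof -
    consider "j \<noteq> i" "j \<noteq> Suc i" | "j = i" | "j = Suc i" by blast
    then show ?thesis
    proof cases
      case 1
      have "sU {j<..N} j (sact ?s h) R = sact ?s (sU {j<..N} j h) R"
        using 1 iN j by (intro sU_tr_commute) auto
      moreover have "z j = ?c j" using 1 by (simp add: z_def)
      ultimately show ?thesis
        by (simp only: hU[OF j] lin scale_right_distrib scale_left_commute[of "?x j"])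
    next
      case 2
      have "sU {i<..N} i (sact ?s h) R = sU ?Q i (sact ?s h) R + k *s h R"
        unfolding Qi using finQ by (simp add: sU_insert tt)
      also have "sU ?Q i (sact ?s h) R = sact ?s (sU ?Q (Suc i) h) R"
        using finQ iN by (intro sU_tr_left) auto
      also have "\<dots> = ?x (Suc i) *s sact ?s h R"
        using i by (subst hU) (auto simp: lin)
      finally have 1: "sU {i<..N} i (sact ?s h) R = ?x (Suc i) *s sact ?s h R + k *s h R" .
      \<comment> \<open>The eigenvalues at i and i + 1 differ by \<open>k * ?b\<close>, which is why
        -1/b is the multiple of h that completes s_i h to an eigenvector.\<close>
      have 2: "k + ?g * ?x i = ?x (Suc i) * ?g"
        using b by (simp add: field_simps)
      have "sU {i<..N} i h R = ?x i *s h R" using hU[of i] i by auto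
      then have "sU {i<..N} i (sact ?s h) R + ?g *s sU {i<..N} i h R
        = ?x (Suc i) *s sact ?s h R
          + (k + ?g * ?x i) *s h R"
        unfolding 1 by (simp only: scale_left_distrib[of k] scale_scale add.assoc)
      then show ?thesis unfolding 2 using \<open>j = i\<close>
        by (simp add: z_def scale_right_diff_distrib)
    next
      case 3
      have "sU ?Q (Suc i) (sact ?s h) R = sact ?s (sU ?Q i h) R"
        using sU_tr_left[of "Suc i" i ?Q h R] finQ iN by (simp add: tr_commute)
      also have "sU ?Q i h = (\<lambda>R. ?x i *s h R - k *s sact ?s h R)"
      proof
        fix R
        have "sU {i<..N} i h R = sU ?Q i h R + k *s sact ?s h R"
          unfolding Qi using finQ by (simp add: sU_insert)
        moreover have "sU {i<..N} i h R = ?x i *s h R" using hU[of i] i by auto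
        ultimately show "sU ?Q i h R = ?x i *s h R - k *s sact ?s h R" by simp
      qed
      also have "sact ?s (\<lambda>R. ?x i *s h R - k *s sact ?s h R) R
          = ?x i *s sact ?s h R - k *s h R"
        using tt[of h R] by (simp add: sact_def P_diff P_scale)
      finally have 1: "sU ?Q (Suc i) (sact ?s h) R = ?x i *s sact ?s h R - k *s h R" .
      have 2: "- k + ?g * ?x (Suc i) = ?x i * ?g"
        using b by (simp add: field_simps)
      have "sU ?Q (Suc i) h R = ?x (Suc i) *s h R" using hU[of "Suc i"] i by auto
      then have "sU ?Q (Suc i) (sact ?s h) R + ?g *s sU ?Q (Suc i) h R
        = ?x i *s sact ?s h R
          + (- k + ?g * ?x (Suc i)) *s h R"
        unfolding 1
        by (simp only: scale_left_distrib[of "- k"] scale_scale scale_minus_left add.assoc diff_conv_add_uminus)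
      then show ?thesis unfolding 2 using \<open>j = Suc i\<close>
        by (simp add: z_def scale_right_diff_distrib)
    qed
  qed
  define D where "D R = (sact ?s h R + ?g *s h R) + (- p i T) *s g R" for R
  have "D R = 0"
  proof (rule eigen_unique)
    fix R assume DR: "D R \<noteq> 0"
    have "R \<subseteq> {1..N} \<and> card R = n"
    proof -
      consider "h (?s -` R) \<noteq> 0" | "h R \<noteq> 0" | "p i T \<noteq> 0" "g R \<noteq> 0"
        using DR by (force simp: D_def sact_def)
      then show ?thesis
      proof cases
        case 1
        then have *: "?s -` R \<subseteq> {1..N}" "card (?s -` R) = n" using solution_supp[OF h] by auto
        have "R = ?s ` (?s -` R)" by (simp add: surj_image_vimage_eq)
        also have "\<dots> \<subseteq> ?s ` {1..N}" using *(1) by (rule image_mono)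
        also have "\<dots> = {1..N}" using permutes_image[OF tr_permutes[OF iN(1,2)]] .
        finally show ?thesis using * by (simp add: card_tr_vimage_eq)
      next
        case 2
        then show ?thesis using solution_supp[OF h] by auto
      next
        case 3
        then show ?thesis using solution_supp[OF g] by auto
      qed
    qed
    moreover have "R \<noteq> {1..n}"
    proof
      assume R: "R = {1..n}"
      have "?s -` R = R" unfolding R using i by (auto simp: tr_def split: if_splits)
      then have "sact ?s h R = (1 / ?b) *s X T + p i T *s X (flip i T)"
        using solution_lead[OF h] tr_X[OF T iN(3) i(2)] R by (simp add: sact_def)
      moreover have "p i T *s g R = p i T *s X (flip i T)"
        using solution_lead[OF g] R by (cases "p i T = 0") auto
      ultimately have "D R = 0" using solution_lead[OF h] R by (auto simp: D_def)
      then show False using DR by simp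
    qed
    moreover have "R = {1..n}" if "R \<subseteq> {1..n}" "card R = n" using that by (intro card_subset_eq) auto
    ultimately show "R \<subseteq> {1..N} \<and> \<not> R \<subseteq> {1..n}" by blast
  next
    fix j R assume j: "j \<in> {n<..N}"
    have "sU {j<..N} j D R = (sU {j<..N} j (sact ?s h) R + ?g *s sU {j<..N} j h R)
        - p i T *s sU {j<..N} j g R"
      unfolding D_def[abs_def] sU_add by simp
    then show "sU {j<..N} j D R = (1 + k * of_int (z j)) *s D R"
      unfolding Uh[OF j] gU[OF j] by (simp add: D_def algebra_simps)
  qed
  then show ?thesis by (simp add: D_def algebra_simps)
qed

text \<open>Downward induction from j = N, where the sum is empty and the content 0. The recursion
  is J_j = s_j J_(j+1) s_j + s_j, with s_j evaluated by \<open>solution_tr\<close>; the auxiliary g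
  belongs to the flipped tableau.\<close>

lemma solution_sJ:
  assumes T: "T \<in> Y" and n: "n < j" "j \<le> N"
    and h: "solution n (spec n T) (X T) [1..<Suc N] h"
  shows "sJ {j<..N} j h R = of_int (c T j) *s h R"
  using n T h
proof (induction "N - j" arbitrary: j T h R)
  case 0
  then show ?case using c_N by (simp add: sJ_def)
next
  case (Suc d)
  let ?s = "tr j (Suc j)" and ?Q = "{Suc j<..N}" and ?b = "of_int (c T j - c T (Suc j)) :: 'k"
  have j: "j < N" "1 \<le> j" "j \<in> {1..N}" "Suc j \<in> {1..N}" using Suc by auto
  have b: "?b \<noteq> 0" using c_Suc[OF \<open>T \<in> Y\<close> j(2,1)] by simp
  obtain g where g: "p j T \<noteq> 0 \<Longrightarrow> solution n (spec n (flip j T)) (X (flip j T)) [1..<Suc N] g"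
  proof (cases "p j T = 0")
    case False
    then have "flip j T \<in> Y" using flip Suc.prems j by blast
    then have "\<exists>g. solution n (spec n (flip j T)) (X (flip j T)) [1..<Suc N] g"
      using exists_solution_upt Suc.prems by simp
    then show ?thesis using that by blast
  qed auto
  have s: "sact ?s h R = (1 / ?b) *s h R + p j T *s g R" for R
    using Suc.prems j g by (intro solution_tr) auto
  have hJ: "sJ ?Q (Suc j) h R = of_int (c T (Suc j)) *s h R" for R
    using Suc.prems Suc.hyps(2) j by (intro Suc.hyps(1)) auto
  have gJ: "p j T *s sJ ?Q (Suc j) g R = p j T *s of_int (c T j) *s g R" for R
  proof (cases "p j T = 0")
    case False
    then have "flip j T \<in> Y" "c (flip j T) (Suc j) = c T j" using flip[OF \<open>T \<in> Y\<close> j(2,1)] by auto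
    then show ?thesis
      using Suc.hyps(1)[of "Suc j" "flip j T" g R] Suc.prems Suc.hyps(2) j g[OF False] by auto
  qed simp
  have e: "(1 / ?b) * of_int (c T (Suc j)) = of_int (c T j) * (1 / ?b) - (1 / ?b) * ?b"
    using b by (simp add: field_simps)
  have sJs: "sJ ?Q (Suc j) (sact ?s h) = (\<lambda>R. of_int (c T j) *s sact ?s h R - h R)"
  proof
    fix R
    have "sact ?s h = (\<lambda>R. (1 / ?b) *s h R + p j T *s g R)" using s by auto
    then have "sJ ?Q (Suc j) (sact ?s h) R = sJ ?Q (Suc j) (\<lambda>R. 0 + (1 / ?b) *s h R) R + p j T *s sJ ?Q (Suc j) g R"
      by (simp only: sJ_add add_0_left)
    also have "sJ ?Q (Suc j) (\<lambda>R. 0 + (1 / ?b) *s h R) R = (1 / ?b) *s of_int (c T (Suc j)) *s h R"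
      unfolding sJ_add hJ by (simp add: sJ_def sact_def)
    also have "\<dots> + p j T *s sJ ?Q (Suc j) g R
        = of_int (c T j) *s ((1 / ?b) *s h R + p j T *s g R) - ((1 / ?b) * ?b) *s h R"
      unfolding gJ
      by (simp only: scale_scale e scale_left_diff_distrib scale_right_distrib mult.commute[of "p j T"])
        (simp add: algebra_simps)
    finally show "sJ ?Q (Suc j) (sact ?s h) R = of_int (c T j) *s sact ?s h R - h R"
      using b unfolding s by simp
  qed
  have img: "?s ` ?Q = ?Q" by (auto simp: tr_def image_iff)
  have "sJ ?Q j h R = sJ (?s ` ?Q) (?s (Suc j)) (sact ?s (sact ?s h)) R"
    unfolding img sact_tr_tr[OF j(3,4)] by simp
  also have "\<dots> = sact ?s (sJ ?Q (Suc j) (sact ?s h)) R"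
    using j by (intro sJ_sact tr_permutes) auto
  also have "\<dots> = of_int (c T j) *s h R - sact ?s h R"
    using fun_cong[OF sact_tr_tr[OF j(3,4)], of h R] unfolding sJs by (simp add: sact_def P_diff P_scale)
  finally have "sJ ?Q j h R = of_int (c T j) *s h R - sact ?s h R" .
  moreover have "{j<..N} = insert (Suc j) ?Q" using j by auto
  ultimately show ?case by (simp add: sJ_def)
qed

text \<open>U_j is x_j D_j + 1 + k J_j, and by \<open>solution_sJ\<close> the last two terms already
  account for the whole eigenvalue. So x_j D_j h = 0, and reading this at \<open>insert j R\<close>
  gives D_j h at R.\<close>

lemma solution_sD_zero:
  assumes "T \<in> Y" "n < j" "j \<le> N" "solution n (spec n T) (X T) [1..<Suc N] h"
  shows "sD j h R = 0"
proof (cases "j \<in> R")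
  case False
  have "sU {j<..N} j h R = (1 + k * of_int (c T j)) *s h R" for R
    using solution_sU_upt[OF assms(4), of j] assms(2,3) by (simp add: spec_high)
  then have "xD j h R = 0" for R
    by (simp add: sU_def solution_sJ[OF assms] algebra_simps)
  from this[of "insert j R"] False show ?thesis by (simp add: xD_def)
qed (simp add: sD_def)

text \<open>\<open>G\<close> will turn out to be theta_m^(-1) applied to the zeta of the smaller
  exponent. Its order of the variables starts with m, but for j > m the successors are the same as
  in the natural order, and the comparison uses only these operators.\<close>

theorem sD_solution:
  assumes T: "T \<in> Y" and m: "1 \<le> m" "m \<le> N"
    and h: "solution m (spec m T) (X T) [1..<Suc N] h"
    and G: "solution (m - 1) (spec (m - 1) T) (X T) ([m] @ [1..<m] @ [Suc m..<Suc N]) G"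
  shows "sD m h R = ((1 + k * of_int (c T m)) *
    (\<Prod>l\<in>{Suc m..N}. 1 - (k / (1 + k * (of_int (c T m) - of_int (c T l))))\<^sup>2)) *s G R" (is "_ = ?lam *s _")
proof (rule solution_diff_unique[of _ _ m "{1..<m}" "c T"])
  fix R assume *: "sD m h R \<noteq> 0 \<or> G R \<noteq> 0"
  \<comment> \<open>D_m lowers the degree by one and leaves no x_m, so among subsets of
    \<open>{1..m}\<close> only \<open>{1..<m}\<close> remains as leading set.\<close>
  have "R \<subseteq> {1..N} \<and> card R = m - 1 \<and> m \<notin> R"
  proof (cases "G R = 0")
    case True
    then have D: "sD m h R \<noteq> 0" using * by simp
    then have mR: "m \<notin> R" by (auto simp: sD_def)
    obtain l where l: "h (insert l R) \<noteq> 0" "l \<notin> R"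
    proof (cases "h (insert m R) = 0")
      case True
      then have "\<exists>l\<in>{1..N} - R - {m}. h (insert l R) \<noteq> 0"
        using D mR True by (auto simp: sD_def sum_negf P_minus) (metis (no_types, lifting) DiffI sum.neutral P_zero atLeastAtMost_iff singletonD)
      then show ?thesis using that by auto
    qed (use mR that in auto)
    then have "insert l R \<subseteq> {1..N}" "card (insert l R) = m" using solution_supp[OF h l(1)] by simp_all
    moreover from this(1) have "finite R" using finite_subset by auto
    ultimately show ?thesis using l mR by auto
  next
    case False
    then have "m \<notin> R" using solution_first[of "m - 1" _ _ m _ G R] G m by auto
    then show ?thesis using solution_supp[OF G False] by simp
  qed
  moreover have "R = {1..<m}" if "R \<subseteq> {1..m}" "card R = m - 1" "m \<notin> R"
  proof -
    have "R \<subseteq> {1..<m}" using that by (auto simp: less_le)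
    then show ?thesis using that by (intro card_subset_eq) auto
  qed
  ultimately show "R \<subseteq> {1..N} \<and> (R \<subseteq> {1..m} \<longrightarrow> R = {1..<m})" by blast
next
  fix j R assume j: "j \<in> {m<..N}"
  have "sD j (sD m h) R = 0" for R
  proof -
    have "sD j (sD m h) R = sD m (sD j h) R" using j m by (intro sD_sD_commute) auto
    also have "sD j h = (\<lambda>R. 0)" using solution_sD_zero[OF T _ _ h] j by auto
    also have "sD m (\<lambda>R. 0) R = 0" by (simp add: sD_def)
    finally show ?thesis .
  qed
  then have "xD j (sD m h) R = 0" by (simp add: xD_def)
  moreover have "sJ {j<..N} j (sD m h) R = of_int (c T j) *s sD m h R"
  proof -
    have "sJ {j<..N} j (sD m h) R = sD m (sJ {j<..N} j h) R" using j m by (intro sJ_sD) auto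
    also have "sJ {j<..N} j h = (\<lambda>R. of_int (c T j) *s h R)" using solution_sJ[OF T _ _ h] j by auto
    finally show ?thesis by (simp add: sD_scale)
  qed
  ultimately show "sU {j<..N} j (sD m h) R = (1 + k * of_int (c T j)) *s sD m h R"
    by (simp add: sU_def algebra_simps)
  show "sU {j<..N} j G R = (1 + k * of_int (c T j)) *s G R"
    using solution_sU[of "m - 1" "spec (m - 1) T" "X T" "[m] @ [1..<m]" "Suc m" G j] G j
      spec_high[of "m - 1" j T] m by (auto simp del: upt_Suc)
next
  have neq: "spec m T i \<noteq> spec m T l" if "Suc m \<le> i" "l \<le> m" for i l
    using spec_neq[of l m i T] that by auto
  have "[1..<Suc m] = [1..<m] @ [m]" using m by simp
  then have "solution m (spec m T) (X T) ([] @ [Suc m..<Suc N] @ [1..<m] @ [m])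
      (\<lambda>R. if R = {1..m} then X T else 0)"
    using solution_start[OF m(2) J_X[OF T]] by (simp add: spec_def[abs_def] del: upt_Suc)
  then have "\<exists>h. solution m (spec m T) (X T) ([] @ [1..<m] @ [Suc m..<Suc N] @ [m]) h"
    by (rule solution_move_block) (use neq in \<open>auto simp del: upt_Suc\<close>)
  then obtain h1 where h1: "solution m (spec m T) (X T) ([1..<m] @ [Suc m..<Suc N] @ m # []) h1"
    by (auto simp del: upt_Suc)
  \<comment> \<open>In the order of \<open>h1\<close> the index m comes last. Moving it back past N,
    ..., m + 1 costs one intertwiner each, and these become the \<open>raise\<close> factors;
    uniqueness identifies the result with the given h.\<close>
  define h2 where "h2 = foldr (\<lambda>i. intertwine (spec m T) i m) [Suc m..<Suc N] h1"
  have "solution m (spec m T) (X T) ([1..<m] @ m # [Suc m..<Suc N] @ []) h2"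
    unfolding h2_def using neq by (intro solution_move_left[OF h1]) auto
  moreover have "[1..<m] @ m # [Suc m..<Suc N] = [1..<Suc N]"
    using m upt_append_upt[of 1 m "Suc N"] by (simp add: upt_conv_Cons[of m] del: upt_Suc)
  ultimately have h2: "solution m (spec m T) (X T) [1..<Suc N] h2" by simp
  have hh2: "h R = 1 *s h2 R" for R
  proof (rule solution_diff_unique[of _ _ m "{1..m}" "c T"])
    fix R assume "h R \<noteq> 0 \<or> h2 R \<noteq> 0"
    then have "R \<subseteq> {1..N}" "card R = m" using solution_supp[OF h] solution_supp[OF h2] by auto
    then show "R \<subseteq> {1..N} \<and> (R \<subseteq> {1..m} \<longrightarrow> R = {1..m})"
      using card_subset_eq[of "{1..m}" R] by simp
  next
    fix j R assume "j \<in> {m<..N}"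
    then show "sU {j<..N} j h R = (1 + k * of_int (c T j)) *s h R"
      "sU {j<..N} j h2 R = (1 + k * of_int (c T j)) *s h2 R"
      using solution_sU_upt[OF h, of j] solution_sU_upt[OF h2, of j] by (simp_all add: spec_high)
  qed (simp add: solution_lead[OF h] solution_lead[OF h2])
  let ?e = "\<lambda>l. k / (1 + k * (of_int (c T m) - of_int (c T l)))"
  have h1z: "(\<Sum>l\<in>{m..N}. h1 (insert l {1..<m})) = X T"
  proof -
    \<comment> \<open>In this order l precedes m, so the prefix ending in l excludes a set that
      contains l instead of m.\<close>
    have "h1 (insert l {1..<m}) = 0" if "l \<in> {Suc m..N}" for l
    proof -
      have "[Suc m..<Suc N] = [Suc m..<Suc l] @ [Suc l..<Suc N]"
        using that by (intro upt_append_upt[symmetric]) auto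
      then have "dominated m (([1..<m] @ [Suc m..<Suc l]) @ ([Suc l..<Suc N] @ [m])) h1"
        using h1 by (simp add: solution_def del: upt_Suc)
      moreover have "{1..m} \<inter> set ([1..<m] @ [Suc m..<Suc l]) = {1..<m}"
        "insert l {1..<m} \<inter> set ([1..<m] @ [Suc m..<Suc l]) = insert l {1..<m}" using that by auto
      then have "card ({1..m} \<inter> set ([1..<m] @ [Suc m..<Suc l]))
          < card (insert l {1..<m} \<inter> set ([1..<m] @ [Suc m..<Suc l]))" using that by (simp del: upt_Suc)
      ultimately show ?thesis by (rule dominated_zero)
    qed
    moreover have "{m..N} = insert m {Suc m..N}" using m by auto
    moreover have "insert m {1..<m} = {1..m}" using m by auto
    ultimately show ?thesis using solution_lead[OF h1] by simp
  qed
  \<comment> \<open>All added terms vanish, and the full sum can be evaluated by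
    \<open>sum_sD\<close>.\<close>
  have "sD m h {1..<m} = (\<Sum>j\<in>{m..N}. sD j h {1..<m})"
    using m solution_sD_zero[OF T _ _ h] by (subst sum.remove[of _ m]) (auto intro!: sum.neutral)
  also have "\<dots> = (\<Sum>l\<in>{m..N}. h2 (insert l {1..<m}))"
    using m by (simp add: sum_sD hh2)
  also have "\<dots> = foldr (raise (\<lambda>i. k / (spec m T m - spec m T i)) m) [Suc m..<Suc N] (X T)"
    unfolding h2_def using m by (subst sum_foldr_intertwine) (auto simp: h1z)
  also have "\<dots> = foldr (raise ?e m) [Suc m..<Suc N] (X T)"
    by (intro foldr_cong) (auto simp: raise_def spec_def algebra_simps)
  also have "\<dots> = ?lam *s X T"
    using k_generic[of "c T m"] k_generic[of "c T m - c T _"] m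
    by (intro foldr_raise_eigenvector[OF J_X[OF T]]) (auto simp del: of_int_diff simp: of_int_diff[symmetric])
  finally show "sD m h {1..<m} = ?lam *s G {1..<m}"
  proof -
    assume "sD m h {1..<m} = ?lam *s X T"
    moreover have "{1..<m} = {1..m - 1}" using m by auto
    ultimately show ?thesis using solution_lead[OF G] by metis
  qed
qed

end

section \<open>Young's seminormal representation\<close>

locale young =
  fixes tau :: "nat list"
  assumes partition: "is_partition tau (sum_list tau)"
begin

abbreviation "N \<equiv> sum_list tau"

section \<open>Cells, contents and exchanges in reverse standard tableaux\<close>

lemma part_antimono: "1 \<le> i \<Longrightarrow> i \<le> j \<Longrightarrow> part tau j \<le> part tau i"
  using partition unfolding is_partition_def part_def sorted_rev_iff_nth_mono by auto

lemma diagram_down: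
  "(i', j') \<in> diagram tau \<Longrightarrow> 1 \<le> i \<Longrightarrow> i \<le> i' \<Longrightarrow> 1 \<le> j \<Longrightarrow> j \<le> j' \<Longrightarrow> (i, j) \<in> diagram tau"
  using part_antimono[of i i'] by (auto simp: diagram_def)

lemma finite_diagram: "finite (diagram tau)"
proof (rule finite_subset)
  show "diagram tau \<subseteq> {1..length tau} \<times> {1..part tau 1}"
    using part_antimono[of 1] by (force simp: diagram_def)
qed simp

lemma finite_Ytab: "finite (Ytab tau)"
proof (rule finite_subset)
  show "Ytab tau \<subseteq> {T. \<forall>c. (c \<in> diagram tau \<longrightarrow> T c \<in> {1..N}) \<and> (c \<notin> diagram tau \<longrightarrow> T c = 0)}"
    by (auto simp: Ytab_def bij_betw_def)
qed (intro finite_set_of_finite_funs finite_diagram, simp)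

text \<open>Exchanging entries may destroy monotonicity, while the content formulas are still needed
  for the result; bijectivity is preserved and suffices for them.\<close>

definition filling :: "tabl \<Rightarrow> bool" where
  "filling T \<longleftrightarrow> bij_betw T (diagram tau) {1..N}"

lemma Ytab_filling: "T \<in> Ytab tau \<Longrightarrow> filling T"
  by (simp add: Ytab_def filling_def)

lemma cell_of_eq:
  assumes "filling T" "x \<in> diagram tau" "T x = n"
  shows "cell_of tau T n = x"
  unfolding cell_of_def
  using assms by (intro the_equality) (auto simp: filling_def bij_betw_def inj_on_def)

lemma cell_of:
  assumes "filling T" "n \<in> {1..N}"
  shows "cell_of tau T n \<in> diagram tau" "T (cell_of tau T n) = n"
proof -
  have "n \<in> T ` diagram tau" using assms by (simp add: filling_def bij_betw_def)
  then obtain x where "x \<in> diagram tau" "T x = n" by blast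
  with cell_of_eq[OF assms(1) this] show "cell_of tau T n \<in> diagram tau" "T (cell_of tau T n) = n" by auto
qed

lemma swap_entries_eq: "1 \<le> i \<Longrightarrow> swap_entries T i x = tr i (Suc i) (T x)"
  by (simp add: swap_entries_def tr_def)

lemma swap_entries_swap_entries [simp]: "swap_entries (swap_entries T i) i = T"
  by (auto simp: swap_entries_def fun_eq_iff)

lemma filling_swap_entries:
  assumes "filling T" "1 \<le> i" "i < N"
  shows "filling (swap_entries T i)"
proof -
  have "bij_betw (tr i (Suc i)) {1..N} {1..N}"
    using assms by (intro permutes_imp_bij permutes_swap_id) auto
  then have "bij_betw (tr i (Suc i) \<circ> T) (diagram tau) {1..N}"
    using assms(1) bij_betw_trans unfolding filling_def by blast
  moreover have "tr i (Suc i) \<circ> T = swap_entries T i"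
    using assms(2) by (simp add: fun_eq_iff swap_entries_eq)
  ultimately show ?thesis by (simp add: filling_def)
qed

lemma cell_of_swap_entries:
  assumes "filling T" "1 \<le> i" "i < N" "j \<in> {1..N}"
  shows "cell_of tau (swap_entries T i) j = cell_of tau T (tr i (Suc i) j)"
proof -
  have "tr i (Suc i) j \<in> {1..N}"
    using assms permutes_in_image[OF permutes_swap_id[of i "{1..N}" "Suc i"], of j] by auto
  then show ?thesis
    using assms filling_swap_entries cell_of[OF assms(1)]
    by (intro cell_of_eq) (auto simp: swap_entries_eq)
qed

lemma content_swap_entries:
  assumes "filling T" "1 \<le> i" "i < N" "j \<in> {1..N}"
  shows "content tau (swap_entries T i) j = content tau T (tr i (Suc i) j)"
  using cell_of_swap_entries[OF assms] by (simp add: content_def row_def col_def)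

lemma Ytab_antimono:
  assumes T: "T \<in> Ytab tau" and d: "(i, j) \<in> diagram tau" "(i', j') \<in> diagram tau"
    and le: "i \<le> i'" "j \<le> j'" and ne: "(i, j) \<noteq> (i', j')"
  shows "T (i', j') < T (i, j)"
proof -
  have rows: "T (i, j') < T (i, j)" if "(i, j) \<in> diagram tau" "(i, j') \<in> diagram tau" "j < j'" for i j j'
    using T that unfolding Ytab_def by blast
  have cols: "T (i', j) < T (i, j)" if "(i, j) \<in> diagram tau" "(i', j) \<in> diagram tau" "i < i'" for i i' j
    using T that unfolding Ytab_def by blast
  have "(i, j') \<in> diagram tau"
    using d le by (intro diagram_down[OF d(2)]) (auto simp: diagram_def)
  then show ?thesis
    using rows[of i j j'] cols[of i j' i'] d le ne by (cases "i = i'"; cases "j = j'") auto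
qed

definition gap :: "tabl \<Rightarrow> nat \<Rightarrow> int" where
  "gap T i = content tau T i - content tau T (Suc i)"

lemma gap_swap_entries:
  "filling T \<Longrightarrow> 1 \<le> i \<Longrightarrow> i < N \<Longrightarrow> gap (swap_entries T i) i = - gap T i"
  by (simp add: gap_def content_swap_entries)

text \<open>In a common row or column the two cells are adjacent, since a cell between them would
  carry an entry strictly between i and i + 1. The same argument at a corner of their rectangle
  excludes that one lies strictly below and to the right of the other, so otherwise the differences
  of rows and columns add up.\<close>

lemma gap_cases:
  assumes T: "T \<in> Ytab tau" and i: "1 \<le> i" "i < N"
  shows "row tau T i = row tau T (Suc i) \<and> gap T i = 1
    \<or> col tau T i = col tau T (Suc i) \<and> row tau T i \<noteq> row tau T (Suc i) \<and> gap T i = -1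
    \<or> row tau T i \<noteq> row tau T (Suc i) \<and> col tau T i \<noteq> col tau T (Suc i) \<and> \<bar>gap T i\<bar> \<ge> 2"
proof -
  obtain r q where c1: "cell_of tau T i = (r, q)" by force
  obtain r' q' where c2: "cell_of tau T (Suc i) = (r', q')" by force
  have d: "(r, q) \<in> diagram tau" "T (r, q) = i" "(r', q') \<in> diagram tau" "T (r', q') = Suc i"
    using cell_of[OF Ytab_filling[OF T], of i] cell_of[OF Ytab_filling[OF T], of "Suc i"] i c1 c2 by auto
  have pos: "1 \<le> r" "1 \<le> q" "1 \<le> r'" "1 \<le> q'" using d by (auto simp: diagram_def)
  have defs: "row tau T i = r" "row tau T (Suc i) = r'" "col tau T i = q" "col tau T (Suc i) = q'"
    "gap T i = int q - int r - (int q' - int r')"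
    by (simp_all add: row_def col_def gap_def content_def c1 c2)
  note anti = Ytab_antimono[OF T]
  have no_between: False if "(a, b) \<in> diagram tau" "i < T (a, b)" "T (a, b) < Suc i" for a b
    using that by simp
  have "\<not> (r \<le> r' \<and> q \<le> q')" using anti[OF d(1,3)] d by fastforce
  moreover have "q = Suc q'" if "r = r'"
  proof (rule ccontr)
    assume "q \<noteq> Suc q'"
    then have "Suc q' < q" using that \<open>\<not> (r \<le> r' \<and> q \<le> q')\<close> by auto
    moreover have m: "(r, Suc q') \<in> diagram tau"
      using diagram_down[OF d(1)] pos \<open>Suc q' < q\<close> by auto
    ultimately have "T (r, q) < T (r, Suc q')" "T (r, Suc q') < T (r', q')"
      using anti[OF m d(1)] anti[OF d(3) m] that by auto
    then show False using d by simp
  qed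
  moreover have "r = Suc r'" if "q = q'"
  proof (rule ccontr)
    assume "r \<noteq> Suc r'"
    then have "Suc r' < r" using that \<open>\<not> (r \<le> r' \<and> q \<le> q')\<close> by auto
    moreover have m: "(Suc r', q) \<in> diagram tau"
      using diagram_down[OF d(1)] pos \<open>Suc r' < r\<close> by auto
    ultimately have "T (r, q) < T (Suc r', q)" "T (Suc r', q) < T (r', q')"
      using anti[OF m d(1)] anti[OF d(3) m] that by auto
    then show False using d by simp
  qed
  moreover have "\<not> (r' < r \<and> q' < q)"
  proof
    assume "r' < r \<and> q' < q"
    moreover from this have m: "(r', q) \<in> diagram tau"
      using diagram_down[OF d(1)] pos by auto
    ultimately have "T (r, q) < T (r', q)" "T (r', q) < T (r', q')"
      using anti[OF m d(1)] anti[OF d(3) m] by auto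
    then show False using d by simp
  qed
  ultimately consider "r = r'" "q = Suc q'" | "q = q'" "r = Suc r'" | "r < r'" "q' < q" | "r' < r" "q < q'"
    using less_linear[of r r'] less_linear[of q q'] by force
  then show ?thesis unfolding defs by cases auto
qed

lemma gap_nonzero: "T \<in> Ytab tau \<Longrightarrow> 1 \<le> i \<Longrightarrow> i < N \<Longrightarrow> gap T i \<noteq> 0"
  using gap_cases[of T i] by auto

text \<open>On a common diagonal the cells right of and below the upper one would both have to carry
  i + 1. This makes the third denominator in the braid relation nonzero.\<close>

lemma content_neq_Suc_Suc:
  assumes T: "T \<in> Ytab tau" and i: "1 \<le> i" "Suc i < N"
  shows "content tau T i \<noteq> content tau T (Suc (Suc i))"
proof
  assume eq: "content tau T i = content tau T (Suc (Suc i))"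
  obtain r q where c1: "cell_of tau T i = (r, q)" by force
  obtain r' q' where c2: "cell_of tau T (Suc (Suc i)) = (r', q')" by force
  have d: "(r, q) \<in> diagram tau" "T (r, q) = i" "(r', q') \<in> diagram tau" "T (r', q') = Suc (Suc i)"
    using cell_of[OF Ytab_filling[OF T], of i] cell_of[OF Ytab_filling[OF T], of "Suc (Suc i)"] i c1 c2 by auto
  have pos: "1 \<le> r" "1 \<le> q" "1 \<le> r'" "1 \<le> q'" using d by (auto simp: diagram_def)
  note anti = Ytab_antimono[OF T]
  have diag: "int q - int r = int q' - int r'"
    using eq by (simp add: content_def row_def col_def c1 c2)
  have "\<not> (r \<le> r' \<and> q \<le> q')" using anti[OF d(1,3)] d by fastforce
  then have lt: "r' < r" "q' < q" using diag by linarith+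
  have m: "(Suc r', q') \<in> diagram tau" "(r', Suc q') \<in> diagram tau"
    using lt pos by (auto intro!: diagram_down[OF d(1)])
  have "T (Suc r', q') = Suc i"
    using anti[OF m(1) d(1)] anti[OF d(3) m(1)] lt d by auto
  moreover have "T (r', Suc q') = Suc i"
    using anti[OF m(2) d(1)] anti[OF d(3) m(2)] lt d by auto
  ultimately have "(Suc r', q') = (r', Suc q')"
    using Ytab_filling[OF T] m unfolding filling_def bij_betw_def inj_on_def by metis
  then show False by simp
qed

lemma content_N:
  assumes T: "T \<in> Ytab tau" and "1 \<le> N"
  shows "content tau T N = 0"
proof -
  obtain r q where c: "cell_of tau T N = (r, q)" by force
  have d: "(r, q) \<in> diagram tau" "T (r, q) = N"
    using cell_of[OF Ytab_filling[OF T], of N] assms c by auto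
  then have m: "(1, 1) \<in> diagram tau" by (intro diagram_down[OF d(1)]) (auto simp: diagram_def)
  have "T (1, 1) \<in> {1..N}" using m Ytab_filling[OF T] by (auto simp: filling_def bij_betw_def)
  then have "(r, q) = (1, 1)"
    using Ytab_antimono[OF T m d(1)] d by (force simp: diagram_def)
  then show ?thesis by (simp add: content_def row_def col_def c)
qed

text \<open>Only the comparison between i and i + 1 is reversed, and these entries share neither a
  row nor a column.\<close>

lemma swap_entries_Ytab:
  assumes T: "T \<in> Ytab tau" and i: "1 \<le> i" "i < N" and gap: "\<bar>gap T i\<bar> \<ge> 2"
  shows "swap_entries T i \<in> Ytab tau"
proof -
  have rc: "row tau T i \<noteq> row tau T (Suc i)" "col tau T i \<noteq> col tau T (Suc i)"
    using gap_cases[OF T i] gap by auto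
  have cell: "cell_of tau T (T x) = x" if "x \<in> diagram tau" for x
    using cell_of_eq[OF Ytab_filling[OF T] that] by simp
  have lt: "swap_entries T i x < swap_entries T i y"
    if "T x < T y" "x \<in> diagram tau" "y \<in> diagram tau" "fst x = fst y \<or> snd x = snd y" for x y
  proof -
    have "\<not> (T x = i \<and> T y = Suc i)"
      using cell[of x] cell[of y] that rc by (auto simp: row_def col_def)
    then show ?thesis using that(1) by (auto simp: swap_entries_def)
  qed
  have "swap_entries T i x = 0" if "x \<notin> diagram tau" for x
  proof -
    have "T x = 0" using T that unfolding Ytab_def by blast
    then show ?thesis using i by (simp add: swap_entries_def)
  qed
  moreover have "bij_betw (swap_entries T i) (diagram tau) {1..N}"
    using filling_swap_entries[OF Ytab_filling[OF T] i] by (simp add: filling_def)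
  moreover have "T (a, b') < T (a, b)" if "(a, b) \<in> diagram tau" "(a, b') \<in> diagram tau" "b < b'" for a b b'
    using T that unfolding Ytab_def by blast
  moreover have "T (a', b) < T (a, b)" if "(a, b) \<in> diagram tau" "(a', b) \<in> diagram tau" "a < a'" for a a' b
    using T that unfolding Ytab_def by blast
  ultimately show ?thesis unfolding Ytab_def by (auto intro!: lt)
qed

text \<open>The argument is the gap of the tableau whose coefficient is being computed, the negative
  of the \<open>b\<close> in \<open>rep_s_basis\<close>; hence the two signs are exchanged.\<close>

definition swap_coeff :: "int \<Rightarrow> K" where
  "swap_coeff b = (if b \<le> -2 then 1 else if 2 \<le> b then 1 - 1 / (of_int b)\<^sup>2 else 0)"

lemma swap_coeff_mult: "b \<noteq> 0 \<Longrightarrow> swap_coeff b * swap_coeff (- b) = 1 - 1 / (of_int b)\<^sup>2"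
proof -
  assume "b \<noteq> 0"
  then consider "b \<le> -2" | "b = 1" | "b = -1" | "2 \<le> b" by linarith
  then show ?thesis by cases (auto simp: swap_coeff_def)
qed

lemma swap_coeff_nonzero: "swap_coeff b \<noteq> 0 \<Longrightarrow> \<bar>b\<bar> \<ge> 2"
  by (auto simp: swap_coeff_def split: if_splits)

text \<open>\<open>young_op\<close> extends \<open>rep_s\<close> by the identity on the span of the functions supported outside
  \<open>Ytab tau\<close>; this makes it an action on the whole of \<open>vec\<close>.\<close>

definition formal_op :: "nat \<Rightarrow> vec \<Rightarrow> vec" where
  "formal_op i v S = v S / of_int (gap S i) + swap_coeff (gap S i) * v (swap_entries S i)"

definition young_op :: "nat \<Rightarrow> vec \<Rightarrow> vec" where
  "young_op i v S = (if S \<in> Ytab tau then formal_op i v S else v S)"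

definition inV :: "vec \<Rightarrow> bool" where
  "inV v \<longleftrightarrow> (\<forall>S. S \<notin> Ytab tau \<longrightarrow> v S = 0)"

lemma young_op_inV: "inV v \<Longrightarrow> inV (young_op i v)"
  by (simp add: inV_def young_op_def)

lemma rep_s_basis_eq:
  assumes T: "T \<in> Ytab tau" and i: "1 \<le> i" "i < N"
  shows "rep_s_basis tau i T S = (if S = T then 1 / of_int (gap T i) else 0)
    + (if S = swap_entries T i then swap_coeff (- gap T i) else 0)"
proof -
  have ne: "swap_entries T i \<noteq> T"
  proof
    assume *: "swap_entries T i = T"
    have "swap_entries T i (cell_of tau T i) = Suc i"
      using cell_of[OF Ytab_filling[OF T], of i] i by (simp add: swap_entries_def)
    then show False using cell_of[OF Ytab_filling[OF T], of i] i * by simp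
  qed
  consider "row tau T i = row tau T (Suc i)" "gap T i = 1"
    | "col tau T i = col tau T (Suc i)" "row tau T i \<noteq> row tau T (Suc i)" "gap T i = -1"
    | "row tau T i \<noteq> row tau T (Suc i)" "col tau T i \<noteq> col tau T (Suc i)" "2 \<le> gap T i"
    | "row tau T i \<noteq> row tau T (Suc i)" "col tau T i \<noteq> col tau T (Suc i)" "gap T i \<le> -2" "\<not> 2 \<le> gap T i"
  proof -
    have "2 \<le> \<bar>gap T i\<bar> \<Longrightarrow> 2 \<le> gap T i \<or> gap T i \<le> -2 \<and> \<not> 2 \<le> gap T i" by linarith
    then show thesis using gap_cases[OF assms] that by blast
  qed
  then show ?thesis
    using ne ne[symmetric]
    by cases (simp_all add: rep_s_basis_def Let_def gap_def[symmetric] basis_def smult_vec_def swap_coeff_def)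
qed

lemma sum_fun_apply: "(\<Sum>x\<in>A. f x) S = (\<Sum>x\<in>A. f x S :: 'a :: comm_monoid_add)"
  by (induction A rule: infinite_finite_induct) auto

lemma rep_s_eq:
  assumes v: "inV v" and i: "1 \<le> i" "i < N"
  shows "rep_s tau i v = young_op i v"
proof
  fix S
  have "rep_s tau i v S = (\<Sum>T\<in>Ytab tau. v T * rep_s_basis tau i T S)"
    by (simp add: rep_s_def sum_fun_apply smult_vec_def)
  also have "\<dots> = (\<Sum>T\<in>Ytab tau. if T = S then v T / of_int (gap T i) else 0)
      + (\<Sum>T\<in>Ytab tau. if T = swap_entries S i then v T * swap_coeff (- gap T i) else 0)"
    unfolding sum.distrib[symmetric]
  proof (intro sum.cong refl)
    fix T assume "T \<in> Ytab tau"
    moreover have "T = swap_entries S i \<longleftrightarrow> S = swap_entries T i" by auto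
    ultimately show "v T * rep_s_basis tau i T S = (if T = S then v T / of_int (gap T i) else 0)
      + (if T = swap_entries S i then v T * swap_coeff (- gap T i) else 0)"
      using i by (simp add: rep_s_basis_eq ring_distribs)
  qed
  also have "\<dots> = (if S \<in> Ytab tau then v S / of_int (gap S i) else 0)
      + (if swap_entries S i \<in> Ytab tau then v (swap_entries S i) * swap_coeff (- gap (swap_entries S i) i) else 0)"
    by (simp add: finite_Ytab)
  also have "\<dots> = young_op i v S"
  proof (cases "S \<in> Ytab tau")
    case True
    then show ?thesis
      using v i gap_swap_entries[OF Ytab_filling[OF True]] by (auto simp: young_op_def formal_op_def inV_def)
  next
    case False
    \<comment> \<open>Were this coefficient nonzero, exchanging back would make \<open>S\<close>
      itself a tableau.\<close>
    have "swap_coeff (- gap (swap_entries S i) i) = 0" if "swap_entries S i \<in> Ytab tau"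
      using swap_entries_Ytab[OF that i] swap_coeff_nonzero False by force
    then show ?thesis using False v by (auto simp: young_op_def inV_def)
  qed
  finally show "rep_s tau i v S = young_op i v S" .
qed

text \<open>Values outside \<open>Ytab tau\<close> enter only with coefficient 0. So the Coxeter
  relations can be checked for the formula \<open>formal_op\<close>, even where intermediate
  fillings are not standard.\<close>

lemma formal_op_cong:
  assumes "\<And>S. S \<in> Ytab tau \<Longrightarrow> v S = w S" "S \<in> Ytab tau" "1 \<le> i" "i < N"
  shows "formal_op i v S = formal_op i w S"
proof (cases "swap_coeff (gap S i) = 0")
  case False
  then have "swap_entries S i \<in> Ytab tau" using assms swap_coeff_nonzero swap_entries_Ytab by blast
  with assms show ?thesis by (simp add: formal_op_def)
qed (simp add: formal_op_def assms)

lemma young_op_formal: "S \<in> Ytab tau \<Longrightarrow> young_op i v S = formal_op i v S"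
  by (simp add: young_op_def)

lemma young_op_square:
  assumes "1 \<le> i" "i < N"
  shows "young_op i (young_op i v) = v"
proof
  fix S
  show "young_op i (young_op i v) S = v S"
  proof (cases "S \<in> Ytab tau")
    case True
    let ?b = "gap S i"
    have b: "?b \<noteq> 0" "(of_int ?b :: K) \<noteq> 0" using gap_nonzero[OF True assms] by auto
    have "young_op i (young_op i v) S = formal_op i (formal_op i v) S"
      using True assms by (auto simp: young_op_formal intro: formal_op_cong)
    also have "\<dots> = (1 / (of_int ?b)\<^sup>2 + swap_coeff ?b * swap_coeff (- ?b)) * v S"
      using gap_swap_entries[OF Ytab_filling[OF True] assms]
      by (simp add: formal_op_def power2_eq_square algebra_simps add_divide_distrib)
    finally show ?thesis using swap_coeff_mult[OF b(1)] by simp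
  qed (simp add: young_op_def)
qed

lemma young_op_commute:
  assumes "1 \<le> i" "Suc i < j" "j < N"
  shows "young_op i (young_op j v) = young_op j (young_op i v)"
proof
  fix S
  show "young_op i (young_op j v) S = young_op j (young_op i v) S"
  proof (cases "S \<in> Ytab tau")
    case True
    note f = Ytab_filling[OF True]
    have "gap (swap_entries S i) j = gap S j" "gap (swap_entries S j) i = gap S i"
      using assms f by (simp_all add: gap_def content_swap_entries tr_def)
    moreover have "swap_entries (swap_entries S i) j = swap_entries (swap_entries S j) i"
      using assms by (auto simp: swap_entries_def fun_eq_iff)
    ultimately have "formal_op i (formal_op j v) S = formal_op j (formal_op i v) S"
      by (simp add: formal_op_def add_divide_distrib algebra_simps)
    moreover have "young_op i (young_op j v) S = formal_op i (formal_op j v) S"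
      "young_op j (young_op i v) S = formal_op j (formal_op i v) S"
      using True assms by (auto simp: young_op_formal intro: formal_op_cong)
    ultimately show ?thesis by simp
  qed (simp add: young_op_def)
qed

text \<open>Both sides are expanded in the values of v at the six fillings obtained from S by
  permuting i, i + 1, i + 2. With gaps X, Y and Z = X + Y, the coefficients agree by the partial
  fraction 1/(XY) = 1/(XZ) + 1/(YZ).\<close>

lemma young_op_braid:
  assumes "1 \<le> i" "Suc i < N"
  shows "young_op i (young_op (Suc i) (young_op i v)) = young_op (Suc i) (young_op i (young_op (Suc i) v))"
proof
  fix S
  show "young_op i (young_op (Suc i) (young_op i v)) S = young_op (Suc i) (young_op i (young_op (Suc i) v)) S"
  proof (cases "S \<in> Ytab tau")
    case True
    let ?j = "Suc i"
    define x where "x = gap S i"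
    define y where "y = gap S ?j"
    define X Y where "X = (of_int x :: K)" and "Y = (of_int y :: K)"
    have xy: "x \<noteq> 0" "y \<noteq> 0" "x + y \<noteq> 0"
      using gap_nonzero[OF True] content_neq_Suc_Suc[OF True] assms by (auto simp: x_def y_def gap_def)
    define Z where "Z = (of_int (x + y) :: K)"
    have XY: "X \<noteq> 0" "Y \<noteq> 0" "Z \<noteq> 0" "Z = X + Y"
      using xy by (simp_all add: X_def Y_def Z_def del: of_int_add) simp
    have reduce: "young_op a (young_op b (young_op a v)) S = formal_op a (formal_op b (formal_op a v)) S"
      if "1 \<le> a" "a < N" "1 \<le> b" "b < N" for a b
    proof -
      have "young_op b (young_op a v) S' = formal_op b (formal_op a v) S'" if "S' \<in> Ytab tau" for S'
        using that \<open>1 \<le> b\<close> \<open>b < N\<close> by (auto simp: young_op_formal intro: formal_op_cong)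
      then show ?thesis using that True by (auto simp: young_op_formal intro: formal_op_cong)
    qed
    let ?S1 = "swap_entries S i" and ?S2 = "swap_entries S ?j"
    let ?S12 = "swap_entries ?S1 ?j" and ?S21 = "swap_entries ?S2 i"
    have f: "filling S" "filling ?S1" "filling ?S2" "filling ?S12" "filling ?S21"
      using Ytab_filling[OF True] assms by (auto intro!: filling_swap_entries)
    have g1: "gap ?S1 i = - x" "gap ?S1 ?j = x + y" "gap ?S2 ?j = - y" "gap ?S2 i = x + y"
      using assms f by (simp_all add: gap_def content_swap_entries x_def y_def tr_def)
    have g2: "gap ?S12 i = y" "gap ?S21 ?j = x"
      using assms f by (simp_all add: gap_def content_swap_entries x_def y_def tr_def)
    have "tr i ?j (tr ?j (Suc ?j) (tr i ?j z)) = tr ?j (Suc ?j) (tr i ?j (tr ?j (Suc ?j) z))" for z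
      by (auto simp: tr_def)
    then have w: "swap_entries ?S12 i = swap_entries ?S21 ?j"
      using assms by (simp add: swap_entries_eq fun_eq_iff)
    have px: "swap_coeff x * swap_coeff (- x) = 1 - 1 / X\<^sup>2" and py: "swap_coeff y * swap_coeff (- y) = 1 - 1 / Y\<^sup>2"
      using swap_coeff_mult xy by (auto simp: X_def Y_def)
    have c0: "1 / (X * Y * X) + swap_coeff x * swap_coeff (- x) / Z
        = 1 / (Y * X * Y) + swap_coeff y * swap_coeff (- y) / Z"
    proof -
      have "1 / X\<^sup>2 - 1 / Y\<^sup>2 = (1 / (X * Y * X) - 1 / (Y * X * Y)) * Z"
        unfolding XY(4) using XY(1,2) by (simp add: field_simps power2_eq_square)
      then have "(1 / X\<^sup>2 - 1 / Y\<^sup>2) / Z = 1 / (X * Y * X) - 1 / (Y * X * Y)"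
        using XY(3) by simp
      then show ?thesis unfolding px py by (simp add: diff_divide_distrib algebra_simps)
    qed
    have c1: "1 / (X * Y) - 1 / (Z * X) = 1 / (Y * Z)"
      "1 / (X * Y) - 1 / (Z * Y) = 1 / (X * Z)"
    proof -
      have h: "1 / (U * V) - 1 / (W * U) = 1 / (V * W)" if "U \<noteq> 0" "V \<noteq> 0" "W \<noteq> 0" "W = U + V" for U V W :: K
      proof -
        have "1 / (U * V) = W / (U * V * W)" "1 / (W * U) = V / (U * V * W)" "1 / (V * W) = U / (U * V * W)"
          using that(1-3) by simp_all
        then show ?thesis using that(4) by (simp add: add_divide_distrib)
      qed
      show "1 / (X * Y) - 1 / (Z * X) = 1 / (Y * Z)"
        using XY by (intro h) auto
      have "1 / (Y * X) - 1 / (Z * Y) = 1 / (X * Z)"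
        using XY by (intro h) (auto simp: add.commute)
      then show "1 / (X * Y) - 1 / (Z * Y) = 1 / (X * Z)"
        by (simp only: mult.commute[of Y X])
    qed
    have l: "formal_op i (formal_op ?j (formal_op i v)) S
      = (1 / (X * Y * X) + swap_coeff x * swap_coeff (- x) / Z) * v S
        + swap_coeff x * (1 / (X * Y) - 1 / (Z * X)) * v ?S1
        + swap_coeff y / (X * Z) * v ?S2
        + swap_coeff y * swap_coeff (x + y) / X * v ?S21
        + swap_coeff x * swap_coeff (x + y) / Y * v ?S12
        + swap_coeff x * swap_coeff (x + y) * swap_coeff y * v (swap_entries ?S12 i)"
      by (simp add: formal_op_def g1 g2 flip: x_def y_def del: of_int_add)
        (simp add: algebra_simps add_divide_distrib diff_divide_distrib flip: X_def Y_def Z_def del: of_int_add)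
    have r: "formal_op ?j (formal_op i (formal_op ?j v)) S
      = (1 / (Y * X * Y) + swap_coeff y * swap_coeff (- y) / Z) * v S
        + swap_coeff x / (Y * Z) * v ?S1
        + swap_coeff y * (1 / (X * Y) - 1 / (Z * Y)) * v ?S2
        + swap_coeff y * swap_coeff (x + y) / X * v ?S21
        + swap_coeff x * swap_coeff (x + y) / Y * v ?S12
        + swap_coeff x * swap_coeff (x + y) * swap_coeff y * v (swap_entries ?S21 ?j)"
      by (simp add: formal_op_def g1 g2 flip: x_def y_def del: of_int_add)
        (simp add: algebra_simps add_divide_distrib diff_divide_distrib flip: X_def Y_def Z_def del: of_int_add)
    have "formal_op i (formal_op ?j (formal_op i v)) S = formal_op ?j (formal_op i (formal_op ?j v)) S"
      unfolding l r c0 c1 w by simp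
    then show ?thesis using reduce[of i ?j] reduce[of ?j i] assms by simp
  qed (simp add: young_op_def)
qed

end

text \<open>The value is the image of a polynomial with constant term 1.\<close>

lemma kappa_generic: "1 + kappa * of_int z \<noteq> 0"
proof -
  have z: "(of_int z :: K) = Fract [:of_int z:] 1" for z
  proof -
    have n: "(of_nat n :: K) = Fract [:of_nat n:] 1" for n
      by (simp add: of_nat_fract of_nat_poly)
    show ?thesis
      by (cases z rule: int_cases2) (simp_all add: n)
  qed
  have "1 + kappa * of_int z = Fract [:1, of_int z:] 1"
    by (simp add: z kappa_def One_fract_def one_pCons)
  then show ?thesis by (simp add: Zero_fract_def eq_fract)
qed

lemma vector_space_smult_vec: "vector_space smult_vec"
  by unfold_locales (auto simp: smult_vec_def fun_eq_iff algebra_simps)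

section \<open>The symmetric group representation and its Jucys-Murphy spectrum\<close>

context young
begin

text \<open>The chosen word is literally the one in \<open>rep\<close>, so both agree on V_tau. Off
  V_tau \<open>rep_s\<close> is not invertible, whereas \<open>young_op\<close> satisfies the
  Coxeter relations on all of \<open>vec\<close>.\<close>

definition yrep :: "(nat \<Rightarrow> nat) \<Rightarrow> vec \<Rightarrow> vec" where
  "yrep w v = foldr young_op (SOME ws. set ws \<subseteq> {1..<N} \<and> word_prod ws = w) v"

lemma yrep_word_prod:
  assumes "set ws \<subseteq> {1..<N}"
  shows "yrep (word_prod ws) v = foldr young_op ws v"
proof -
  let ?us = "SOME us. set us \<subseteq> {1..<N} \<and> word_prod us = word_prod ws"
  have "set ?us \<subseteq> {1..<N} \<and> word_prod ?us = word_prod ws"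
    by (rule someI[of _ ws]) (use assms in auto)
  then have "coxeq N ?us ws" using assms by (intro coxeq_iff_word_prod) auto
  then show ?thesis unfolding yrep_def
    by (rule foldr_coxeq) (auto simp: young_op_square young_op_braid intro: young_op_commute)
qed

lemma yrep_comp:
  assumes "w permutes {1..N}" "w' permutes {1..N}"
  shows "yrep (w \<circ> w') v = yrep w (yrep w' v)"
proof -
  obtain a b where "set a \<subseteq> {1..<N}" "word_prod a = w" "set b \<subseteq> {1..<N}" "word_prod b = w'"
    using word_prod_surj assms by metis
  then show ?thesis
    using yrep_word_prod[of "a @ b" v] yrep_word_prod[of a] yrep_word_prod[of b] by auto
qed

lemma foldr_young_op_linear:
  "foldr young_op ws (u + v) = foldr young_op ws u + foldr young_op ws v"
  "foldr young_op ws (smult_vec c v) = smult_vec c (foldr young_op ws v)"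
proof -
  have "young_op i (u + v) = young_op i u + young_op i v" for i u v
    by (auto simp: young_op_def formal_op_def fun_eq_iff add_divide_distrib algebra_simps)
  moreover have "young_op i (smult_vec c v) = smult_vec c (young_op i v)" for i v
    by (auto simp: young_op_def formal_op_def smult_vec_def fun_eq_iff algebra_simps)
  ultimately show "foldr young_op ws (u + v) = foldr young_op ws u + foldr young_op ws v"
    "foldr young_op ws (smult_vec c v) = smult_vec c (foldr young_op ws v)"
    by (induction ws) simp_all
qed

lemma yrep_id: "yrep id v = v"
  using yrep_word_prod[of "[]" v] by simp

sublocale sym_rep smult_vec N yrep kappa
proof -
  interpret vector_space smult_vec by (rule vector_space_smult_vec)
  show "sym_rep smult_vec N yrep"
    by unfold_locales (simp_all add: yrep_def foldr_young_op_linear yrep_comp[unfolded yrep_def] yrep_id[unfolded yrep_def] del: o_apply)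
qed

lemma yrep_adjacent: "1 \<le> i \<Longrightarrow> i < N \<Longrightarrow> yrep (tr i (Suc i)) v = young_op i v"
  using yrep_word_prod[of "[i]" v] by simp

lemma inV_yrep: "inV v \<Longrightarrow> inV (yrep w v)"
proof -
  have "inV v \<Longrightarrow> inV (foldr young_op ws v)" for ws
    by (induction ws) (auto intro: young_op_inV)
  then show "inV v \<Longrightarrow> inV (yrep w v)" unfolding yrep_def .
qed

lemma rep_eq_yrep:
  assumes "w permutes {1..N}" "inV v"
  shows "rep tau w v = yrep w v"
proof -
  let ?ws = "SOME ws. set ws \<subseteq> {1..<N} \<and> word_prod ws = w"
  have "set ?ws \<subseteq> {1..<N}" using someI_ex[OF word_prod_surj[OF assms(1)]] by blast
  moreover have "set ws \<subseteq> {1..<N} \<Longrightarrow> foldr (rep_s tau) ws v = foldr young_op ws v \<and> inV (foldr young_op ws v)" for ws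
    using assms(2) by (induction ws) (auto simp: rep_s_eq intro: young_op_inV)
  ultimately show ?thesis unfolding rep_def word_rep_def yrep_def by blast
qed

text \<open>At fillings outside \<open>Ytab tau\<close> every transposition acts as the identity, so
  \<open>J i\<close> just counts the indices above i. The value is an integer in either
  case.\<close>

definition jm_value :: "tabl \<Rightarrow> nat \<Rightarrow> int" where
  "jm_value S i = (if S \<in> Ytab tau then content tau S i else int (N - i))"

lemma J_step:
  assumes "1 \<le> i" "i < N"
  shows "J i v = yrep (tr i (Suc i)) (J (Suc i) (yrep (tr i (Suc i)) v)) + yrep (tr i (Suc i)) v"
proof -
  let ?s = "tr i (Suc i)"
  have "yrep ?s (yrep (tr (Suc i) j) (yrep ?s v)) = yrep (tr i j) v" if "j \<in> {Suc i<..N}" for j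
  proof -
    have "?s j = j" using that by auto
    then show ?thesis
      using P_P_eq[of i "Suc i" "Suc i" j "yrep ?s v"] that assms by (simp add: P_tr_tr)
  qed
  then have "yrep ?s (J (Suc i) (yrep ?s v)) = (\<Sum>j\<in>{Suc i<..N}. yrep (tr i j) v)"
    by (simp add: J_def P_sum)
  moreover have "{i<..N} = insert (Suc i) {Suc i<..N}" using assms by auto
  ultimately show ?thesis by (simp add: J_def add.commute)
qed

lemma J_eq:
  assumes "i \<in> {1..N}"
  shows "J i v S = of_int (jm_value S i) * v S"
  using assms
proof (induction "N - i" arbitrary: i v S)
  case 0
  then show ?case by (simp add: J_def jm_value_def content_N)
next
  case (Suc d)
  have i: "1 \<le> i" "i < N" using Suc by auto
  have IH: "J (Suc i) v = (\<lambda>S. of_int (jm_value S (Suc i)) * v S)" for v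
    using Suc.hyps(2) i by (intro ext Suc.hyps(1)) auto
  let ?y = "young_op i v"
  have J: "J i v S = young_op i (\<lambda>S. of_int (jm_value S (Suc i)) * ?y S) S + ?y S"
    unfolding J_step[OF i] IH yrep_adjacent[OF i] by simp
  show ?case
  proof (cases "S \<in> Ytab tau")
    case True
    let ?b = "gap S i" and ?S = "swap_entries S i"
    have b: "(of_int ?b :: K) \<noteq> 0" using gap_nonzero[OF True i] by simp
    have c: "swap_coeff ?b * of_int (jm_value ?S (Suc i)) = swap_coeff ?b * of_int (content tau S i)"
    proof (cases "swap_coeff ?b = 0")
      case False
      then have "?S \<in> Ytab tau" using swap_entries_Ytab[OF True i] swap_coeff_nonzero by blast
      then show ?thesis
        using content_swap_entries[OF Ytab_filling[OF True] i, of "Suc i"] i by (simp add: jm_value_def)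
    qed simp
    \<comment> \<open>Applying s_i twice expresses the value of s_i v at the exchanged tableau
      through values at S, which shows that the off-diagonal part of \<open>J i\<close>
      cancels.\<close>
    have "v S = young_op i ?y S" using young_op_square[OF i] by simp
    also have "\<dots> = ?y S / of_int ?b + swap_coeff ?b * ?y ?S"
      by (simp only: young_op_formal[OF True] formal_op_def[of i ?y])
    finally have v: "swap_coeff ?b * ?y ?S = v S - ?y S / of_int ?b" by simp
    have "J i v S = of_int (content tau S (Suc i)) * ?y S / of_int ?b
        + swap_coeff ?b * of_int (jm_value ?S (Suc i)) * ?y ?S + ?y S"
      unfolding J using True by (subst young_op_formal[OF True]) (simp add: formal_op_def[of i "\<lambda>S. _ S * _ S"] jm_value_def)
    also have "\<dots> = of_int (content tau S (Suc i)) * ?y S / of_int ?b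
        + of_int (content tau S i) * (v S - ?y S / of_int ?b) + ?y S"
      unfolding c v[symmetric] by simp
    also have "of_int (content tau S (Suc i)) = (of_int (content tau S i) - of_int ?b :: K)"
      by (simp add: gap_def)
    also have "(of_int (content tau S i) - of_int ?b) * ?y S / of_int ?b
        = of_int (content tau S i) * (?y S / of_int ?b) - ?y S"
      using b by (simp add: left_diff_distrib diff_divide_distrib)
    finally show ?thesis using True by (simp add: jm_value_def algebra_simps)
  next
    case False
    then show ?thesis unfolding J using i
      by (simp add: young_op_def jm_value_def of_nat_diff algebra_simps)
  qed
qed

sublocale jucys_murphy_rep smult_vec N yrep kappa
proof unfold_locales
  fix z show "1 + kappa * of_int z \<noteq> 0" by (rule kappa_generic)
next
  fix i v z
  assume i: "i \<in> {1..N}" and eq: "v + smult_vec kappa (J i v) = smult_vec (kappa * of_int z) v"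
  show "v = 0"
  proof
    fix S
    have "v S + kappa * (of_int (jm_value S i) * v S) = kappa * of_int z * v S"
      using fun_cong[OF eq, of S] i by (simp add: smult_vec_def J_eq)
    then have "(1 + kappa * of_int (jm_value S i - z)) * v S = 0" by (simp add: algebra_simps)
    then show "v S = 0 S" using kappa_generic[of "jm_value S i - z"] by simp
  qed
qed

sublocale seminormal_family smult_vec N yrep kappa "Ytab tau" basis "content tau"
  "\<lambda>i T. swap_entries T i" "\<lambda>i T. swap_coeff (- gap T i)"
proof unfold_locales
  fix T i assume "T \<in> Ytab tau" "i \<in> {1..N}"
  then have "J i (basis T) S = smult_vec (of_int (content tau T i)) (basis T) S" for S
    by (cases "S = T") (simp_all add: J_eq basis_def smult_vec_def jm_value_def)
  then show "J i (basis T) = smult_vec (of_int (content tau T i)) (basis T)" ..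
next
  fix T i assume T: "T \<in> Ytab tau" and i: "1 \<le> i" "i < N"
  have "inV (basis T)" using T by (auto simp: inV_def basis_def)
  then have "young_op i (basis T) = rep_s tau i (basis T)" using i by (simp add: rep_s_eq)
  also have "\<dots> = rep_s_basis tau i T"
    using T by (intro ext) (simp add: rep_s_def sum_fun_apply smult_vec_def basis_def finite_Ytab if_distrib[of "\<lambda>x. x * _"] cong: if_cong)
  also have "\<dots> = smult_vec (1 / of_int (content tau T i - content tau T (Suc i))) (basis T)
      + smult_vec (swap_coeff (- gap T i)) (basis (swap_entries T i))"
    using rep_s_basis_eq[OF T i] by (auto simp: fun_eq_iff smult_vec_def basis_def gap_def)
  finally show "yrep (tr i (Suc i)) (basis T) =
      smult_vec (1 / of_int (content tau T i - content tau T (Suc i))) (basis T)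
      + smult_vec (swap_coeff (- gap T i)) (basis (swap_entries T i))"
    using i by (simp add: yrep_adjacent)
next
  fix T i assume T: "T \<in> Ytab tau" and i: "1 \<le> i" "i < N" and p: "swap_coeff (- gap T i) \<noteq> 0"
  have "swap_entries T i \<in> Ytab tau" using swap_entries_Ytab[OF T i] swap_coeff_nonzero[OF p] by simp
  moreover have "content tau (swap_entries T i) j = content tau T (tr i (Suc i) j)" for j
  proof (cases "j \<in> {1..N}")
    case False
    have "c \<in> diagram tau \<Longrightarrow> T c \<noteq> j \<and> swap_entries T i c \<noteq> j" for c
      using False Ytab_filling[OF T] filling_swap_entries[OF Ytab_filling[OF T] i]
      by (auto simp: filling_def bij_betw_def)
    then have "cell_of tau (swap_entries T i) j = cell_of tau T j"
      unfolding cell_of_def by metis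
    moreover have "tr i (Suc i) j = j" using False i by (auto simp: tr_def)
    ultimately show ?thesis by (simp add: content_def row_def col_def)
  qed (rule content_swap_entries[OF Ytab_filling[OF T] i])
  ultimately show "swap_entries T i \<in> Ytab tau \<and>
      (\<forall>j. content tau (swap_entries T i) j = content tau T (tr i (Suc i) j))" by blast
next
  fix T i assume "T \<in> Ytab tau" "1 \<le> i" "i < N"
  then show "content tau T i \<noteq> content tau T (Suc i)" using gap_nonzero by (fastforce simp: gap_def)
next
  fix T assume "T \<in> Ytab tau" "1 \<le> N"
  then show "content tau T N = 0" by (rule content_N)
qed

end

section \<open>Square-free elements as polynomials\<close>

definition ind :: "nat set \<Rightarrow> expo" where
  "ind R = (\<lambda>k. if k \<in> R then 1 else 0)"

definition sqf_elem :: "(nat set \<Rightarrow> vec) \<Rightarrow> elem" where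
  "sqf_elem h = (\<lambda>beta. if \<forall>k. beta k \<le> 1 then h {k. beta k = 1} else 0)"

lemma ind_le_1 [simp]: "ind R k \<le> 1" and ind_set [simp]: "{k. ind R k = 1} = R"
  by (auto simp: ind_def)

lemma sqf_elem_ind [simp]: "sqf_elem h (ind R) = h R"
  by (simp add: sqf_elem_def)

lemma le_1_ind: "(\<forall>k. beta k \<le> 1) \<longleftrightarrow> beta = ind {k. beta k = 1}"
proof
  assume "\<forall>k. beta k \<le> 1"
  then have "beta k = 0 \<or> beta k = 1" for k by (metis le_less less_one)
  then show "beta = ind {k. beta k = 1}" by (auto simp: ind_def fun_eq_iff)
qed (metis ind_le_1)

lemma sqf_elem_not_ind: "(\<And>R. beta \<noteq> ind R) \<Longrightarrow> sqf_elem h beta = 0"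
  unfolding sqf_elem_def using le_1_ind by metis

lemma sqf_elem_eqI: "(\<And>R. F (ind R) = h R) \<Longrightarrow> (\<And>beta. (\<And>R. beta \<noteq> ind R) \<Longrightarrow> F beta = 0) \<Longrightarrow> F = sqf_elem h"
  by (rule ext) (metis sqf_elem_ind sqf_elem_not_ind)

lemma ind_eq_iff: "ind R = ind R' \<longleftrightarrow> R = R'"
proof
  assume "ind R = ind R'"
  then have "{k. ind R k = 1} = {k. ind R' k = 1}" by (rule arg_cong)
  then show "R = R'" by (simp only: ind_set)
qed simp

lemma ind_comp: "ind R \<circ> w = ind (w -` R)"
  by (auto simp: ind_def fun_eq_iff)

lemma not_ind_comp:
  assumes "w permutes A" "\<And>R. beta \<noteq> ind R"
  shows "beta \<circ> w \<noteq> ind R"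
proof
  assume "beta \<circ> w = ind R"
  then have "beta \<circ> w \<circ> inv w = ind (inv w -` R)" by (simp only: ind_comp)
  then show False using assms(2) permutes_inv_o(1)[OF assms(1)] by (metis comp_assoc comp_id)
qed

subsection \<open>Divided differences\<close>

definition is_divdiff :: "nat \<Rightarrow> nat \<Rightarrow> elem \<Rightarrow> elem \<Rightarrow> bool" where
  "is_divdiff i j F Q \<longleftrightarrow> (\<forall>beta S. F beta S - F (beta \<circ> tr i j) S = mulx i Q beta S - mulx j Q beta S)"

text \<open>Multiplication by x_i - x_j is injective: raising the i-th exponent in the equation
  expresses the coefficient of Q at beta by one with a smaller j-th exponent.\<close>

lemma divdiff_eq:
  assumes "i \<noteq> j" "is_divdiff i j F Q"
  shows "divdiff i j F = Q"
  unfolding divdiff_def is_divdiff_def[symmetric]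
proof (rule the_equality)
  fix Q' assume "is_divdiff i j F Q'"
  then have eq: "mulx i Q' beta S - mulx j Q' beta S = mulx i Q beta S - mulx j Q beta S" for beta S
    using assms unfolding is_divdiff_def by metis
  have "Q' beta S = Q beta S" for beta S
  proof (induction "beta j" arbitrary: beta)
    case 0
    then show ?case using eq[of "beta(i := Suc (beta i))" S] assms(1) by (simp add: mulx_def)
  next
    case (Suc n)
    let ?b = "beta(i := Suc (beta i))"
    have "Q' (?b(j := n)) S = Q (?b(j := n)) S" using assms(1) by (intro Suc.hyps) simp
    then show ?case
      using eq[of ?b S] assms(1) Suc.hyps(2)[symmetric] by (simp add: mulx_def)
  qed
  then show "Q' = Q" by (simp add: fun_eq_iff)
qed (rule assms(2))

lemma is_divdiff_sqf_elem:
  assumes ij: "i \<noteq> j"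
  shows "is_divdiff i j (sqf_elem h) (sqf_elem (\<lambda>R. if i \<in> R \<or> j \<in> R then 0 else h (insert i R) - h (insert j R)))"
    (is "is_divdiff i j _ (sqf_elem ?q)")
  unfolding is_divdiff_def
proof (intro allI)
  fix beta :: expo and S
  \<comment> \<open>The quotient has no monomial containing x_a, so multiplication by x_a keeps it
    square-free.\<close>
  have mul: "mulx a (sqf_elem ?q) beta S =
      (if (\<forall>k. beta k \<le> 1) \<and> beta a = 1 \<and> beta b = 0 then ?q ({k. beta k = 1} - {a}) S else 0)"
    if ab: "(a, b) = (i, j) \<or> (a, b) = (j, i)" for a b
  proof (cases "\<exists>R. beta = ind R")
    case True
    then obtain R where R: "beta = ind R" by blast
    have "(ind R)(a := 0) = ind (R - {a})" by (auto simp: ind_def)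
    moreover have "ind R a - 1 = 0" by (simp add: ind_def)
    ultimately show ?thesis unfolding R using ab ij by (auto simp: mulx_def) (auto simp: ind_def split: if_splits)
  next
    case False
    have "mulx a (sqf_elem ?q) beta S = 0"
    proof (cases "0 < beta a \<and> (\<exists>R. beta(a := beta a - 1) = ind R)")
      case True
      then obtain R where R: "beta(a := beta a - 1) = ind R" "0 < beta a" by auto
      have "a \<in> R"
      proof (rule ccontr)
        assume "a \<notin> R"
        then have "beta a = 1" using fun_cong[OF R(1), of a] R(2) by (simp add: ind_def)
        then have "beta = ind (insert a R)"
          using R(1) \<open>a \<notin> R\<close> by (auto simp: ind_def fun_eq_iff split: if_splits)
        then show False using False by blast
      qed
      then show ?thesis using R ab by (auto simp: mulx_def)
    next
      case F: False
      then show ?thesis using sqf_elem_not_ind[of "beta(a := beta a - 1)" ?q] by (auto simp: mulx_def)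
    qed
    moreover have "\<not> (\<forall>k. beta k \<le> 1)" using False le_1_ind by metis
    ultimately show ?thesis by (simp only: simp_thms if_False)
  qed
  show "sqf_elem h beta S - sqf_elem h (beta \<circ> tr i j) S = mulx i (sqf_elem ?q) beta S - mulx j (sqf_elem ?q) beta S"
  proof (cases "\<exists>R. beta = ind R")
    case True
    then obtain R where R: "beta = ind R" by blast
    have v: "tr i j -` R = insert j (R - {i})" if "i \<in> R" "j \<notin> R"
      using that by (auto simp: tr_def split: if_splits)
    have v': "tr i j -` R = insert i (R - {j})" if "i \<notin> R" "j \<in> R"
      using that by (auto simp: tr_def split: if_splits)
    have v'': "tr i j -` R = R" if "i \<in> R \<longleftrightarrow> j \<in> R"
      using that by (auto simp: tr_def split: if_splits)
    have m: "mulx i (sqf_elem ?q) beta S = (if i \<in> R \<and> j \<notin> R then ?q (R - {i}) S else 0)"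
      "mulx j (sqf_elem ?q) beta S = (if j \<in> R \<and> i \<notin> R then ?q (R - {j}) S else 0)"
      using mul[of i j] mul[of j i] unfolding R by (auto simp: ind_def)
    show ?thesis unfolding m unfolding R ind_comp sqf_elem_ind
      using ij by (cases "i \<in> R"; cases "j \<in> R") (simp_all add: v v' v'' insert_absorb)
  next
    case False
    moreover have "\<not> (\<forall>k. beta k \<le> 1)" using False le_1_ind by metis
    moreover have "sqf_elem h (beta \<circ> tr i j) = 0"
      using False not_ind_comp[of "tr i j" UNIV beta] by (intro sqf_elem_not_ind) (auto simp: permutes_swap_id)
    ultimately show ?thesis using mul[of i j] mul[of j i] sqf_elem_not_ind[of beta h] by auto
  qed
qed

text \<open>Writing p' for p(x(i,j)): x_i p - x_j p' = x_i (p - p') + (x_i - x_j) p'.\<close>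

lemma is_divdiff_mulx:
  assumes ij: "i \<noteq> j" and Q: "is_divdiff i j F Q"
  shows "is_divdiff i j (mulx i F) (\<lambda>beta. mulx i Q beta + F (beta \<circ> tr i j))"
  unfolding is_divdiff_def
proof (intro allI)
  fix beta :: expo and S
  let ?t = "tr i j"
  have upd: "(beta \<circ> ?t)(i := (beta \<circ> ?t) i - 1) = beta(j := beta j - 1) \<circ> ?t"
    using ij by (auto simp: fun_eq_iff tr_def)
  have comm: "beta(i := a, j := b) = beta(j := b, i := a)" for a b using ij by (rule fun_upd_twist)
  have Qi: "F (beta(i := beta i - 1)) S - F (beta(i := beta i - 1) \<circ> ?t) S
      = mulx i Q (beta(i := beta i - 1)) S - mulx j Q (beta(i := beta i - 1)) S"
    using Q unfolding is_divdiff_def by blast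
  have 1: "mulx i F (beta \<circ> ?t) S = (if 0 < beta j then F (beta(j := beta j - 1) \<circ> ?t) S else 0)"
    unfolding mulx_def upd by simp
  have 2: "(if 0 < beta i then mulx j Q (beta(i := beta i - 1)) S else 0)
      = (if 0 < beta j then mulx i Q (beta(j := beta j - 1)) S else 0)"
    using ij comm by (simp add: mulx_def)
  show "mulx i F beta S - mulx i F (beta \<circ> ?t) S
      = mulx i (\<lambda>beta. mulx i Q beta + F (beta \<circ> ?t)) beta S - mulx j (\<lambda>beta. mulx i Q beta + F (beta \<circ> ?t)) beta S"
    unfolding 1 using Qi 2 by (cases "0 < beta i"; cases "0 < beta j")
      (simp_all add: mulx_def[of _ F] mulx_def[of _ "\<lambda>beta. _ beta + _ beta"] algebra_simps)
qed

section \<open>Dunkl and Cherednik operators on square-free elements\<close>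

context young
begin

definition valued :: "(nat set \<Rightarrow> vec) \<Rightarrow> bool" where
  "valued h \<longleftrightarrow> (\<forall>R. inV (h R))"

lemma inV_simps: "inV 0" "inV u \<Longrightarrow> inV v \<Longrightarrow> inV (u + v)" "inV u \<Longrightarrow> inV v \<Longrightarrow> inV (u - v)"
  "inV v \<Longrightarrow> inV (smult_vec c v)"
  by (auto simp: inV_def smult_vec_def)

lemma inV_sqf_elem: "valued h \<Longrightarrow> inV (sqf_elem h beta)"
  by (simp add: sqf_elem_def valued_def inV_simps)

lemma act_sqf_elem:
  assumes "w permutes {1..N}" "valued h"
  shows "act tau w (sqf_elem h) = sqf_elem (sact w h)"
proof (rule sqf_elem_eqI)
  fix R
  show "act tau w (sqf_elem h) (ind R) = sact w h R"
    using assms by (simp add: act_def ind_comp sact_def rep_eq_yrep valued_def)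
next
  fix beta :: expo assume "\<And>R. beta \<noteq> ind R"
  then have "sqf_elem h (beta \<circ> w) = 0" using not_ind_comp[OF assms(1)] by (intro sqf_elem_not_ind) auto
  then show "act tau w (sqf_elem h) beta = 0" using assms by (simp add: act_def rep_eq_yrep inV_simps)
qed

lemma Dop_sqf_elem:
  assumes i: "i \<in> {1..N}" and h: "valued h"
  shows "Dop tau i (sqf_elem h) = sqf_elem (sD i h)"
proof (rule sqf_elem_eqI)
  let ?q = "\<lambda>j R. if i \<in> R \<or> j \<in> R then 0 else h (insert i R) - h (insert j R)"
  have dd: "divdiff i j (sqf_elem h) = sqf_elem (?q j)" if "j \<in> {1..N} - {i}" for j
    using that by (intro divdiff_eq is_divdiff_sqf_elem) auto
  have V: "Vact tau (tr i j) (divdiff i j (sqf_elem h)) beta = yrep (tr i j) (sqf_elem (?q j) beta)"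
    if "j \<in> {1..N} - {i}" for j beta
    using that i h unfolding Vact_def dd[OF that]
    by (intro rep_eq_yrep tr_permutes inV_sqf_elem) (auto simp: valued_def inV_simps)
  have D: "Dop tau i (sqf_elem h) beta = pderiv_x i (sqf_elem h) beta
      + smult_vec kappa (\<Sum>j\<in>{1..N} - {i}. yrep (tr i j) (sqf_elem (?q j) beta))" for beta
  proof -
    have "(\<Sum>j\<in>{1..N} - {i}. Vact tau (tr i j) (divdiff i j (sqf_elem h))) beta
        = (\<Sum>j\<in>{1..N} - {i}. yrep (tr i j) (sqf_elem (?q j) beta))"
      by (subst sum_fun_apply) (intro sum.cong refl V)
    then show ?thesis by (simp add: Dop_def smult_el_def smult_vec_def fun_eq_iff)
  qed
  fix R
  have "pderiv_x i (sqf_elem h) (ind R) = (if i \<in> R then 0 else h (insert i R))"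
  proof (cases "i \<in> R")
    case True
    have "(ind R)(i := Suc (ind R i)) \<noteq> ind R'" for R'
    proof
      assume "(ind R)(i := Suc (ind R i)) = ind R'"
      from fun_cong[OF this, of i] show False using True by (auto simp: ind_def split: if_splits)
    qed
    then have "sqf_elem h ((ind R)(i := Suc (ind R i))) = 0" by (rule sqf_elem_not_ind)
    then show ?thesis using True by (simp add: pderiv_x_def fun_eq_iff)
  next
    case False
    then have "(ind R)(i := Suc (ind R i)) = ind (insert i R)" "ind R i = 0" by (auto simp: ind_def)
    then have "pderiv_x i (sqf_elem h) (ind R) S = h (insert i R) S" for S
      unfolding pderiv_x_def by simp
    then show ?thesis using False by (simp add: fun_eq_iff)
  qed
  moreover have "(\<Sum>j\<in>{1..N} - {i}. yrep (tr i j) (?q j R))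
      = (if i \<in> R then 0 else (\<Sum>j\<in>{1..N} - R - {i}. yrep (tr i j) (h (insert i R) - h (insert j R))))"
    by (auto intro!: sum.mono_neutral_cong_right)
  ultimately show "Dop tau i (sqf_elem h) (ind R) = sD i h R"
    unfolding D by (simp add: sD_def)
next
  fix beta :: expo assume nb: "\<And>R. beta \<noteq> ind R"
  let ?q = "\<lambda>j R. if i \<in> R \<or> j \<in> R then 0 else h (insert i R) - h (insert j R)"
  have V: "Vact tau (tr i j) (divdiff i j (sqf_elem h)) beta = 0" if "j \<in> {1..N} - {i}" for j
  proof -
    have "divdiff i j (sqf_elem h) = sqf_elem (?q j)"
      using that by (intro divdiff_eq is_divdiff_sqf_elem) auto
    then show ?thesis
      using that i nb by (simp add: Vact_def sqf_elem_not_ind rep_eq_yrep tr_permutes inV_simps)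
  qed
  have "(beta(i := Suc (beta i))) \<noteq> ind R" for R
  proof
    assume eq: "beta(i := Suc (beta i)) = ind R"
    have "Suc (beta i) = ind R i" using fun_cong[OF eq, of i] by simp
    then have "beta i = 0" using ind_le_1[of R i] by linarith
    then have "beta = ind (R - {i})" using eq by (auto simp: ind_def fun_eq_iff split: if_splits)
    then show False using nb by blast
  qed
  then have "pderiv_x i (sqf_elem h) beta = 0" by (simp add: pderiv_x_def sqf_elem_not_ind fun_eq_iff)
  moreover have "(\<Sum>j\<in>{1..N} - {i}. Vact tau (tr i j) (divdiff i j (sqf_elem h))) beta = 0"
    by (subst sum_fun_apply) (intro sum.neutral ballI V)
  ultimately show "Dop tau i (sqf_elem h) beta = 0"
    by (simp add: Dop_def smult_el_def fun_eq_iff)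
qed

text \<open>The commutation rule of D_i with x_i: the extra term in the divided difference of x_i p,
  followed by tau((i,j)), is exactly the action of (i,j) on p.\<close>

lemma Dop_mulx_sqf_elem:
  assumes i: "i \<in> {1..N}" and h: "valued h"
  shows "Dop tau i (mulx i (sqf_elem h)) = mulx i (Dop tau i (sqf_elem h)) + sqf_elem h
    + smult_el kappa (\<Sum>j\<in>{1..N} - {i}. act tau (tr i j) (sqf_elem h))"
proof -
  let ?F = "sqf_elem h"
  define Q where "Q j = divdiff i j ?F" for j
  have Q: "is_divdiff i j ?F (Q j)" "\<And>beta. inV (Q j beta)" if "j \<in> {1..N} - {i}" for j
  proof -
    have "i \<noteq> j" using that by auto
    note d = is_divdiff_sqf_elem[OF this, of h]
    from divdiff_eq[OF \<open>i \<noteq> j\<close> d] d show "is_divdiff i j ?F (Q j)" by (simp add: Q_def)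
    from divdiff_eq[OF \<open>i \<noteq> j\<close> d] show "inV (Q j beta)" for beta
      using h by (auto simp: Q_def valued_def inV_simps intro!: inV_sqf_elem)
  qed
  have V: "Vact tau (tr i j) (divdiff i j (mulx i ?F))
      = mulx i (Vact tau (tr i j) (Q j)) + act tau (tr i j) ?F" if j: "j \<in> {1..N} - {i}" for j
  proof -
    have d: "divdiff i j (mulx i ?F) = (\<lambda>beta. mulx i (Q j) beta + ?F (beta \<circ> tr i j))"
      using j by (intro divdiff_eq is_divdiff_mulx Q) auto
    have t: "tr i j permutes {1..N}" using i j by (intro tr_permutes) auto
    have m: "mulx i G beta = (if 0 < beta i then G (beta(i := beta i - 1)) else 0)" for G beta
      by (auto simp: mulx_def)
    have "inV (mulx i (Q j) beta)" for beta using Q(2)[OF j] by (simp add: m inV_simps)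
    then have "Vact tau (tr i j) (divdiff i j (mulx i ?F)) beta
        = yrep (tr i j) (mulx i (Q j) beta) + yrep (tr i j) (?F (beta \<circ> tr i j))" for beta
      using t h unfolding Vact_def d by (simp add: rep_eq_yrep inV_simps inV_sqf_elem P_add)
    moreover have "mulx i (Vact tau (tr i j) (Q j)) beta = yrep (tr i j) (mulx i (Q j) beta)" for beta
      using t Q(2)[OF j] by (simp add: m Vact_def rep_eq_yrep)
    moreover have "act tau (tr i j) ?F beta = yrep (tr i j) (?F (beta \<circ> tr i j))" for beta
      using t h by (simp add: act_def rep_eq_yrep inV_sqf_elem)
    ultimately show ?thesis by (simp add: fun_eq_iff)
  qed
  have mulx_add: "mulx i (A + B) = mulx i A + mulx i B" for A B by (auto simp: mulx_def fun_eq_iff)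
  have mulx_smult: "mulx i (smult_el c A) = smult_el c (mulx i A)" for A c
    by (auto simp: mulx_def smult_el_def fun_eq_iff)
  have mulx_sum: "mulx i (\<Sum>j\<in>A. f j) = (\<Sum>j\<in>A. mulx i (f j))" for A f
  proof -
    have "mulx i 0 = 0" by (auto simp: mulx_def fun_eq_iff)
    then show ?thesis by (induction A rule: infinite_finite_induct) (simp_all add: mulx_add)
  qed
  have smult_add: "smult_el c (A + B) = smult_el c A + smult_el c B" for A B c
    by (auto simp: smult_el_def fun_eq_iff algebra_simps)
  have "pderiv_x i (mulx i ?F) = mulx i (pderiv_x i ?F) + ?F"
    by (auto simp: pderiv_x_def mulx_def fun_eq_iff algebra_simps)
  then show ?thesis
    unfolding Dop_def using V by (simp add: Q_def sum.distrib mulx_add mulx_smult mulx_sum smult_add)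
qed

text \<open>The subtraction in \<open>Uop\<close> removes the transpositions with j < i from the
  commutator, leaving those with j > i.\<close>

lemma Uop_sqf_elem:
  assumes i: "i \<in> {1..N}" and h: "valued h"
  shows "Uop tau i (sqf_elem h) = sqf_elem (sU {i<..N} i h)"
proof -
  have m: "mulx i (sqf_elem (sD i h)) = sqf_elem (xD i h)"
  proof (rule sqf_elem_eqI)
    fix R
    have "(ind R)(i := 0) = ind (R - {i})" "ind R i - 1 = 0" "0 < ind R i \<longleftrightarrow> i \<in> R" by (auto simp: ind_def)
    then have "mulx i (sqf_elem (sD i h)) (ind R) S = xD i h R S" for S by (simp add: mulx_def xD_def)
    then show "mulx i (sqf_elem (sD i h)) (ind R) = xD i h R" by (rule ext)
  next
    fix beta :: expo assume nb: "\<And>R. beta \<noteq> ind R"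
    have "sqf_elem (sD i h) (beta(i := beta i - 1)) = 0" if "0 < beta i"
    proof (cases "\<exists>R. beta(i := beta i - 1) = ind R")
      case True
      then obtain R where R: "beta(i := beta i - 1) = ind R" by blast
      have "i \<in> R"
      proof (rule ccontr)
        assume "i \<notin> R"
        then have "beta i = 1" using fun_cong[OF R, of i] that by (simp add: ind_def)
        then have "beta = ind (insert i R)"
          using R \<open>i \<notin> R\<close> by (auto simp: ind_def fun_eq_iff split: if_splits)
        then show False using nb by blast
      qed
      then show ?thesis unfolding R by (simp add: sD_def fun_eq_iff)
    qed (auto intro: sqf_elem_not_ind)
    then show "mulx i (sqf_elem (sD i h)) beta = 0" by (auto simp: mulx_def fun_eq_iff)
  qed
  let ?A = "\<lambda>j. act tau (tr i j) (sqf_elem h)"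
  have split: "{1..N} - {i} = {1..<i} \<union> {i<..N}" using i by auto
  have sums: "(\<Sum>j\<in>{1..N} - {i}. ?A j) = (\<Sum>j\<in>{1..<i}. ?A j) + (\<Sum>j\<in>{i<..N}. ?A j)"
    unfolding split by (rule sum.union_disjoint) auto
  then have U: "Uop tau i (sqf_elem h) = mulx i (Dop tau i (sqf_elem h)) + sqf_elem h + smult_el kappa (\<Sum>j\<in>{i<..N}. ?A j)"
  proof -
    have "A + F + smult_el c (B + C) - smult_el c B = A + F + smult_el c C" for A F B C c
      by (simp add: smult_el_def fun_eq_iff algebra_simps)
    with sums show ?thesis unfolding Uop_def Dop_mulx_sqf_elem[OF assms] by metis
  qed
  have "?A j = sqf_elem (sact (tr i j) h)" if "j \<in> {i<..N}" for j
    using i that h by (intro act_sqf_elem tr_permutes) auto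
  then have "(\<Sum>j\<in>{i<..N}. ?A j) = (\<Sum>j\<in>{i<..N}. sqf_elem (sact (tr i j) h))"
    by (intro sum.cong refl)
  also have "\<dots> = sqf_elem (sJ {i<..N} i h)"
    by (rule sqf_elem_eqI) (simp_all add: sum_fun_apply sJ_def sqf_elem_not_ind)
  finally have "(\<Sum>j\<in>{i<..N}. ?A j) = sqf_elem (sJ {i<..N} i h)" .
  then have "Uop tau i (sqf_elem h) beta
      = sqf_elem (xD i h) beta + sqf_elem h beta + smult_vec kappa (sqf_elem (sJ {i<..N} i h) beta)" for beta
    unfolding U Dop_sqf_elem[OF assms] m by (simp add: smult_el_def smult_vec_def)
  then show ?thesis
    by (intro sqf_elem_eqI) (simp_all add: sU_def sqf_elem_not_ind smult_vec_def zero_fun_def)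
qed

end

section \<open>The order on exponents and the polynomials \<open>\<zeta>\<close>\<close>

definition antitone_upto :: "nat \<Rightarrow> expo \<Rightarrow> bool" where
  "antitone_upto N g \<longleftrightarrow> (\<forall>i j. 1 \<le> i \<and> i \<le> j \<and> j \<le> N \<longrightarrow> g j \<le> g i)"

lemma antitone_upto_sorted: "antitone_upto N g \<longleftrightarrow> sorted (rev (map g [1..<Suc N]))"
proof
  assume "antitone_upto N g"
  then show "sorted (rev (map g [1..<Suc N]))"
    unfolding sorted_rev_iff_nth_mono antitone_upto_def by (auto simp del: upt_Suc)
next
  assume *: "sorted (rev (map g [1..<Suc N]))"
  show "antitone_upto N g"
    unfolding antitone_upto_def
  proof (intro allI impI)
    fix i j assume ij: "1 \<le> i \<and> i \<le> j \<and> j \<le> N"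
    have "i \<le> j \<Longrightarrow> j < N \<Longrightarrow> g (1 + j) \<le> g (1 + i)" for i j
      using * unfolding sorted_rev_iff_nth_mono by (simp del: upt_Suc)
    moreover have "i - 1 \<le> j - 1" "j - 1 < N" using ij by auto
    ultimately have "g (1 + (j - 1)) \<le> g (1 + (i - 1))" by blast
    then show "g j \<le> g i" using ij by simp
  qed
qed

lemma rearrangement_exists: "\<exists>w. w permutes {1..N} \<and> antitone_upto N (gamma \<circ> w)"
proof -
  define xs where "xs = rev (sort_key gamma [1..<Suc N])"
  have xs: "set xs = {1..N}" "distinct xs" "length xs = N" by (auto simp: xs_def)
  define w where "w k = (if k \<in> {1..N} then xs ! (k - 1) else k)" for k
  have "bij_betw (\<lambda>k. k - 1) {1..N} {..<N}"
    by (rule bij_betw_byWitness[of _ Suc]) auto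
  moreover have "bij_betw (\<lambda>k. xs ! k) {..<N} {1..N}" using xs by (intro bij_betw_nth) auto
  ultimately have "bij_betw ((\<lambda>k. xs ! k) \<circ> (\<lambda>k. k - 1)) {1..N} {1..N}" by (rule bij_betw_trans)
  then have "bij_betw w {1..N} {1..N}"
    by (rule bij_betw_cong[THEN iffD1, rotated]) (simp add: w_def)
  then have "w permutes {1..N}" by (rule bij_imp_permutes) (auto simp: w_def)
  moreover have "map (gamma \<circ> w) [1..<Suc N] = map gamma xs"
    using xs by (intro nth_equalityI) (auto simp: w_def simp del: upt_Suc)
  then have "antitone_upto N (gamma \<circ> w)"
    unfolding antitone_upto_sorted by (simp add: xs_def rev_map[symmetric] del: upt_Suc)
  ultimately show ?thesis by blast
qed

lemma rearrangement_unique: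
  assumes "w permutes {1..N}" "w' permutes {1..N}"
    and "antitone_upto N (gamma \<circ> w)" "antitone_upto N (gamma \<circ> w')"
  shows "gamma \<circ> w = gamma \<circ> w'"
proof
  fix k
  have m: "mset (map (gamma \<circ> w) [1..<Suc N]) = image_mset gamma (mset_set {1..N})"
    if "w permutes {1..N}" for w
  proof -
    have "image_mset w (mset_set {1..N}) = mset_set {1..N}"
      using that by (simp add: image_mset_mset_set permutes_inj_on permutes_image)
    moreover have "mset [1..<Suc N] = mset_set {1..N}"
      by (simp only: mset_upt atLeastLessThanSuc_atLeastAtMost)
    ultimately show ?thesis by (simp only: mset_map image_mset.compositionality[symmetric])
  qed
  have "rev (map (gamma \<circ> w) [1..<Suc N]) = rev (map (gamma \<circ> w') [1..<Suc N])"
    using m[OF assms(1)] m[OF assms(2)] assms(3,4) unfolding antitone_upto_sorted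
    by (metis mset_rev properties_for_sort)
  then have "map (gamma \<circ> w) [1..<Suc N] = map (gamma \<circ> w') [1..<Suc N]" by (simp only: rev_is_rev_conv)
  then have "(gamma \<circ> w) k = (gamma \<circ> w') k" if "k \<in> {1..N}"
    using that by (auto simp del: upt_Suc)
  then show "(gamma \<circ> w) k = (gamma \<circ> w') k"
    using assms(1,2) by (cases "k \<in> {1..N}") (auto simp: permutes_not_in)
qed

text \<open>Sorting the indices by their values gives existence; the sorted list depends only on the
  multiset of values, which gives uniqueness.\<close>

lemma plus_rearr:
  obtains w where "w permutes {1..N}" "plus_rearr N gamma = gamma \<circ> w" "antitone_upto N (gamma \<circ> w)"
proof -
  obtain w where w: "w permutes {1..N}" "antitone_upto N (gamma \<circ> w)" using rearrangement_exists by blast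
  have "(THE g. (\<exists>w. w permutes {1..N} \<and> g = gamma \<circ> w) \<and> antitone_upto N g) = gamma \<circ> w"
  proof (rule the_equality)
    fix g assume "(\<exists>w. w permutes {1..N} \<and> g = gamma \<circ> w) \<and> antitone_upto N g"
    then obtain w' where "w' permutes {1..N}" "g = gamma \<circ> w'" "antitone_upto N (gamma \<circ> w')" by auto
    then show "g = gamma \<circ> w" using rearrangement_unique[of w' N w gamma] w by simp
  qed (use w in blast)
  then have "plus_rearr N gamma = gamma \<circ> w"
    by (simp only: plus_rearr_def antitone_upto_def)
  then show ?thesis using w that by blast
qed

lemma sum_ind: "(\<Sum>j=1..i. ind R j) = card (R \<inter> {1..i})"
  by (simp add: ind_def sum.If_cases Int_commute)

lemma down_closed_eq:
  assumes "R \<subseteq> {1..N}" "\<And>i j. 1 \<le> i \<Longrightarrow> i \<le> j \<Longrightarrow> j \<in> R \<Longrightarrow> i \<in> R"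
  shows "R = {1..card R}"
proof (cases "R = {}")
  case False
  have fin: "finite R" using assms(1) finite_subset by blast
  have R: "R = {1..Max R}"
  proof (intro equalityI subsetI)
    fix x assume "x \<in> R"
    then show "x \<in> {1..Max R}" using Max_ge[OF fin] assms(1) by auto
  next
    fix x assume "x \<in> {1..Max R}"
    then show "x \<in> R" using assms(2)[of x "Max R"] Max_in[OF fin False] by auto
  qed
  then have "card R = card {1..Max R}" by (rule arg_cong)
  then have "card R = Max R" by simp
  with R show ?thesis by metis
qed simp

lemma plus_rearr_ind:
  assumes R: "R \<subseteq> {1..N}"
  shows "plus_rearr N (ind R) = ind {1..card R}"
proof -
  obtain w where w: "w permutes {1..N}" "plus_rearr N (ind R) = ind R \<circ> w" "antitone_upto N (ind R \<circ> w)"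
    by (rule plus_rearr)
  let ?R = "w -` R"
  have RN: "?R \<subseteq> {1..N}" using R permutes_in_image[OF w(1)] by auto
  have "?R = {1..card ?R}"
  proof (rule down_closed_eq[OF RN])
    fix i j assume ij: "1 \<le> i" "i \<le> j" "j \<in> ?R"
    then have "(ind R \<circ> w) j \<le> (ind R \<circ> w) i" using w(3) RN by (auto simp: antitone_upto_def)
    then show "i \<in> ?R" using ij by (auto simp: ind_def split: if_splits)
  qed
  moreover have "card ?R = card R" using card_vimage_inj[OF permutes_inj[OF w(1)]] permutes_surj[OF w(1)] by simp
  ultimately have "?R = {1..card R}" by simp
  then show ?thesis unfolding w(2) ind_comp by (rule arg_cong)
qed

abbreviation below :: "nat \<Rightarrow> nat set \<Rightarrow> nat set \<Rightarrow> bool" where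
  "below N R L \<equiv> \<forall>i\<in>{1..N}. card (R \<inter> {1..i}) \<le> card (L \<inter> {1..i})"

text \<open>The largest entry of gamma is the first of its rearrangement, hence bounded by that of
  \<open>ind L\<close>, so gamma is a 0-1 vector. Equal degree then forces equal rearrangements, and
  only the comparison of the vectors themselves remains.\<close>

lemma tri_lt_ind_iff:
  assumes N: "1 \<le> N" and L: "L \<subseteq> {1..N}" and gamma: "supported N gamma"
  shows "tri_lt N gamma (ind L) \<longleftrightarrow> (\<exists>R\<subseteq>{1..N}. gamma = ind R \<and> R \<noteq> L \<and> card R = card L \<and>
    below N R L)"
proof
  assume lt: "tri_lt N gamma (ind L)"
  obtain w where w: "w permutes {1..N}" "plus_rearr N gamma = gamma \<circ> w" "antitone_upto N (gamma \<circ> w)"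
    by (rule plus_rearr)
  let ?g = "gamma \<circ> w"
  have "?g 1 \<le> 1"
  proof -
    consider "dom_lt N ?g (ind {1..card L})" | "?g = ind {1..card L}"
      using lt unfolding tri_lt_def w(2) plus_rearr_ind[OF L] by blast
    then show ?thesis
    proof cases
      case 1
      then have "\<forall>i\<in>{1..N}. (\<Sum>j=1..i. ?g j) \<le> (\<Sum>j=1..i. ind {1..card L} j)"
        by (simp add: dom_lt_def)
      from bspec[OF this, of 1] have "(\<Sum>j=1..1. ?g j) \<le> (\<Sum>j=1..1. ind {1..card L} j)"
        using N by simp
      moreover have "ind {1..card L} 1 \<le> 1" by (rule ind_le_1)
      ultimately show ?thesis by (simp del: ind_le_1)
    next
      case 2
      show ?thesis unfolding 2 by (rule ind_le_1)
    qed
  qed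
  have "gamma k \<le> 1" for k
  proof (cases "k \<in> {1..N}")
    case True
    then have "inv w k \<in> {1..N}" using permutes_in_image[OF permutes_inv[OF w(1)]] by simp
    then have "?g (inv w k) \<le> ?g 1" using w(3) N unfolding antitone_upto_def by auto
    moreover have "?g (inv w k) = gamma k" using permutes_inverses(1)[OF w(1)] by simp
    ultimately show ?thesis using \<open>?g 1 \<le> 1\<close> by linarith
  qed (use gamma in \<open>auto simp: supported_def\<close>)
  then have "\<forall>k. gamma k \<le> 1" by blast
  with le_1_ind[of gamma] obtain R where R: "gamma = ind R" by blast
  have RN: "R \<subseteq> {1..N}" using gamma unfolding R supported_def by (auto simp: ind_def split: if_splits)
  have "card R = card L"
    using lt RN L unfolding tri_lt_def R sum_ind by (simp add: Int_absorb2)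
  moreover from this have "dom_lt N (ind R) (ind L)"
    using lt unfolding tri_lt_def R plus_rearr_ind[OF RN] plus_rearr_ind[OF L] by (auto simp: dom_lt_def)
  ultimately show "\<exists>R\<subseteq>{1..N}. gamma = ind R \<and> R \<noteq> L \<and> card R = card L \<and>
    below N R L"
    using R RN unfolding dom_lt_def sum_ind by blast
next
  assume "\<exists>R\<subseteq>{1..N}. gamma = ind R \<and> R \<noteq> L \<and> card R = card L \<and>
    below N R L"
  then obtain R where R: "R \<subseteq> {1..N}" "gamma = ind R" "R \<noteq> L" "card R = card L"
    "below N R L" by blast
  have "ind R \<noteq> ind L" using R(3) by (simp add: ind_eq_iff)
  then show "tri_lt N gamma (ind L)"
    using R L unfolding tri_lt_def R(2) plus_rearr_ind[OF R(1)] plus_rearr_ind[OF L] dom_lt_def sum_ind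
    by (simp add: Int_absorb2)
qed

lemma word_prod_upt: "1 \<le> m \<Longrightarrow> word_prod [1..<m] i = (if 1 \<le> i \<and> i < m then Suc i else if i = m then 1 else i)"
proof (induction m arbitrary: i)
  case (Suc m)
  show ?case
  proof (cases "m = 0")
    case False
    then have "[1..<Suc m] = [1..<m] @ [m]" by simp
    then have "word_prod [1..<Suc m] i = word_prod [1..<m] (tr m (Suc m) i)" by simp
    also have "\<dots> = (if 1 \<le> i \<and> i < Suc m then Suc i else if i = Suc m then 1 else i)"
      using False by (subst Suc.IH) (auto simp: tr_def)
    finally show ?thesis .
  qed (simp add: One_nat_def)
qed simp

lemma rank_perm_initial: "m \<le> N \<Longrightarrow> rank_perm N (ind {1..m}) = id"
proof
  fix i assume m: "m \<le> N"
  show "rank_perm N (ind {1..m}) i = id i"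
  proof (cases "i \<in> {1..N}")
    case True
    show ?thesis
    proof (cases "i \<le> m")
      case le: True
      have "{j \<in> {1..N}. ind {1..m} i < ind {1..m} j} = {}"
        "{j \<in> {1..i}. ind {1..m} j = ind {1..m} i} = {1..i}"
        using True le by (auto simp: ind_def)
      then show ?thesis using True by (simp add: rank_perm_def rank_def)
    next
      case False
      have "{j \<in> {1..N}. ind {1..m} i < ind {1..m} j} = {1..m}"
        "{j \<in> {1..i}. ind {1..m} j = ind {1..m} i} = {m<..i}"
        using True False m by (auto simp: ind_def split: if_splits)
      then show ?thesis using True False by (simp add: rank_perm_def rank_def)
    qed
  qed (auto simp: rank_perm_def)
qed

lemma rank_perm_shifted:
  assumes m: "1 \<le> m" "m \<le> N"
  shows "rank_perm N (ind {2..m}) i = (if i = 1 then m else if 2 \<le> i \<and> i \<le> m then i - 1 else i)"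
proof (cases "i \<in> {1..N}")
  case True
  consider "i = 1" | "2 \<le> i" "i \<le> m" | "m < i" "i \<noteq> 1" using True by force
  then show ?thesis
  proof cases
    case 1
    have "{j \<in> {1..N}. ind {2..m} i < ind {2..m} j} = {2..m}"
      "{j \<in> {1..i}. ind {2..m} j = ind {2..m} i} = {1}"
      using 1 m by (auto simp: ind_def split: if_splits)
    then show ?thesis using 1 True m by (simp add: rank_perm_def rank_def)
  next
    case 2
    have sets: "{j \<in> {1..N}. ind {2..m} i < ind {2..m} j} = {}"
      "{j \<in> {1..i}. ind {2..m} j = ind {2..m} i} = {2..i}"
      using 2 m by (auto simp: ind_def split: if_splits)
    have "rank N (ind {2..m}) i = i - 1" unfolding rank_def sets using 2 by simp
    then show ?thesis using 2 True by (simp add: rank_perm_def)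
  next
    case 3
    have "{j \<in> {1..N}. ind {2..m} i < ind {2..m} j} = {2..m}"
      "{j \<in> {1..i}. ind {2..m} j = ind {2..m} i} = insert 1 {m<..i}"
      using 3 m by (auto simp: ind_def split: if_splits)
    then show ?thesis using 3 True m by (simp add: rank_perm_def rank_def)
  qed
qed (use m in \<open>auto simp: rank_perm_def\<close>)

section \<open>Identification of the zetas with solutions\<close>

context sym_rep
begin

text \<open>\<open>sU\<close> is built from linear operations and the group action, so it commutes
  with equivariant linear maps; this is applied to the projection \<open>off\<close>.\<close>

lemma sU_intertwiner:
  assumes add: "\<And>u v. f (u + v) = f u + f v" and scale: "\<And>c v. f (c *s v) = c *s f v"
    and P: "\<And>w v. w permutes {1..N} \<Longrightarrow> f (P w v) = P w (f v)"
    and i: "i \<in> {1..N}" and Q: "Q \<subseteq> {1..N}"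
  shows "sU Q i (\<lambda>R. f (h R)) R = f (sU Q i h R)"
proof -
  have zero: "f 0 = 0" using scale[of 0 0] by simp
  have sum: "f (\<Sum>x\<in>A. g x) = (\<Sum>x\<in>A. f (g x))" for A :: "nat set" and g
    by (induction A rule: infinite_finite_induct) (simp_all add: zero add)
  have diff: "f (u - v) = f u - f v" for u v using add[of "u - v" v] by simp
  have tr: "P (tr i j) (f v) = f (P (tr i j) v)" if "j \<in> {1..N}" for j v
    using P tr_permutes i that by simp
  have "sD i (\<lambda>R. f (h R)) R = f (sD i h R)" for R
  proof -
    have "(\<Sum>j\<in>{1..N} - R - {i}. P (tr i j) (f (h (insert i R)) - f (h (insert j R))))
        = (\<Sum>j\<in>{1..N} - R - {i}. f (P (tr i j) (h (insert i R) - h (insert j R))))"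
      unfolding diff[symmetric] by (intro sum.cong refl tr) auto
    then show ?thesis by (simp add: sD_def add scale sum zero)
  qed
  moreover have "sJ Q i (\<lambda>R. f (h R)) R = f (sJ Q i h R)"
    unfolding sJ_def sact_def sum using Q by (intro sum.cong refl tr) auto
  ultimately show ?thesis by (simp add: sU_def xD_def add scale zero)
qed

end

context young
begin

definition off :: "vec \<Rightarrow> vec" where
  "off v = (\<lambda>S. if S \<in> Ytab tau then 0 else v S)"

lemma off_yrep:
  assumes "w permutes {1..N}"
  shows "off (yrep w v) = yrep w (off v)"
proof -
  have "off (young_op i v) = young_op i (off v)" if "1 \<le> i" "i < N" for i v
  proof
    fix S
    show "off (young_op i v) S = young_op i (off v) S"
    proof (cases "S \<in> Ytab tau")
      case S: True
      have "swap_coeff (gap S i) * off v (swap_entries S i) = 0"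
        using swap_entries_Ytab[OF S that] swap_coeff_nonzero by (force simp: off_def)
      moreover have "off v S = 0" using S by (simp add: off_def)
      ultimately show ?thesis using S by (simp add: off_def[of "young_op i v"] young_op_formal formal_op_def)
    qed (simp add: off_def young_op_def)
  qed
  then have "set ws \<subseteq> {1..<N} \<Longrightarrow> off (foldr young_op ws v) = foldr young_op ws (off v)" for ws
    by (induction ws) auto
  moreover obtain ws where "set ws \<subseteq> {1..<N}" "word_prod ws = w"
    using word_prod_surj[OF assms] by blast
  ultimately show ?thesis using yrep_word_prod by metis
qed

lemma inV_iff_off: "inV v \<longleftrightarrow> off v = 0"
  by (auto simp: inV_def off_def fun_eq_iff)

text \<open>The component outside \<open>V\<^sub>\<tau>\<close> satisfies the same eigenvalue equations, so it vanishes by uniqueness.\<close>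

lemma valuedI:
  assumes supp: "\<And>R. h R \<noteq> 0 \<Longrightarrow> R \<subseteq> {1..N} \<and> (R \<subseteq> {1..q} \<longrightarrow> inV (h R))"
    and ev: "\<And>j R. j \<in> {q<..N} \<Longrightarrow> sU {j<..N} j h R = smult_vec (1 + kappa * of_int (z j)) (h R)"
  shows "valued h"
  unfolding valued_def inV_iff_off
proof
  fix R
  have lin: "off (u + v) = off u + off v" "off (smult_vec c v) = smult_vec c (off v)" for u v c
    by (auto simp: off_def smult_vec_def fun_eq_iff)
  show "off (h R) = 0"
  proof (rule eigen_unique[where h = "\<lambda>R. off (h R)" and q = q and z = z])
    fix R assume "off (h R) \<noteq> 0"
    then have "h R \<noteq> 0" "\<not> inV (h R)" by (auto simp: inV_iff_off) (simp add: off_def zero_fun_def)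
    then show "R \<subseteq> {1..N} \<and> \<not> R \<subseteq> {1..q}" using supp by blast
  next
    fix j R assume "j \<in> {q<..N}"
    then show "sU {j<..N} j (\<lambda>R. off (h R)) R = smult_vec (1 + kappa * of_int (z j)) (off (h R))"
      by (subst sU_intertwiner) (auto simp: lin off_yrep ev)
  qed
qed

text \<open>Any candidate is square-free by \<open>tri_lt_ind_iff\<close>, and the equations for j >
  q alone then determine it. \<open>high\<close> gives these eigenvalues the form required by
  uniqueness, and \<open>minimal\<close> makes L the only admissible support set inside
  \<open>{1..q}\<close>.\<close>

lemma zeta_eqI:
  assumes L: "L \<subseteq> {1..N}" "1 \<le> N" and T: "T \<in> Ytab tau"
    and minimal: "\<And>R. R \<subseteq> {1..q} \<Longrightarrow> card R = card L \<Longrightarrow>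
      below N R L \<Longrightarrow> R = L"
    and rho: "rank_perm N (ind L) permutes {1..N}"
    and high: "\<And>j. j \<in> {q<..N} \<Longrightarrow> rank_perm N (ind L) j = j \<and> j \<notin> L"
    and supp: "\<And>R. h R \<noteq> 0 \<Longrightarrow> R \<subseteq> {1..N} \<and> card R = card L \<and>
      below N R L"
    and lead: "h L = yrep (inv (rank_perm N (ind L))) (basis T)"
    and ev: "\<And>i R. i \<in> {1..N} \<Longrightarrow> sU {i<..N} i h R =
      smult_vec (of_bool (i \<in> L) + 1 + kappa * of_int (content tau T (rank_perm N (ind L) i))) (h R)"
    and valued: "valued h"
  shows "zeta tau (ind L) T = sqf_elem h"
proof -
  let ?rho = "rank_perm N (ind L)"
  have basis: "inV (basis T)" using T by (auto simp: inV_def basis_def)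
  have lead': "rep tau (inv ?rho) (basis T) = h L"
    unfolding lead using rho basis by (intro rep_eq_yrep permutes_inv)
  have ind_L: "of_nat (ind L i) = (of_bool (i \<in> L) :: K)" for i by (simp add: ind_def)
  have supported_ind: "supported N (ind R) \<longleftrightarrow> R \<subseteq> {1..N}" for R
    by (auto simp: supported_def ind_def split: if_splits)
  have tri: "tri_lt N (ind R) (ind L) \<longleftrightarrow> R \<noteq> L \<and> card R = card L \<and>
      below N R L" if "R \<subseteq> {1..N}" for R
  proof -
    have "supported N (ind R)" using that supported_ind by simp
    from tri_lt_ind_iff[OF L(2,1) this] show ?thesis using that by (auto simp: ind_eq_iff)
  qed
  show ?thesis
    unfolding zeta_def
  proof (rule the_equality, intro conjI)
    show "well_formed tau (sqf_elem h)"
      unfolding well_formed_def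
    proof (intro allI impI)
      fix beta S assume nz: "sqf_elem h beta S \<noteq> 0"
      then obtain R where R: "beta = ind R" using sqf_elem_not_ind[of beta h] by fastforce
      then have "h R S \<noteq> 0" using nz by simp
      then have "h R \<noteq> 0" "S \<in> Ytab tau" using valued by (auto simp: valued_def inV_def)
      then show "supported N beta \<and> S \<in> Ytab tau" using supp R supported_ind by blast
    qed
    show "sqf_elem h (ind L) = rep tau (inv ?rho) (basis T)" using lead' by simp
    show "\<forall>gamma. gamma \<noteq> ind L \<and> \<not> tri_lt N gamma (ind L) \<longrightarrow> sqf_elem h gamma = 0"
    proof (intro allI impI)
      fix gamma assume g: "gamma \<noteq> ind L \<and> \<not> tri_lt N gamma (ind L)"
      show "sqf_elem h gamma = 0"
      proof (cases "\<exists>R. gamma = ind R")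
        case True
        then obtain R where R: "gamma = ind R" by blast
        then have "h R = 0" using g supp[of R] tri[of R] by auto
        then show ?thesis using R by (simp add: zero_fun_def)
      qed (auto intro: sqf_elem_not_ind)
    qed
    show "\<forall>i\<in>{1..N}. Uop tau i (sqf_elem h) = smult_el (of_nat (ind L i) + 1 + kappa * of_int (content tau T (?rho i))) (sqf_elem h)"
    proof
      fix i assume i: "i \<in> {1..N}"
      show "Uop tau i (sqf_elem h) = smult_el (of_nat (ind L i) + 1 + kappa * of_int (content tau T (?rho i))) (sqf_elem h)"
        unfolding Uop_sqf_elem[OF i valued] ind_L
        by (rule sqf_elem_eqI[symmetric])
          (simp_all add: ev[OF i] smult_el_def smult_vec_def sqf_elem_not_ind zero_fun_def)
    qed
  next
    fix F
    assume F: "well_formed tau F \<and> F (ind L) = rep tau (inv ?rho) (basis T)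
      \<and> (\<forall>gamma. gamma \<noteq> ind L \<and> \<not> tri_lt N gamma (ind L) \<longrightarrow> F gamma = 0)
      \<and> (\<forall>i\<in>{1..N}. Uop tau i F = smult_el (of_nat (ind L i) + 1 + kappa * of_int (content tau T (?rho i))) F)"
    define g where "g R = F (ind R)" for R
    have sup: "supported N gamma" if nz: "F gamma \<noteq> 0" for gamma
    proof -
      obtain S where "F gamma S \<noteq> 0" using nz by (auto simp: fun_eq_iff)
      then show ?thesis using F unfolding well_formed_def by blast
    qed
    have Flt: "gamma = ind L \<or> tri_lt N gamma (ind L)" if "F gamma \<noteq> 0" for gamma
      using F that by metis
    have "F gamma = 0" if not_ind: "\<And>R. gamma \<noteq> ind R" for gamma
    proof (rule ccontr)
      assume nz: "F gamma \<noteq> 0"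
      have "tri_lt N gamma (ind L)" using Flt[OF nz] not_ind by simp
      then show False using tri_lt_ind_iff[OF L(2,1) sup[OF nz]] not_ind by auto
    qed
    then have Fg: "F = sqf_elem g" by (intro sqf_elem_eqI) (auto simp: g_def)
    have "F (ind R) S = 0" if "S \<notin> Ytab tau" for R S
      using F that unfolding well_formed_def by blast
    then have vg: "valued g" by (simp add: valued_def inV_def g_def)
    have gsupp: "R \<subseteq> {1..N} \<and> card R = card L \<and> below N R L"
      if "g R \<noteq> 0" for R
    proof -
      have RN: "R \<subseteq> {1..N}" using sup[of "ind R"] that supported_ind by (simp add: g_def)
      moreover have "ind R = ind L \<or> tri_lt N (ind R) (ind L)" using Flt that by (simp add: g_def)
      then have "R = L \<or> tri_lt N (ind R) (ind L)" by (simp add: ind_eq_iff)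
      ultimately show ?thesis using tri[OF RN] by auto
    qed
    have gev: "sU {i<..N} i g R = smult_vec (of_bool (i \<in> L) + 1 + kappa * of_int (content tau T (?rho i))) (g R)"
      if i: "i \<in> {1..N}" for i R
    proof -
      have "Uop tau i F = smult_el (of_nat (ind L i) + 1 + kappa * of_int (content tau T (?rho i))) F"
        using F i by blast
      then have "sqf_elem (sU {i<..N} i g) (ind R)
          = smult_el (of_bool (i \<in> L) + 1 + kappa * of_int (content tau T (?rho i))) (sqf_elem g) (ind R)"
        unfolding Fg Uop_sqf_elem[OF i vg] ind_L by (rule fun_cong)
      then show ?thesis by (simp add: smult_el_def smult_vec_def)
    qed
    have "g R = smult_vec 1 (h R)" for R
    proof (rule solution_diff_unique[where q = q and S = L and z = "content tau T"])
      fix R assume "g R \<noteq> 0 \<or> h R \<noteq> 0"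
      then have "R \<subseteq> {1..N} \<and> card R = card L \<and> below N R L"
        using gsupp[of R] supp[of R] by argo
      then show "R \<subseteq> {1..N} \<and> (R \<subseteq> {1..q} \<longrightarrow> R = L)" using minimal[of R] by argo
    next
      fix j R assume j: "j \<in> {q<..N}"
      then have jN: "j \<in> {1..N}" by auto
      show "sU {j<..N} j g R = smult_vec (1 + kappa * of_int (content tau T j)) (g R)"
        "sU {j<..N} j h R = smult_vec (1 + kappa * of_int (content tau T j)) (h R)"
        using gev[OF jN, of R] ev[OF jN, of R] high[OF j] by simp_all
    next
      show "g L = smult_vec 1 (h L)" using F lead' by (simp add: g_def smult_vec_def)
    qed
    then have "g R = h R" for R by (simp add: smult_vec_def)
    then have "g = h" by (rule ext)
    then show "F = sqf_elem h" using Fg by simp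
  qed
qed

lemma spec_eq: "spec n T i = of_bool (i \<le> n) + 1 + kappa * of_int (content tau T i)"
  by (simp add: spec_def)

text \<open>In the natural order the successors of i are \<open>{i<..N}\<close>, as in U_i. Every
  m-element set lies below \<open>{1..m}\<close>, so the support condition reduces to
  cardinality.\<close>

lemma zeta_initial:
  assumes T: "T \<in> Ytab tau" and m: "1 \<le> m" "m \<le> N"
    and h: "solution m (spec m T) (basis T) [1..<Suc N] h"
  shows "valued h" and "zeta tau (ind {1..m}) T = sqf_elem h"
proof -
  have basis: "inV (basis T)" using T by (auto simp: inV_def basis_def)
  have full: "R = {1..m}" if "R \<subseteq> {1..m}" "card R = m" for R
    using that by (intro card_subset_eq) auto
  show v: "valued h"
  proof (rule valuedI[where q = m and z = "content tau T"])
    fix R assume nz: "h R \<noteq> 0"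
    show "R \<subseteq> {1..N} \<and> (R \<subseteq> {1..m} \<longrightarrow> inV (h R))"
      using solution_supp[OF h nz] full solution_lead[OF h] basis by metis
  next
    fix j R assume "j \<in> {m<..N}"
    then show "sU {j<..N} j h R = smult_vec (1 + kappa * of_int (content tau T j)) (h R)"
      using solution_sU_upt[OF h, of j R] m by (simp add: spec_eq)
  qed
  show "zeta tau (ind {1..m}) T = sqf_elem h"
  proof (rule zeta_eqI[where q = m])
    fix R assume "h R \<noteq> 0"
    from solution_supp[OF h this] have R: "R \<subseteq> {1..N}" "card R = m" .
    have "card (R \<inter> {1..i}) \<le> card ({1..m} \<inter> {1..i})" for i
    proof -
      have "finite R" using R(1) finite_subset by blast
      then have "card (R \<inter> {1..i}) \<le> m" unfolding R(2)[symmetric] by (intro card_mono) auto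
      moreover have "card (R \<inter> {1..i}) \<le> card {1..i}" by (intro card_mono) auto
      moreover have "{1..m} \<inter> {1..i} = {1..min m i}" by auto
      ultimately show ?thesis by simp
    qed
    then show "R \<subseteq> {1..N} \<and> card R = card {1..m} \<and> below N R {1..m}"
      using R by simp
  next
    fix i R assume i: "i \<in> {1..N}"
    then show "sU {i<..N} i h R = smult_vec (of_bool (i \<in> {1..m}) + 1
        + kappa * of_int (content tau T (rank_perm N (ind {1..m}) i))) (h R)"
      using solution_sU_upt[OF h i, of R] m by (simp add: spec_eq rank_perm_initial)
  next
    show "h {1..m} = yrep (inv (rank_perm N (ind {1..m}))) (basis T)"
      using solution_lead[OF h] by (simp add: rank_perm_initial[OF m(2)] inv_id yrep_id)
  qed (use m T v full in \<open>auto simp: rank_perm_initial permutes_id\<close>)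
qed

text \<open>theta_m maps m to 1 and i to i + 1 for i < m, so it carries the order m, 1, ..., m - 1,
  m + 1, ..., N of G to the natural one. Its inverse is the rank function of (0, 1^(m-1), 0, ...),
  which matches eigenvalues and leading term.\<close>

lemma zeta_shifted:
  assumes T: "T \<in> Ytab tau" and m: "1 \<le> m" "m \<le> N"
    and G: "solution (m - 1) (spec (m - 1) T) (basis T) ([m] @ [1..<m] @ [Suc m..<Suc N]) G"
  shows "valued G" and "zeta tau (ind {2..m}) T = sqf_elem (sact (word_prod [1..<m]) G)"
proof -
  let ?th = "word_prod [1..<m]" and ?rho = "rank_perm N (ind {2..m})"
  have th: "?th permutes {1..N}" using m by (intro word_prod_permutes) auto
  have th_rho: "?th (?rho i) = i" "?rho (?th i) = i" for i
    unfolding word_prod_upt[OF m(1)] rank_perm_shifted[OF m] using m(1) by auto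
  have inv_rho: "inv ?rho = ?th" using th_rho by (intro inv_unique_comp) (auto simp: fun_eq_iff)
  have inv_th: "inv ?th = ?rho" using th_rho by (intro inv_unique_comp) (auto simp: fun_eq_iff)
  have rho: "?rho permutes {1..N}" unfolding inv_th[symmetric] using th by (rule permutes_inv)
  have basis: "inV (basis T)" using T by (auto simp: inV_def basis_def)
  have lead: "G {1..<m} = basis T"
  proof -
    have "{1..<m} = {1..m - 1}" using m by auto
    then show ?thesis using solution_lead[OF G] by simp
  qed
  have supp: "R \<subseteq> {1..N}" "card R = m - 1" "m \<notin> R" if "G R \<noteq> 0" for R
    using solution_supp[OF G that] solution_first[of "m - 1" _ _ m _ G R] G m that by auto
  have full: "R = {1..<m}" if "R \<subseteq> {1..m}" "card R = m - 1" "m \<notin> R" for R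
  proof -
    have "R \<subseteq> {1..<m}" using that by (auto simp: less_le)
    then show ?thesis using that by (intro card_subset_eq) auto
  qed
  \<comment> \<open>The preimage of the successors of i under theta_m is the set of successors of
    \<open>?rho i\<close> in the order of G; this is checked in the three blocks of the
    list.\<close>
  have ev: "sU (?rho ` {i<..N}) (?rho i) G R = smult_vec (spec (m - 1) T (?rho i)) (G R)"
    if i: "i \<in> {1..N}" for i R
  proof -
    have eig: "eigen (spec (m - 1) T) (m # ([1..<m] @ [Suc m..<Suc N])) G"
      using G by (simp add: solution_def del: upt_Suc)
    have tail: "eigen (spec (m - 1) T) ([1..<m] @ [Suc m..<Suc N]) G" using eig by (simp del: upt_Suc)
    have memb: "x \<in> ?rho ` {i<..N} \<longleftrightarrow> ?th x \<in> {i<..N}" for x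
    proof
      assume "x \<in> ?rho ` {i<..N}"
      then obtain y where "x = ?rho y" "y \<in> {i<..N}" by blast
      then show "?th x \<in> {i<..N}" by (simp only: th_rho)
    next
      assume "?th x \<in> {i<..N}"
      then have "?rho (?th x) \<in> ?rho ` {i<..N}" by (rule imageI)
      then show "x \<in> ?rho ` {i<..N}" by (simp only: th_rho)
    qed
    consider "i = 1" | "2 \<le> i" "i \<le> m" | "m < i" "i \<noteq> 1" using i by force
    then show ?thesis
    proof cases
      case 1
      have "?rho ` {i<..N} = set ([1..<m] @ [Suc m..<Suc N])"
        unfolding set_eq_iff memb using 1 m by (auto simp: word_prod_upt[OF m(1)] simp del: upt_Suc)
      moreover have "?rho i = m" using 1 rank_perm_shifted[OF m] by simp
      ultimately show ?thesis using eig by (simp del: upt_Suc set_append)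
    next
      case 2
      have "?rho ` {i<..N} = {i - 1<..<m} \<union> set [Suc m..<Suc N]"
        unfolding set_eq_iff memb using 2 m by (auto simp: word_prod_upt[OF m(1)] simp del: upt_Suc)
      moreover have "?rho i = i - 1" using 2 rank_perm_shifted[OF m] by simp
      moreover have "i - 1 \<in> {1..<m}" using 2 by auto
      ultimately show ?thesis using tail unfolding eigen_upt_append by metis
    next
      case 3
      have "?rho ` {i<..N} = {i<..N}"
        unfolding set_eq_iff memb using 3 m by (auto simp: word_prod_upt[OF m(1)])
      moreover have "?rho i = i" using 3 m rank_perm_shifted[OF m] by simp
      moreover have "sU {i<..N} i G R = smult_vec (spec (m - 1) T i) (G R)"
        using solution_sU[of "m - 1" "spec (m - 1) T" "basis T" "[m] @ [1..<m]" "Suc m" G i R] G i 3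
        by (simp del: upt_Suc)
      ultimately show ?thesis by simp
    qed
  qed
  show v: "valued G"
  proof (rule valuedI[where q = m and z = "content tau T"])
    fix R assume nz: "G R \<noteq> 0"
    show "R \<subseteq> {1..N} \<and> (R \<subseteq> {1..m} \<longrightarrow> inV (G R))"
      using supp[OF nz] full lead basis by metis
  next
    fix j R assume j: "j \<in> {m<..N}"
    then show "sU {j<..N} j G R = smult_vec (1 + kappa * of_int (content tau T j)) (G R)"
      using solution_sU[of "m - 1" "spec (m - 1) T" "basis T" "[m] @ [1..<m]" "Suc m" G j R] G m
      by (auto simp: spec_eq simp del: upt_Suc)
  qed
  have dom: "R \<subseteq> {1..N}" "card R = m - 1" "1 \<notin> R" if "sact ?th G R \<noteq> 0" for R
  proof -
    have nz: "G (?th -` R) \<noteq> 0" using that by (auto simp: sact_def)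
    have R: "R = ?th ` (?th -` R)" using permutes_surj[OF th] by (simp add: surj_image_vimage_eq)
    show "R \<subseteq> {1..N}"
      using image_mono[OF supp(1)[OF nz], of ?th] R permutes_image[OF th] by simp
    show "card R = m - 1"
      using supp(2)[OF nz] R card_image[OF inj_on_subset[OF permutes_inj[OF th] subset_UNIV], of "?th -` R"] by simp
    \<comment> \<open>G avoids m, so its image avoids 1; with the cardinality this yields domination
      by \<open>{2..m}\<close>.\<close>
    have "?th m = 1" using word_prod_upt[OF m(1)] by simp
    then show "1 \<notin> R" using supp(3)[OF nz] by auto
  qed
  show "zeta tau (ind {2..m}) T = sqf_elem (sact ?th G)"
  proof (rule zeta_eqI[where q = m])
    fix R assume nz: "sact ?th G R \<noteq> 0"
    note R = dom[OF nz]
    have fin: "finite R" using R(1) finite_subset by blast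
    have "card (R \<inter> {1..i}) \<le> card ({2..m} \<inter> {1..i})" for i
    proof -
      have "card (R \<inter> {1..i}) \<le> m - 1" unfolding R(2)[symmetric] using fin by (intro card_mono) auto
      moreover have "R \<inter> {1..i} \<subseteq> {2..i}"
        using R(1,3) by (auto simp: subset_iff) (metis One_nat_def Suc_1 le_antisym not_less_eq_eq)
      then have "card (R \<inter> {1..i}) \<le> card {2..i}" by (intro card_mono) auto
      moreover have "{2..m} \<inter> {1..i} = {2..min m i}" by auto
      ultimately show ?thesis by simp
    qed
    then show "R \<subseteq> {1..N} \<and> card R = card {2..m} \<and> below N R {2..m}"
      using R by simp
  next
    fix R assume R: "R \<subseteq> {1..m}" "card R = card {2..m}"
      and le: "below N R {2..m}"
    \<comment> \<open>The bound for the first initial segment excludes 1 from R.\<close>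
    have "card (R \<inter> {1..1}) \<le> card ({2..m} \<inter> {1..1})" by (rule bspec[OF le]) (use m in auto)
    also have "{2..m} \<inter> {1..1} = {}" by auto
    finally have "R \<inter> {1} = {}" by simp
    then have "R \<subseteq> {2..m}" using R(1) by (auto simp: subset_iff) (metis One_nat_def Suc_1 le_antisym not_less_eq_eq)
    then show "R = {2..m}" using R(2) by (intro card_subset_eq) auto
  next
    fix i R assume i: "i \<in> {1..N}"
    have "?rho i \<in> {1..N}" using permutes_in_image[OF rho] i by blast
    moreover have "?rho ` {i<..N} \<subseteq> {1..N}"
      using permutes_image[OF rho] i image_mono[of "{i<..N}" "{1..N}" ?rho] by auto
    moreover have "?th ` ?rho ` {i<..N} = {i<..N}" by (simp add: image_image th_rho)
    ultimately have "sU {i<..N} i (sact ?th G) R = sact ?th (sU (?rho ` {i<..N}) (?rho i) G) R"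
      using sU_sact[OF th, of "?rho i" "?rho ` {i<..N}" G R] by (simp add: th_rho)
    also have "\<dots> = smult_vec (spec (m - 1) T (?rho i)) (sact ?th G R)"
      by (simp add: sact_def ev[OF i] P_scale)
    also have "spec (m - 1) T (?rho i) = of_bool (i \<in> {2..m}) + 1 + kappa * of_int (content tau T (?rho i))"
    proof -
      have "?rho i \<le> m - 1 \<longleftrightarrow> i \<in> {2..m}" unfolding rank_perm_shifted[OF m] using i m by auto
      then show ?thesis by (simp only: spec_eq)
    qed
    finally show "sU {i<..N} i (sact ?th G) R = smult_vec (of_bool (i \<in> {2..m}) + 1
        + kappa * of_int (content tau T (?rho i))) (sact ?th G R)" .
  next
    have "?th -` {2..m} = {1..<m}"
    proof -
      have "x \<in> ?th -` {2..m} \<longleftrightarrow> x \<in> {1..<m}" for x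
        using m by (auto simp: word_prod_upt[OF m(1)])
      then show ?thesis by blast
    qed
    then show "sact ?th G {2..m} = yrep (inv ?rho) (basis T)" by (simp add: sact_def lead inv_rho)
  next
    show "valued (sact ?th G)" using v by (simp add: valued_def sact_def inV_yrep)
  next
    fix j assume "j \<in> {m<..N}"
    then show "?rho j = j \<and> j \<notin> {2..m}" using m rank_perm_shifted[OF m, of j] by auto
  qed (use m T rho in auto)
qed

section \<open>The tableau \<open>T0\<close> and the hook product\<close>

text \<open>The j-th part of the conjugate partition.\<close>

definition col_len :: "nat \<Rightarrow> nat" where
  "col_len j = card {r \<in> {1..length tau}. j \<le> part tau r}"

text \<open>Counts the cells in the first j columns; it is the offset in the definition of
  \<open>T0\<close>.\<close>

definition cells_upto :: "nat \<Rightarrow> nat" where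
  "cells_upto j = (\<Sum>r\<in>{1..length tau}. min (part tau r) j)"

lemma T0_eq: "(i, j) \<in> diagram tau \<Longrightarrow> T0 tau (i, j) = N + 1 - (cells_upto (j - 1) + i)"
  by (simp add: T0_def cells_upto_def)

lemma col_cells: "{r \<in> {1..length tau}. j \<le> part tau r} = {1..col_len j}"
  unfolding col_len_def
proof (rule down_closed_eq)
  fix r s assume "1 \<le> r" "r \<le> s" "s \<in> {r \<in> {1..length tau}. j \<le> part tau r}"
  then show "r \<in> {r \<in> {1..length tau}. j \<le> part tau r}" using part_antimono[of r s] by auto
qed auto

lemma diagram_iff: "(i, j) \<in> diagram tau \<longleftrightarrow> 1 \<le> j \<and> i \<in> {1..col_len j}"
  unfolding col_cells[symmetric] by (auto simp: diagram_def)

lemma cells_upto_Suc: "cells_upto (Suc j) = cells_upto j + col_len (Suc j)"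
proof -
  have "cells_upto (Suc j) = (\<Sum>r\<in>{1..length tau}. min (part tau r) j + (if Suc j \<le> part tau r then 1 else 0))"
    unfolding cells_upto_def by (intro sum.cong) auto
  also have "\<dots> = cells_upto j + col_len (Suc j)"
    by (simp add: sum.distrib cells_upto_def col_len_def sum.If_cases Int_def conj_commute)
  finally show ?thesis .
qed

lemma cells_upto_minus: "1 \<le> j \<Longrightarrow> cells_upto (j - 1) + col_len j = cells_upto j"
  using cells_upto_Suc[of "j - 1"] by simp

lemma cells_upto_mono: "j \<le> j' \<Longrightarrow> cells_upto j \<le> cells_upto j'"
  unfolding cells_upto_def by (intro sum_mono) auto

lemma sum_part: "(\<Sum>r\<in>{1..length tau}. part tau r) = N"
proof -
  have "(\<Sum>r\<in>{1..length tau}. part tau r) = (\<Sum>r\<in>{0..<length tau}. part tau (Suc r))"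
    by (rule sum.reindex_bij_witness[of _ Suc "\<lambda>r. r - 1"]) auto
  also have "\<dots> = N" by (simp add: part_def sum_list_sum_nth)
  finally show ?thesis .
qed

lemma cells_upto_le: "cells_upto j \<le> N"
  unfolding cells_upto_def sum_part[symmetric] by (intro sum_mono) auto

lemma cells_upto_max: "cells_upto (part tau 1) = N"
  unfolding cells_upto_def sum_part[symmetric]
  by (intro sum.cong refl) (use part_antimono[of 1] in \<open>auto simp: min_def\<close>)

lemma card_diagram: "card (diagram tau) = N"
proof -
  have "diagram tau = (SIGMA i:{1..length tau}. {1..part tau i})" by (auto simp: diagram_def)
  then show ?thesis by (simp add: sum_part)
qed

lemma cell_position:
  assumes "(i, j) \<in> diagram tau"
  shows "cells_upto (j - 1) < cells_upto (j - 1) + i" "cells_upto (j - 1) + i \<le> cells_upto j"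
  using assms cells_upto_minus[of j] by (auto simp: diagram_iff)

lemma T0_column_less:
  assumes "(i, j) \<in> diagram tau" "(i', j') \<in> diagram tau" "j < j'"
  shows "T0 tau (i', j') < T0 tau (i, j)"
proof -
  have "cells_upto j \<le> cells_upto (j' - 1)" using assms(3) by (intro cells_upto_mono) simp
  then have "cells_upto (j - 1) + i < cells_upto (j' - 1) + i'"
    using cell_position[OF assms(1)] cell_position[OF assms(2)] by linarith
  moreover have "cells_upto (j' - 1) + i' \<le> N"
    using cell_position[OF assms(2)] cells_upto_le[of j'] by linarith
  ultimately show ?thesis by (simp add: T0_eq assms)
qed

lemma T0_row_less:
  assumes "(i, j) \<in> diagram tau" "(i', j) \<in> diagram tau" "i < i'"
  shows "T0 tau (i', j) < T0 tau (i, j)"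
  using assms cell_position[OF assms(2)] cells_upto_le[of j] by (simp add: T0_eq)

lemma T0_Ytab: "T0 tau \<in> Ytab tau"
proof -
  have inj: "inj_on (T0 tau) (diagram tau)"
  proof (rule inj_onI)
    fix x y assume xy: "x \<in> diagram tau" "y \<in> diagram tau" "T0 tau x = T0 tau y"
    obtain i j i' j' where [simp]: "x = (i, j)" "y = (i', j')" by (cases x; cases y) auto
    have "j = j'" using xy T0_column_less[of i j i' j'] T0_column_less[of i' j' i j]
      by (cases j j' rule: linorder_cases) auto
    moreover from this have "i = i'" using xy T0_row_less[of i j i'] T0_row_less[of i' j i]
      by (cases i i' rule: linorder_cases) auto
    ultimately show "x = y" by simp
  qed
  have "T0 tau ` diagram tau \<subseteq> {1..N}"
  proof (rule image_subsetI)
    fix x assume x: "x \<in> diagram tau"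
    obtain i j where [simp]: "x = (i, j)" by (cases x)
    show "T0 tau x \<in> {1..N}"
      using x cell_position[of i j] cells_upto_le[of j] by (auto simp: T0_eq diagram_iff)
  qed
  then have "T0 tau ` diagram tau = {1..N}"
    using card_image[OF inj] by (intro card_subset_eq) (auto simp: card_diagram)
  then have "bij_betw (T0 tau) (diagram tau) {1..N}" using inj by (simp add: bij_betw_def)
  then show ?thesis
    using T0_column_less T0_row_less unfolding Ytab_def by (auto simp: T0_def)
qed

lemma content_T0: "(i, j) \<in> diagram tau \<Longrightarrow> content tau (T0 tau) (T0 tau (i, j)) = int j - int i"
  using cell_of_eq[OF Ytab_filling[OF T0_Ytab], of "(i, j)"] by (simp add: content_def row_def col_def)

text \<open>The leg of the cell (1,j) has \<open>col_len j - 1\<close> cells. Integers avoid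
  truncated subtraction.\<close>

lemma hook_first_row:
  assumes "1 \<le> j" "j \<le> part tau 1"
  shows "int (hook tau 1 j) = int (part tau 1) - int j + int (col_len j)"
proof -
  have "1 \<le> length tau" using assms by (auto simp: part_def split: if_splits)
  then have "{1..col_len j} = insert 1 {k. 1 < k \<and> k \<le> length tau \<and> j \<le> part tau k}"
    unfolding col_cells[symmetric] using assms by (auto simp: less_le)
  moreover have "finite {k. 1 < k \<and> k \<le> length tau \<and> j \<le> part tau k}" by simp
  ultimately have "card {1..col_len j} = Suc (card {k. 1 < k \<and> k \<le> length tau \<and> j \<le> part tau k})" by simp
  then show ?thesis using assms by (simp add: hook_def)
qed

section \<open>Telescoping products of linear factors in kappa\<close>

definition kf :: "int \<Rightarrow> K" where
  "kf d = 1 + kappa * of_int d"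

lemma kf_nonzero [simp]: "kf d \<noteq> 0"
  unfolding kf_def by (rule kappa_generic)

lemma kf_factor: "1 - (kappa / kf d)\<^sup>2 = kf (d - 1) * kf (d + 1) / (kf d)\<^sup>2"
proof -
  have "1 - (kappa / kf d)\<^sup>2 = ((kf d)\<^sup>2 - kappa\<^sup>2) / (kf d)\<^sup>2"
    by (simp add: power_divide diff_divide_distrib)
  also have "(kf d)\<^sup>2 - kappa\<^sup>2 = kf (d - 1) * kf (d + 1)"
    by (simp add: kf_def power2_eq_square algebra_simps)
  finally show ?thesis .
qed

text \<open>By \<open>kf_factor\<close> each factor is a second-order quotient of neighbouring
  values of \<open>kf\<close>, so the product telescopes twice and one quotient survives at each
  end.\<close>

lemma kf_column_product:
  "(\<Prod>i=1..n. 1 - (kappa / kf (e + int i))\<^sup>2) = kf e / kf (e + 1) * (kf (e + int n + 1) / kf (e + int n))"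
proof (induction n)
  case (Suc n)
  have "(\<Prod>i=1..Suc n. 1 - (kappa / kf (e + int i))\<^sup>2)
      = kf e / kf (e + 1) * (kf (e + int n + 1) / kf (e + int n)) * (1 - (kappa / kf (e + int (Suc n)))\<^sup>2)"
    using Suc by simp
  also have "1 - (kappa / kf (e + int (Suc n)))\<^sup>2
      = kf (e + int n) * kf (e + int n + 2) / (kf (e + int n + 1) * kf (e + int n + 1))"
    unfolding kf_factor by (simp add: power2_eq_square algebra_simps)
  finally have "(\<Prod>i=1..Suc n. 1 - (kappa / kf (e + int i))\<^sup>2)
      = kf e / kf (e + 1) * (kf (e + int n + 2) / kf (e + int n + 1))"
    by simp
  moreover have "e + int (Suc n) + 1 = e + int n + 2" "e + int (Suc n) = e + int n + 1" by simp_all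
  ultimately show ?case by (simp only:)
qed simp

text \<open>After reversal the product is kf(0) / kf(n), and kf(0) = 1.\<close>

lemma kf_telescope: "(\<Prod>j=1..n. kf (int n - int j) / kf (int n - int j + 1)) = 1 / kf (int n)"
proof -
  have "(\<Prod>j=1..n. kf (int n - int j) / kf (int n - int j + 1)) = (\<Prod>j=1..n. kf (int j - 1) / kf (int j))"
    by (rule prod.reindex_bij_witness[of _ "\<lambda>j. Suc n - j" "\<lambda>j. Suc n - j"]) (auto simp: of_nat_diff algebra_simps)
  also have "\<dots> = 1 / kf (int n)"
  proof (induction n)
    case (Suc n)
    have "int (Suc n) - 1 = int n" by simp
    then have "(\<Prod>j=1..Suc n. kf (int j - 1) / kf (int j)) = 1 / kf (int n) * (kf (int n) / kf (int (Suc n)))"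
      using Suc by simp
    then show ?case by simp
  qed (simp add: kf_def)
  finally show ?thesis .
qed

text \<open>Column j consists of the cells with content difference (n - j) + i, n = tau_1 - 1. The
  upper end of its telescoped product is at the hook length h(1,j); the lower ends multiply to 1 /
  kf(n), which the factor 1 + kappa c(m,T_0) = kf(n) cancels.\<close>

lemma hook_product:
  assumes m: "1 \<le> m" "m \<le> length tau" and len: "2 \<le> part tau 1"
    and eq: "\<forall>i\<in>{1..m}. part tau i = part tau 1" and lt: "part tau (Suc m) < part tau 1"
  shows "(1 + kappa * of_int (content tau (T0 tau) m)) * (\<Prod>l\<in>{Suc m..N}. 1 - (kappa / (1 + kappa *
      (of_int (content tau (T0 tau) m) - of_int (content tau (T0 tau) l))))\<^sup>2)
    = (\<Prod>j=1..part tau 1 - 1. (1 + kappa * of_nat (hook tau 1 j)) / (1 + kappa * (of_nat (hook tau 1 j) - 1)))"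
proof -
  let ?a = "part tau 1" and ?T = "T0 tau"
  define n where "n = ?a - 1"
  have an: "?a = Suc n" "1 \<le> ?a" using len by (auto simp: n_def)
  have "{r \<in> {1..length tau}. ?a \<le> part tau r} = {1..m}"
  proof (intro equalityI subsetI)
    fix r assume r: "r \<in> {r \<in> {1..length tau}. ?a \<le> part tau r}"
    have "r \<le> m"
    proof (rule ccontr)
      assume "\<not> r \<le> m"
      then have "part tau r \<le> part tau (Suc m)" using part_antimono[of "Suc m" r] by simp
      then show False using r lt by simp
    qed
    then show "r \<in> {1..m}" using r by simp
  next
    fix r assume r: "r \<in> {1..m}"
    then have "part tau r = ?a" using eq by blast
    then show "r \<in> {r \<in> {1..length tau}. ?a \<le> part tau r}" using r m by simp
  qed
  then have La: "col_len ?a = m" by (simp add: col_len_def)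
  have cm: "cells_upto n + m = N"
    using cells_upto_minus[OF an(2)] cells_upto_max La by (simp add: n_def)
  have d1: "(1, ?a) \<in> diagram tau" using m an La by (simp add: diagram_iff)
  \<comment> \<open>The last column has exactly m cells and is filled last, so m is its top
    entry.\<close>
  have "?T (1, ?a) = m" using T0_eq[OF d1] cm by (simp add: n_def)
  then have c_m: "content tau ?T m = int n" using content_T0[OF d1] an by simp
  \<comment> \<open>The entries above m are those outside the last column, that is, in columns 1 to
    n.\<close>
  have bij: "bij_betw (\<lambda>(j, i). ?T (i, j)) (SIGMA j:{1..n}. {1..col_len j}) {Suc m..N}"
    unfolding bij_betw_def
  proof
    have inj: "inj_on ?T (diagram tau)"
      using Ytab_filling[OF T0_Ytab] by (simp add: filling_def bij_betw_def)
    show "inj_on (\<lambda>(j, i). ?T (i, j)) (SIGMA j:{1..n}. {1..col_len j})"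
    proof (rule inj_onI)
      fix x y
      assume xy: "x \<in> (SIGMA j:{1..n}. {1..col_len j})" "y \<in> (SIGMA j:{1..n}. {1..col_len j})"
        "(\<lambda>(j, i). ?T (i, j)) x = (\<lambda>(j, i). ?T (i, j)) y"
      obtain j i j' i' where [simp]: "x = (j, i)" "y = (j', i')" by (cases x; cases y) auto
      have "(i, j) \<in> diagram tau" "(i', j') \<in> diagram tau" "?T (i, j) = ?T (i', j')"
        using xy by (auto simp: diagram_iff)
      then have "(i, j) = (i', j')" using inj by (metis inj_onD)
      then show "x = y" by simp
    qed
    show "(\<lambda>(j, i). ?T (i, j)) ` (SIGMA j:{1..n}. {1..col_len j}) = {Suc m..N}"
    proof (intro equalityI subsetI)
      fix l assume "l \<in> (\<lambda>(j, i). ?T (i, j)) ` (SIGMA j:{1..n}. {1..col_len j})"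
      then obtain i j where ij: "1 \<le> j" "j \<le> n" "i \<in> {1..col_len j}" "l = ?T (i, j)" by auto
      then have d: "(i, j) \<in> diagram tau" by (simp add: diagram_iff)
      have "cells_upto (j - 1) + i \<le> cells_upto n"
        using cell_position[OF d] cells_upto_mono[OF ij(2)] by linarith
      then show "l \<in> {Suc m..N}" using ij(3,4) T0_eq[OF d] cm by auto
    next
      fix l assume l: "l \<in> {Suc m..N}"
      obtain i j where ij: "cell_of tau ?T l = (i, j)" by force
      have d: "(i, j) \<in> diagram tau" "?T (i, j) = l"
        using cell_of[OF Ytab_filling[OF T0_Ytab], of l] l ij by auto
      have "j \<le> ?a"
        using d(1) part_antimono[of 1 i] by (auto simp: diagram_def)
      moreover have "j \<noteq> ?a"
      proof
        assume "j = ?a"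
        then have "l = N + 1 - (cells_upto n + i)" "1 \<le> i"
          using T0_eq[OF d(1)] d by (simp_all add: n_def diagram_iff)
        then have "l \<le> m" using cm by linarith
        then show False using l by simp
      qed
      ultimately have "(j, i) \<in> (SIGMA j:{1..n}. {1..col_len j})" using d(1) an by (auto simp: diagram_iff)
      then show "l \<in> (\<lambda>(j, i). ?T (i, j)) ` (SIGMA j:{1..n}. {1..col_len j})"
        using d(2) by force
    qed
  qed
  have "(\<Prod>l\<in>{Suc m..N}. 1 - (kappa / kf (int n - content tau ?T l))\<^sup>2)
      = (\<Prod>(j, i)\<in>(SIGMA j:{1..n}. {1..col_len j}). 1 - (kappa / kf (int n - content tau ?T (?T (i, j))))\<^sup>2)"
    using prod.reindex_bij_betw[OF bij, of "\<lambda>l. 1 - (kappa / kf (int n - content tau ?T l))\<^sup>2"]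
    by (simp add: case_prod_beta)
  also have "\<dots> = (\<Prod>(j, i)\<in>(SIGMA j:{1..n}. {1..col_len j}). 1 - (kappa / kf (int n - int j + int i))\<^sup>2)"
    by (intro prod.cong refl) (auto simp: content_T0 diagram_iff algebra_simps)
  also have "\<dots> = (\<Prod>j=1..n. \<Prod>i=1..col_len j. 1 - (kappa / kf (int n - int j + int i))\<^sup>2)"
    by (subst prod.Sigma) auto
  also have "\<dots> = (\<Prod>j=1..n. kf (int n - int j) / kf (int n - int j + 1)
      * (kf (int (hook tau 1 j)) / kf (int (hook tau 1 j) - 1)))"
  proof (intro prod.cong refl)
    fix j assume j: "j \<in> {1..n}"
    then have h: "int (hook tau 1 j) = int n - int j + int (col_len j) + 1"
      using hook_first_row[of j] an by simp
    show "(\<Prod>i=1..col_len j. 1 - (kappa / kf (int n - int j + int i))\<^sup>2)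
      = kf (int n - int j) / kf (int n - int j + 1) * (kf (int (hook tau 1 j)) / kf (int (hook tau 1 j) - 1))"
      unfolding kf_column_product h by simp
  qed
  also have "\<dots> = 1 / kf (int n) * (\<Prod>j=1..n. kf (int (hook tau 1 j)) / kf (int (hook tau 1 j) - 1))"
    unfolding prod.distrib kf_telescope ..
  finally have "kf (int n) * (\<Prod>l\<in>{Suc m..N}. 1 - (kappa / kf (int n - content tau ?T l))\<^sup>2)
      = (\<Prod>j=1..n. kf (int (hook tau 1 j)) / kf (int (hook tau 1 j) - 1))"
    by simp
  then show ?thesis unfolding c_m n_def[symmetric] by (simp add: kf_def)
qed

end

theorem theorem7p5:
  fixes tau :: "nat list" and N m :: nat
  assumes "is_partition tau N"
    and "2 \<le> part tau 1"
    and "1 \<le> m" and "m \<le> length tau"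
    and "\<forall>i\<in>{1..m}. part tau i = part tau 1"
    and "part tau (Suc m) < part tau 1"
  shows "Dop tau m (zeta tau (\<lambda>k. if 1 \<le> k \<and> k \<le> m then 1 else 0) (T0 tau)) =
    smult_el (\<Prod>j=1..part tau 1 - 1.
        (1 + kappa * of_nat (hook tau 1 j)) / (1 + kappa * (of_nat (hook tau 1 j) - 1)))
      (act tau (inv (word_prod [1..<m]))
         (zeta tau (\<lambda>k. if 2 \<le> k \<and> k \<le> m then 1 else 0) (T0 tau)))"
proof -
  have N: "N = sum_list tau" using assms(1) by (simp add: is_partition_def)
  interpret young tau using assms(1) unfolding N by unfold_locales
  let ?T = "T0 tau" and ?N = "sum_list tau"
  let ?lam = "\<Prod>j=1..part tau 1 - 1.
        (1 + kappa * of_nat (hook tau 1 j)) / (1 + kappa * (of_nat (hook tau 1 j) - 1))"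
  \<comment> \<open>Each of the first m rows contains a cell, so m \<le> N.\<close>
  have "(\<Sum>r\<in>{1..m}. 1) \<le> (\<Sum>r\<in>{1..m}. part tau r)"
  proof (intro sum_mono)
    fix r assume "r \<in> {1..m}"
    then have "part tau r = part tau 1" using assms(5) by blast
    then show "1 \<le> part tau r" using assms(2) by simp
  qed
  also have "\<dots> \<le> (\<Sum>r\<in>{1..length tau}. part tau r)"
    using assms(4) by (intro sum_mono2) auto
  finally have m: "m \<le> ?N" by (simp add: sum_part)
  obtain h where h: "solution m (spec m ?T) (basis ?T) [1..<Suc ?N] h"
    using exists_solution_upt[OF T0_Ytab m] by blast
  have "\<exists>G. solution (m - 1) (spec (m - 1) ?T) (basis ?T)
      ([Suc (m - 1)..<Suc m] @ [1..<Suc (m - 1)] @ [Suc m..<Suc ?N]) G"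
    using m by (intro exists_solution[OF T0_Ytab]) auto
  then obtain G where G: "solution (m - 1) (spec (m - 1) ?T) (basis ?T) ([m] @ [1..<m] @ [Suc m..<Suc ?N]) G"
    using assms(3) by (auto simp del: upt_Suc simp: upt_rec[of m "Suc m"])
  have th: "word_prod [1..<m] permutes {1..?N}" using m by (intro word_prod_permutes) auto
  have exps: "(\<lambda>k. if 1 \<le> k \<and> k \<le> m then 1 else 0) = ind {1..m}"
    "(\<lambda>k. if 2 \<le> k \<and> k \<le> m then 1 else 0) = ind {2..m}"
    by (auto simp: ind_def fun_eq_iff)
  note initial = zeta_initial[OF T0_Ytab assms(3) m h]
  note shifted = zeta_shifted[OF T0_Ytab assms(3) m G]
  have "valued (sact (word_prod [1..<m]) G)" using shifted(1) by (simp add: valued_def sact_def inV_yrep)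
  then have "act tau (inv (word_prod [1..<m])) (zeta tau (ind {2..m}) ?T)
      = sqf_elem (sact (inv (word_prod [1..<m])) (sact (word_prod [1..<m]) G))"
    unfolding shifted(2) by (intro act_sqf_elem permutes_inv[OF th])
  \<comment> \<open>The inverse of theta_m in the claim undoes the theta_m by which the second zeta
    was obtained from G.\<close>
  also have "sact (inv (word_prod [1..<m])) (sact (word_prod [1..<m]) G) = G"
    unfolding sact_comp[OF permutes_inv[OF th] th, symmetric] permutes_inv_o(2)[OF th] by (rule sact_id)
  finally have rhs: "act tau (inv (word_prod [1..<m])) (zeta tau (ind {2..m}) ?T) = sqf_elem G" .
  have "sD m h R = smult_vec ?lam (G R)" for R
    using sD_solution[OF T0_Ytab assms(3) m h G, of R]
    unfolding hook_product[OF assms(3,4,2,5,6)] .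
  then have "sqf_elem (sD m h) = smult_el ?lam (sqf_elem G)"
    by (intro sqf_elem_eqI[symmetric])
      (simp_all add: smult_el_def smult_vec_def sqf_elem_not_ind zero_fun_def)
  moreover have "Dop tau m (zeta tau (ind {1..m}) ?T) = sqf_elem (sD m h)"
    unfolding initial(2) using assms(3) m by (intro Dop_sqf_elem initial(1)) auto
  ultimately show ?thesis unfolding exps rhs by simp
qed

end
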